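(* Let $\mathcal L$ be the operator in $L_2(\mathbb R^d)$ given by $(\mathcal L u)(x)=\int_{\mathbb R^d}a(x-y)u(y)\,dy+V(x)u(x)$, where $a$ and $V$ satisfy the standing assumptions in the context. Let $\mu_0=V_{\min}$, and assume that $V_{\min}\le a_{\min}$ and that the integrals $$I_V:=\int_{\mathbb R^d}\frac{V_-(x)\,dx}{V_-(x)+V_{\min}},\qquad I_a:=\frac{1}{(2\pi)^d}\int_{\mathbb R^d}\frac{\hat a_-(x)\,dx}{\hat a_-(x)+V_{\min}}$$ are finite, where $V_-(x):=-\min\{0,V(x)\}$ and $\hat a_-(x):=-\min\{0,\hat a(x)\}$. Then the number of eigenvalues (counted with multiplicity) of $\mathcal L$ below $\mu_0$ does not exceed $I_aI_V$.
   Context: Let $d\ge 1$. Standing assumptions: $a\in L_1(\mathbb R^d)$ is complex-valued with $a(-x)=\overline{a(x)}$; $V=\mathcal F[\hat V]$ for some $\hat V\in L_1(\mathbb R^d)$ with $\hat V(-x)=\overline{\hat V(x)}$, where $\mathcal F[u](x):=\int_{\mathbb R^d}u(\xi)e^{-\mathrm i x\cdot\xi}\,d\xi$. Put $\hat a:=\mathcal F[a]$. Then $\hat a$ and $V$ are real-valued, bounded, continuous and tend to zero at infinity. Define $a_{\min}:=\inf_{\mathbb R^d}\hat a$, $V_{\min}:=\inf_{\mathbb R^d}V$ and $\mu_0:=\min\{a_{\min},V_{\min}\}$. The operator $\mathcal L$ is bounded and self-adjoint in $L_2(\mathbb R^d)$. Since $0\le V_-\le -V_{\min}$ and $0\le\hat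 a_-\le -V_{\min}$, both integrands take values in $[-\infty,0]$: an integrand is understood as $0$ where its numerator vanishes and as $-\infty$ where its numerator is positive and its denominator is zero. Finiteness of $I_V$ and $I_a$ means $-\infty<I_V\le 0$ and $-\infty<I_a\le 0$, so the product $I_aI_V$ is nonnegative. *)

theory Defs
  imports "HOL-Analysis.Analysis"
begin

section \<open>Fourier transform\<close>

definition fourier :: "('a::euclidean_space \<Rightarrow> complex) \<Rightarrow> 'a \<Rightarrow> complex" where
  "fourier u x = (LINT \<xi>|lborel. u \<xi> * exp (- (\<i> * complex_of_real (x \<bullet> \<xi>))))"

text \<open>
  Elements of L1 are represented by Borel functions, so the symmetry is only required
  almost everywhere.
\<close>

definition hermitian_ae :: "('a::euclidean_space \<Rightarrow> complex) \<Rightarrow> bool" where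
  "hermitian_ae u \<longleftrightarrow> (AE x in lborel. u (- x) = cnj (u x))"

text \<open>
  The transform of a Hermitian symmetric function is real-valued; this is what makes the
  real parts taken in the definitions below harmless.
\<close>

lemma fourier_hermitian_real:
  fixes u :: "'a::euclidean_space \<Rightarrow> complex"
  assumes "integrable lborel u" "hermitian_ae u"
  shows "fourier u x = complex_of_real (Re (fourier u x))"
proof -
  let ?e = "\<lambda>\<xi>::'a. exp (- (\<i> * complex_of_real (x \<bullet> \<xi>)))"
  have um[measurable]: "u \<in> borel_measurable borel"
    using borel_measurable_integrable[OF assms(1)] by simp
  have em[measurable]: "?e \<in> borel_measurable borel"
    by (intro borel_measurable_continuous_onI continuous_intros)
  have [measurable]: "(\<lambda>\<xi>::'a. exp (\<i> * complex_of_real (x \<bullet> \<xi>))) \<in> borel_measurable borel"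
    by (intro borel_measurable_continuous_onI continuous_intros)
  have [measurable]: "cnj \<in> borel_measurable borel"
    by (intro borel_measurable_continuous_onI continuous_intros)
  have refl: "distr lborel borel uminus = (lborel :: 'a measure)"
    using lborel_affine[of "-1" "0::'a"] by (simp add: density_1)
  have "fourier u x = (LINT \<xi>|distr lborel borel uminus. u \<xi> * ?e \<xi>)"
    by (simp only: refl fourier_def)
  also have "\<dots> = (LINT \<xi>|lborel. u (- \<xi>) * ?e (- \<xi>))"
    by (rule integral_distr) measurable
  also have "\<dots> = (LINT \<xi>|lborel. cnj (u \<xi> * ?e \<xi>))"
    using assms(2) by (intro integral_cong_AE) (auto simp: hermitian_ae_def exp_cnj)
  also have "\<dots> = cnj (fourier u x)"
    by (simp only: fourier_def Bochner_Integration.integral_cnj)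
  finally show ?thesis
    by (simp add: complex_eq_iff)
qed


section \<open>Eigenvalues of operators in L2\<close>

text \<open>
  L2 consists of classes of functions modulo equality almost everywhere. We work with
  representatives: an operator acts on functions, and equations between elements of L2, including
  those expressing that a vector is zero or that vectors are linearly dependent, hold
  almost everywhere.
\<close>

definition L2 :: "('a::euclidean_space \<Rightarrow> complex) set" where
  "L2 = {u \<in> borel_measurable lborel. integrable lborel (\<lambda>x. (cmod (u x))\<^sup>2)}"

definition eigenspace ::
  "(('a::euclidean_space \<Rightarrow> complex) \<Rightarrow> 'a \<Rightarrow> complex) \<Rightarrow> complex \<Rightarrow> ('a \<Rightarrow> complex) set" where
  "eigenspace T l = {u \<in> L2. AE x in lborel. T u x = l * u x}"

definition eigenvalue ::
  "(('a::euclidean_space \<Rightarrow> complex) \<Rightarrow> 'a \<Rightarrow> complex) \<Rightarrow> complex \<Rightarrow> bool" where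
  "eigenvalue T l \<longleftrightarrow> (\<exists>u \<in> eigenspace T l. \<not> (AE x in lborel. u x = 0))"

definition lin_indep_ae :: "nat \<Rightarrow> (nat \<Rightarrow> 'a::euclidean_space \<Rightarrow> complex) \<Rightarrow> bool" where
  "lin_indep_ae n f \<longleftrightarrow>
     (\<forall>c. (AE x in lborel. (\<Sum>i<n. c i * f i x) = 0) \<longrightarrow> (\<forall>i<n. c i = 0))"

text \<open>
  The dimension of the eigenspace as a subspace of L2; it equals \<open>\<infinity>\<close> for an eigenspace of
  infinite dimension.
\<close>

definition multiplicity_ev ::
  "(('a::euclidean_space \<Rightarrow> complex) \<Rightarrow> 'a \<Rightarrow> complex) \<Rightarrow> complex \<Rightarrow> enat" where
  "multiplicity_ev T l =
     Sup {enat n |n. \<exists>f. (\<forall>i<n. f i \<in> eigenspace T l) \<and> lin_indep_ae n f}"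

text \<open>
  Every family in \<^typ>\<open>enat\<close> is summable, so an infinite set of eigenvalues gives \<open>\<infinity>\<close>.
\<close>

definition num_eigenvalues_below ::
  "(('a::euclidean_space \<Rightarrow> complex) \<Rightarrow> 'a \<Rightarrow> complex) \<Rightarrow> real \<Rightarrow> enat" where
  "num_eigenvalues_below T m =
     (\<Sum>\<^sub>\<infinity>l \<in> {l::real. l < m \<and> eigenvalue T (complex_of_real l)}.
        multiplicity_ev T (complex_of_real l))"


section \<open>The operator and the integrals\<close>

text \<open>
  For \<open>a\<close> in L1 and \<open>u\<close> in L2 the convolution integral converges absolutely for almost all \<open>x\<close>.
\<close>

definition conv_pot_op ::
  "('a::euclidean_space \<Rightarrow> complex) \<Rightarrow> ('a \<Rightarrow> complex) \<Rightarrow> ('a \<Rightarrow> complex) \<Rightarrow> 'a \<Rightarrow> complex" where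
  "conv_pot_op a V u x = (LINT y|lborel. a (x - y) * u y) + V x * u x"

definition inf_val :: "('a::euclidean_space \<Rightarrow> complex) \<Rightarrow> real" where
  "inf_val f = (INF x. Re (f x))"

definition minus_part :: "('a::euclidean_space \<Rightarrow> complex) \<Rightarrow> 'a \<Rightarrow> real" where
  "minus_part f x = - min 0 (Re (f x))"

text \<open>
  The quotient \<open>t / (t + m)\<close> for \<open>0 \<le> t \<le> - m\<close>, with values in \<open>[-\<infinity>, 0]\<close>. The value at a
  vanishing denominator has to be given explicitly, since division by zero yields \<open>0\<close> in
  \<^typ>\<open>real\<close> and \<open>+\<infinity>\<close> (for a positive numerator) in \<^typ>\<open>ereal\<close>.
\<close>

definition ext_quot :: "real \<Rightarrow> real \<Rightarrow> ereal" where
  "ext_quot t m = (if t = 0 then 0 else if t + m = 0 then - \<infinity> else ereal (t / (t + m)))"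

text \<open>
  The integral of a function with values in \<open>[-\<infinity>, 0]\<close> is minus the integral of its negative.
\<close>

definition nonpos_integral :: "('a::euclidean_space \<Rightarrow> ereal) \<Rightarrow> ereal" where
  "nonpos_integral g = - enn2ereal (\<integral>\<^sup>+x. e2ennreal (- g x) \<partial>lborel)"

definition I_V :: "('a::euclidean_space \<Rightarrow> complex) \<Rightarrow> ereal" where
  "I_V V = nonpos_integral (\<lambda>x. ext_quot (minus_part V x) (inf_val V))"

definition I_a :: "('a::euclidean_space \<Rightarrow> complex) \<Rightarrow> ('a \<Rightarrow> complex) \<Rightarrow> ereal" where
  "I_a a V = ereal (1 / (2 * pi) ^ DIM('a)) *
     nonpos_integral (\<lambda>\<xi>. ext_quot (minus_part (fourier a) \<xi>) (inf_val V))"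

end

theory Submission
  imports Defs "HOL-Probability.Characteristic_Functions"
begin

text \<open>
  Let \<open>m = - V_min\<close>, \<open>p\<close> and \<open>q\<close> the negative parts of \<open>fourier a\<close> and \<open>V\<close>, and \<open>P\<close> the Fourier
  multiplier with symbol \<open>p\<close>. Eigenfunctions for eigenvalues below \<open>- m\<close> span a space on which
  the form of \<open>L + m\<close> is negative definite, hence \<open>\<langle>(m - q) \<psi>, \<psi>\<rangle> < \<langle>P \<psi>, \<psi>\<rangle>\<close>. With
  \<open>\<chi> = P \<psi>\<close>, the inequality \<open>2 \<langle>\<chi>, \<psi>\<rangle> \<le> \<integral> \<bar>\<chi>\<bar>\<^sup>2 / (m - q) + \<langle>(m - q) \<psi>, \<psi>\<rangle>\<close> turns this into
  \<open>\<langle>P \<psi>, \<psi>\<rangle> < \<integral> \<bar>\<chi>\<bar>\<^sup>2 / (m - q)\<close>. Since \<open>m / (m - q) = 1 + W\<close> for \<open>W = q / (m - q)\<close>, this says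
  \<open>\<parallel>f\<parallel>\<^sup>2 < \<integral> W \<bar>\<chi>\<bar>\<^sup>2\<close>, where \<open>f\<close> is \<open>sqrt (p (m - p))\<close> times the transform of \<open>\<psi>\<close>. But \<open>\<chi>\<close> is the
  inverse transform of \<open>sqrt R f\<close> with \<open>R = p / (m - p)\<close>, so \<open>f \<mapsto> sqrt W \<chi>\<close> is a Hilbert-Schmidt
  operator that expands an \<open>n\<close>-dimensional space. Summing over an orthonormal basis of that space
  and applying Bessel's inequality bounds \<open>n\<close> by the square of its Hilbert-Schmidt norm, which is
  \<open>I_a I_V\<close>. Replacing the eigenfunctions by nearby test functions keeps the form negative
  definite, so that only integrable continuous functions have to be transformed.
\<close>

section \<open>Orthonormal families in L2\<close>

text \<open>The obstacle is that neither \<open>m - p\<close> nor \<open>m - q\<close> grows at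
  infinity: \<open>p\<close> and \<open>q\<close> tend to 0 there. The usual Birman-Schwinger
  operator, with kinetic term \<open>m - p\<close> and perturbation \<open>q\<close>, contains
  multiplication by \<open>q / m\<close>, because \<open>1 / (m - p) = (1 + R) / m\<close>; it is
  not compact unless \<open>q\<close> vanishes, so its Hilbert-Schmidt norm is useless. Completing
  the square against \<open>m - q\<close> isolates the corresponding constant 1 in
  \<open>m / (m - q)\<close>. Its contribution is the squared norm of \<open>P \<psi>\<close>, which
  involves \<open>P\<close> alone and can be subtracted from \<open>m\<close> times the form of
  \<open>P\<close>. This leaves the symbol \<open>p (m - p)\<close> on one side and only the
  integrable weight \<open>W\<close> on the other. Dividing \<open>p\<close> by the square root of
  \<open>p (m - p)\<close> then produces the square root of \<open>R\<close>, so \<open>p\<close>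
  and \<open>q\<close> enter the bound symmetrically although they are treated differently. The
  modulus of the resulting kernel is a function of \<open>x\<close> times a function of the
  frequency, which is why the squared Hilbert-Schmidt norm is exactly a product of two
  integrals.\<close>

definition L2_inner :: "('a::euclidean_space \<Rightarrow> complex) \<Rightarrow> ('a \<Rightarrow> complex) \<Rightarrow> complex" where
  "L2_inner u v = (LINT x|lborel. u x * cnj (v x))"

lemma borel_measurable_cnj[measurable]: "cnj \<in> borel_measurable borel"
  by (intro borel_measurable_continuous_onI continuous_intros)

lemma L2_measurable: "u \<in> L2 \<Longrightarrow> u \<in> borel_measurable borel"
  by (simp add: L2_def)

lemma L2_square_integrable: "u \<in> L2 \<Longrightarrow> integrable lborel (\<lambda>x. (cmod (u x))\<^sup>2)"
  by (simp add: L2_def)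

lemma L2_I:
  "u \<in> borel_measurable borel \<Longrightarrow> integrable lborel (\<lambda>x. (cmod (u x))\<^sup>2) \<Longrightarrow> u \<in> L2"
  by (simp add: L2_def)

lemma L2_dominated:
  assumes "v \<in> L2" and [measurable]: "u \<in> borel_measurable borel"
    and "AE x in lborel. cmod (u x) \<le> C * cmod (v x)"
  shows "u \<in> L2"
proof (rule L2_I)
  show "integrable lborel (\<lambda>x. (cmod (u x))\<^sup>2)"
  proof (rule Bochner_Integration.integrable_bound)
    show "integrable lborel (\<lambda>x. C\<^sup>2 * (cmod (v x))\<^sup>2)"
      by (intro integrable_mult_right L2_square_integrable assms)
    show "AE x in lborel. norm ((cmod (u x))\<^sup>2) \<le> norm (C\<^sup>2 * (cmod (v x))\<^sup>2)"
      using assms(3)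
    proof eventually_elim
      case (elim x)
      then have "(cmod (u x))\<^sup>2 \<le> (C * cmod (v x))\<^sup>2"
        by (intro power_mono) auto
      then show ?case by (simp add: power_mult_distrib)
    qed
  qed measurable
qed fact

lemma L2_cmult: "u \<in> L2 \<Longrightarrow> (\<lambda>x. c * u x) \<in> L2"
  by (rule L2_dominated[where C="cmod c" and v=u])
    (auto simp: norm_mult intro!: borel_measurable_times dest: L2_measurable)

lemma norm_add_square_le: "(norm (x + y))\<^sup>2 \<le> 2 * (norm x)\<^sup>2 + 2 * (norm y)\<^sup>2"
proof -
  have "(norm (x + y))\<^sup>2 \<le> (norm x + norm y)\<^sup>2"
    by (intro power_mono norm_triangle_ineq norm_ge_zero)
  also have "\<dots> \<le> 2 * (norm x)\<^sup>2 + 2 * (norm y)\<^sup>2"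
    using zero_le_power2[of "norm x - norm y"] by (simp add: power2_eq_square algebra_simps)
  finally show ?thesis .
qed

lemma L2_add:
  assumes "u \<in> L2" "v \<in> L2"
  shows "(\<lambda>x. u x + v x) \<in> L2"
proof (rule L2_I)
  note [measurable] = assms[THEN L2_measurable]
  show "(\<lambda>x. u x + v x) \<in> borel_measurable borel" by measurable
  show "integrable lborel (\<lambda>x. (cmod (u x + v x))\<^sup>2)"
    by (rule Bochner_Integration.integrable_bound
        [where f="\<lambda>x. 2 * (cmod (u x))\<^sup>2 + 2 * (cmod (v x))\<^sup>2"])
      (use assms norm_add_square_le in \<open>auto intro!: Bochner_Integration.integrable_add
        integrable_mult_right L2_square_integrable\<close>)
qed

lemma L2_zero: "(\<lambda>x. 0) \<in> L2"
  by (simp add: L2_def)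

lemma L2_sum: "(\<And>i. i \<in> A \<Longrightarrow> f i \<in> L2) \<Longrightarrow> (\<lambda>x. \<Sum>i\<in>A. f i x) \<in> L2"
  by (induction A rule: infinite_finite_induct) (auto simp: L2_zero L2_add)

lemma L2_lincomb: "(\<And>i. i \<in> A \<Longrightarrow> f i \<in> L2) \<Longrightarrow> (\<lambda>x. \<Sum>i\<in>A. c i * f i x) \<in> L2"
  by (intro L2_sum L2_cmult)

lemma L2_diff: "u \<in> L2 \<Longrightarrow> v \<in> L2 \<Longrightarrow> (\<lambda>x. u x - v x) \<in> L2"
  using L2_add[of u "\<lambda>x. - 1 * v x"] L2_cmult[of v "- 1"] by simp

lemma L2_integrable_mult:
  assumes "u \<in> L2" "v \<in> L2"
  shows "integrable lborel (\<lambda>x. u x * v x)"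
proof (rule Bochner_Integration.integrable_bound)
  note [measurable] = assms[THEN L2_measurable]
  show "integrable lborel (\<lambda>x. (cmod (u x))\<^sup>2 + (cmod (v x))\<^sup>2)"
    by (intro Bochner_Integration.integrable_add L2_square_integrable assms)
  show "(\<lambda>x. u x * v x) \<in> borel_measurable lborel" by measurable
  have "a * b \<le> a\<^sup>2 + b\<^sup>2" for a b :: real
    using sum_squares_bound[of a b] zero_le_power2[of a] zero_le_power2[of b] by linarith
  then show "AE x in lborel. norm (u x * v x) \<le> norm ((cmod (u x))\<^sup>2 + (cmod (v x))\<^sup>2)"
    by (auto simp: norm_mult)
qed

lemma L2_integrable_mult_cnj:
  assumes "u \<in> L2" "v \<in> L2"
  shows "integrable lborel (\<lambda>x. u x * cnj (v x))"
proof (rule L2_integrable_mult)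
  show "(\<lambda>x. cnj (v x)) \<in> L2"
    using assms(2) by (auto simp: L2_def)
qed fact

lemma L2_inner_cnj: "L2_inner v u = cnj (L2_inner u v)"
  unfolding L2_inner_def Bochner_Integration.integral_cnj[symmetric] by (simp add: mult.commute)

lemma L2_inner_self: "L2_inner u u = complex_of_real (LINT x|lborel. (cmod (u x))\<^sup>2)"
  unfolding L2_inner_def integral_complex_of_real[symmetric]
  by (simp add: complex_norm_square[symmetric])

lemma L2_inner_cmult_left: "L2_inner (\<lambda>x. c * u x) v = c * L2_inner u v"
  by (simp add: L2_inner_def mult.assoc)

lemma L2_inner_diff_left:
  "u \<in> L2 \<Longrightarrow> v \<in> L2 \<Longrightarrow> w \<in> L2 \<Longrightarrow>
    L2_inner (\<lambda>x. u x - v x) w = L2_inner u w - L2_inner v w"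
  by (simp add: L2_inner_def left_diff_distrib L2_integrable_mult_cnj)

lemma L2_inner_diff_right:
  "u \<in> L2 \<Longrightarrow> v \<in> L2 \<Longrightarrow> w \<in> L2 \<Longrightarrow>
    L2_inner w (\<lambda>x. u x - v x) = L2_inner w u - L2_inner w v"
  by (subst (1 2 3) L2_inner_cnj) (simp add: L2_inner_diff_left)

lemma L2_inner_sum_left:
  assumes "\<And>i. i \<in> A \<Longrightarrow> f i \<in> L2" "g \<in> L2"
  shows "L2_inner (\<lambda>x. \<Sum>i\<in>A. c i * f i x) g = (\<Sum>i\<in>A. c i * L2_inner (f i) g)"
  unfolding L2_inner_def sum_distrib_right
  by (subst Bochner_Integration.integral_sum)
    (auto simp: mult.assoc intro!: L2_integrable_mult_cnj assms)

lemma L2_inner_sum_right: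
  assumes "\<And>i. i \<in> A \<Longrightarrow> f i \<in> L2" "g \<in> L2"
  shows "L2_inner g (\<lambda>x. \<Sum>i\<in>A. c i * f i x) = (\<Sum>i\<in>A. cnj (c i) * L2_inner g (f i))"
proof -
  have "L2_inner g (\<lambda>x. \<Sum>i\<in>A. c i * f i x) = cnj (\<Sum>i\<in>A. c i * L2_inner (f i) g)"
    by (subst L2_inner_cnj) (simp add: L2_inner_sum_left assms)
  also have "\<dots> = (\<Sum>i\<in>A. cnj (c i) * L2_inner g (f i))"
    by (simp add: L2_inner_cnj[symmetric])
  finally show ?thesis .
qed

lemma L2_inner_cong_AE:
  assumes "AE x in lborel. u x = u' x" and "u \<in> borel_measurable borel" "u' \<in> borel_measurable borel"
    "v \<in> borel_measurable borel"
  shows "L2_inner u v = L2_inner u' v"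
  unfolding L2_inner_def by (rule integral_cong_AE) (use assms in auto)

lemma L2_inner_self_eq_0_iff:
  assumes "u \<in> L2"
  shows "L2_inner u u = 0 \<longleftrightarrow> (AE x in lborel. u x = 0)"
proof -
  have "L2_inner u u = 0 \<longleftrightarrow> (LINT x|lborel. (cmod (u x))\<^sup>2) = 0"
    by (simp only: L2_inner_self of_real_eq_0_iff)
  also have "\<dots> \<longleftrightarrow> (AE x in lborel. (cmod (u x))\<^sup>2 = 0)"
    by (rule integral_nonneg_eq_0_iff_AE) (auto intro: L2_square_integrable assms)
  finally show ?thesis by simp
qed

section \<open>Bessel's inequality and Gram-Schmidt orthonormalisation\<close>

definition orthonormal_family :: "nat \<Rightarrow> (nat \<Rightarrow> 'a::euclidean_space \<Rightarrow> complex) \<Rightarrow> bool" where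
  "orthonormal_family n e \<longleftrightarrow>
     (\<forall>i<n. e i \<in> L2) \<and> (\<forall>i<n. \<forall>j<n. L2_inner (e i) (e j) = (if i = j then 1 else 0))"

text \<open>The projection residual is used twice: its squared norm is the defect in Bessel's
  inequality, and its normalisation is the next Gram-Schmidt vector.\<close>

lemma residual_orthogonal:
  assumes e: "orthonormal_family n e" and u: "u \<in> L2" and j: "j < n"
  shows "L2_inner (\<lambda>x. u x - (\<Sum>i<n. L2_inner u (e i) * e i x)) (e j) = 0"
proof -
  have "L2_inner (\<lambda>x. u x - (\<Sum>i<n. L2_inner u (e i) * e i x)) (e j) =
      L2_inner u (e j) - (\<Sum>i<n. L2_inner u (e i) * L2_inner (e i) (e j))"
    using e j u
    by (subst L2_inner_diff_left, (auto simp: orthonormal_family_def intro!: L2_lincomb)[3])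
      (subst L2_inner_sum_left, auto simp: orthonormal_family_def)
  also have "(\<Sum>i<n. L2_inner u (e i) * L2_inner (e i) (e j)) =
      (\<Sum>i<n. if i = j then L2_inner u (e i) else 0)"
    using e j by (intro sum.cong) (auto simp: orthonormal_family_def)
  finally show ?thesis using j by simp
qed

lemma bessel_inequality:
  assumes e: "orthonormal_family n e" and u: "u \<in> L2"
  shows "(\<Sum>i<n. (cmod (L2_inner u (e i)))\<^sup>2) \<le> (LINT x|lborel. (cmod (u x))\<^sup>2)"
proof -
  define b where "b i = L2_inner u (e i)" for i
  define r where "r x = u x - (\<Sum>i<n. b i * e i x)" for x
  have eL: "\<And>i. i \<in> {..<n} \<Longrightarrow> e i \<in> L2" using e by (auto simp: orthonormal_family_def)
  have rL: "r \<in> L2" unfolding r_def by (intro L2_diff u L2_lincomb eL)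
  have ro: "L2_inner r (e j) = 0" if "j < n" for j
    unfolding r_def b_def by (rule residual_orthogonal[OF e u that])
  \<comment> \<open>Since \<open>r\<close> is orthogonal to every \<open>e i\<close>, the second
    factor \<open>r\<close> can be replaced by \<open>u\<close>; the squared norm of
    \<open>r\<close> then becomes the difference of the two sides.\<close>
  have "L2_inner r r = L2_inner r u - L2_inner r (\<lambda>x. \<Sum>i<n. b i * e i x)"
    by (subst (2) r_def[abs_def]) (intro L2_inner_diff_right u L2_lincomb eL rL)
  also have "L2_inner r (\<lambda>x. \<Sum>i<n. b i * e i x) = 0"
    by (subst L2_inner_sum_right) (auto simp: eL rL ro)
  also have "L2_inner r u = L2_inner u u - (\<Sum>i<n. b i * L2_inner (e i) u)"
    unfolding r_def
    by (subst L2_inner_diff_left, (auto simp: eL u intro!: L2_lincomb)[3])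
      (subst L2_inner_sum_left, auto simp: eL u)
  also have "(\<Sum>i<n. b i * L2_inner (e i) u) = (\<Sum>i<n. complex_of_real ((cmod (b i))\<^sup>2))"
    by (intro sum.cong refl) (subst L2_inner_cnj, simp add: b_def complex_norm_square[symmetric])
  finally have "complex_of_real (LINT x|lborel. (cmod (r x))\<^sup>2) =
      complex_of_real ((LINT x|lborel. (cmod (u x))\<^sup>2) - (\<Sum>i<n. (cmod (b i))\<^sup>2))"
    by (simp add: L2_inner_self)
  then have "(LINT x|lborel. (cmod (r x))\<^sup>2) =
      (LINT x|lborel. (cmod (u x))\<^sup>2) - (\<Sum>i<n. (cmod (b i))\<^sup>2)"
    by (simp only: of_real_eq_iff)
  moreover have "0 \<le> (LINT x|lborel. (cmod (r x))\<^sup>2)" by simp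
  ultimately show ?thesis by (simp add: b_def)
qed

text \<open>The coefficients are kept in the conclusion because they are reused: sesquilinear forms
  are expanded in them, and they are applied again to the test functions from which the family
  \<open>f\<close> is built.\<close>

lemma gram_schmidt_ae:
  assumes "\<And>i. i < n \<Longrightarrow> f i \<in> L2" and "lin_indep_ae n f"
  shows "\<exists>C. orthonormal_family n (\<lambda>i x. \<Sum>k<n. C i k * f k x)"
  using assms
proof (induction n)
  case 0
  show ?case by (simp add: orthonormal_family_def)
next
  case (Suc n)
  have "lin_indep_ae n f"
    unfolding lin_indep_ae_def
  proof (intro allI impI)
    fix c :: "nat \<Rightarrow> complex" and i
    assume c: "AE x in lborel. (\<Sum>i<n. c i * f i x) = 0" and i: "i < n"
    have "AE x in lborel. (\<Sum>i<Suc n. (if i < n then c i else 0) * f i x) = 0"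
      using c by simp
    then have "(if i < n then c i else 0) = 0"
      using Suc.prems(2)[unfolded lin_indep_ae_def, THEN spec, of "\<lambda>i. if i < n then c i else 0"] i
      by (meson less_SucI)
    then show "c i = 0" using i by simp
  qed
  then obtain C where C: "orthonormal_family n (\<lambda>i x. \<Sum>k<n. C i k * f k x)"
    using Suc.IH Suc.prems(1) by force
  define e where "e i x = (\<Sum>k<n. C i k * f k x)" for i x
  have e: "orthonormal_family n e" using C by (simp add: e_def[abs_def])
  define b where "b i = L2_inner (f n) (e i)" for i
  define r where "r x = f n x - (\<Sum>i<n. b i * e i x)" for x
  have eL: "\<And>i. i \<in> {..<n} \<Longrightarrow> e i \<in> L2" using e by (auto simp: orthonormal_family_def)
  have fn: "f n \<in> L2" using Suc.prems(1) by simp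
  have rL: "r \<in> L2" unfolding r_def by (intro L2_diff fn L2_lincomb eL)
  have ro: "L2_inner r (e j) = 0" if "j < n" for j
    unfolding r_def b_def by (rule residual_orthogonal[OF e fn that])
  \<comment> \<open>\<open>D\<close> expresses the residual in the original family. Its entry at
    \<open>n\<close> is 1, so independence forbids a residual that vanishes almost
    everywhere.\<close>
  define D where "D k = (if k = n then 1 else - (\<Sum>i<n. b i * C i k))" for k
  have rD: "r x = (\<Sum>k<Suc n. D k * f k x)" for x
  proof -
    have "(\<Sum>i<n. b i * e i x) = (\<Sum>k<n. \<Sum>i<n. b i * (C i k * f k x))"
      by (subst sum.swap) (simp add: e_def sum_distrib_left)
    also have "\<dots> = (\<Sum>k<n. (\<Sum>i<n. b i * C i k) * f k x)"
      by (simp add: sum_distrib_right mult.assoc)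
    finally show ?thesis by (simp add: r_def D_def sum_negf)
  qed
  have "\<not> (AE x in lborel. r x = 0)"
  proof
    assume "AE x in lborel. r x = 0"
    then have "D n = 0" using Suc.prems(2) unfolding rD lin_indep_ae_def by blast
    then show False by (simp add: D_def)
  qed
  then have r0: "L2_inner r r \<noteq> 0" using L2_inner_self_eq_0_iff[OF rL] by simp
  define N where "N = (LINT x|lborel. (cmod (r x))\<^sup>2)"
  have N: "L2_inner r r = complex_of_real N" by (simp add: N_def L2_inner_self)
  have "N \<ge> 0" by (simp add: N_def)
  with r0 N have N0: "N > 0" by (cases "N = 0") auto
  define s where "s = complex_of_real (1 / sqrt N)"
  have sN: "s * (cnj s * N) = 1"
  proof -
    have "s * (cnj s * N) = complex_of_real (1 / sqrt N * (1 / sqrt N * N))"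
      by (simp only: s_def complex_cnj_complex_of_real of_real_mult)
    also have "1 / sqrt N * (1 / sqrt N * N) = 1"
      using N0 by (simp add: field_simps)
    finally show ?thesis by simp
  qed
  define C' where "C' i k = (if i < n then (if k < n then C i k else 0) else s * D k)" for i k
  have eC: "(\<lambda>i x. \<Sum>k<Suc n. C' i k * f k x) = (\<lambda>i. if i < n then e i else (\<lambda>x. s * r x))"
    by (intro ext) (simp add: C'_def e_def rD sum_distrib_left mult.assoc algebra_simps)
  have "orthonormal_family (Suc n) (\<lambda>i. if i < n then e i else (\<lambda>x. s * r x))"
  proof -
    have "L2_inner (e i) (\<lambda>x. s * r x) = 0" if "i < n" for i
      using ro[OF that] by (subst L2_inner_cnj) (simp add: L2_inner_cmult_left)
    moreover have "L2_inner (\<lambda>x. s * r x) (e i) = 0" if "i < n" for i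
      using ro[OF that] by (simp add: L2_inner_cmult_left)
    moreover have "L2_inner (\<lambda>x. s * r x) (\<lambda>x. s * r x) = 1"
    proof -
      have "L2_inner r (\<lambda>x. s * r x) = cnj s * N"
        by (subst L2_inner_cnj) (simp add: L2_inner_cmult_left N)
      then show ?thesis using sN by (simp add: L2_inner_cmult_left)
    qed
    ultimately show ?thesis
      using e rL L2_cmult[OF rL, of s] by (auto simp: orthonormal_family_def less_Suc_eq)
  qed
  then show ?case unfolding eC[symmetric] by blast
qed


section \<open>Convolution and the Fourier transform\<close>

lemma borel_measurable_exp_complex[measurable]: "(exp :: complex \<Rightarrow> complex) \<in> borel_measurable borel"
  by (intro borel_measurable_continuous_onI continuous_intros)

section \<open>Affine changes of variable\<close>

lemma lborel_integrable_affine_euclidean: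
  fixes f :: "'a::euclidean_space \<Rightarrow> 'b::{banach, second_countable_topology}"
  assumes "integrable lborel f" "c \<noteq> 0"
  shows "integrable lborel (\<lambda>x. f (t + c *\<^sub>R x))"
proof -
  have [measurable]: "f \<in> borel_measurable borel"
    using borel_measurable_integrable[OF assms(1)] by simp
  have "integrable (density (distr lborel borel (\<lambda>x. t + c *\<^sub>R x)) (\<lambda>_. ennreal (\<bar>c\<bar>^DIM('a)))) f"
    using assms lborel_affine[OF assms(2), of t] by (simp add: ennreal_power)
  then have "integrable lborel (\<lambda>x. \<bar>c\<bar>^DIM('a) *\<^sub>R f (t + c *\<^sub>R x))"
    by (subst (asm) integrable_density) (simp_all add: integrable_distr_eq)
  then have "integrable lborel (\<lambda>x. inverse (\<bar>c\<bar>^DIM('a)) *\<^sub>R (\<bar>c\<bar>^DIM('a) *\<^sub>R f (t + c *\<^sub>R x)))"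
    by (rule integrable_scaleR_right)
  then show ?thesis using assms(2) by simp
qed

text \<open>Reflections (\<open>c = -1\<close>), translations (\<open>c = 1\<close>) and the
  dilations of Gaussians (\<open>c = s\<close>) are all instances of this formula.\<close>

lemma lborel_integral_affine_euclidean:
  fixes f :: "'a::euclidean_space \<Rightarrow> 'b::{banach, second_countable_topology}"
  assumes [measurable]: "f \<in> borel_measurable borel" and c: "c \<noteq> 0"
  shows "(LINT x|lborel. f x) = \<bar>c\<bar>^DIM('a) *\<^sub>R (LINT x|lborel. f (t + c *\<^sub>R x))"
proof -
  have "(LINT x|lborel. f x) =
      (LINT x|density (distr lborel borel (\<lambda>x. t + c *\<^sub>R x)) (\<lambda>_. ennreal (\<bar>c\<bar>^DIM('a))). f x)"
    using lborel_affine[OF c, of t] by (simp add: ennreal_power)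
  then show ?thesis
    by (subst (asm) integral_density) (simp_all add: integral_distr)
qed

lemma lborel_integral_reflect_translate:
  fixes f :: "'a::euclidean_space \<Rightarrow> 'b::{banach, second_countable_topology}"
  assumes "f \<in> borel_measurable borel"
  shows "(LINT y|lborel. f (x - y)) = (LINT y|lborel. f y)"
  using lborel_integral_affine_euclidean[OF assms, of "-1" x] by simp

lemma lborel_integral_translate:
  fixes f :: "'a::euclidean_space \<Rightarrow> 'b::{banach, second_countable_topology}"
  assumes "f \<in> borel_measurable borel"
  shows "(LINT y|lborel. f (y - x)) = (LINT y|lborel. f y)"
  using lborel_integral_affine_euclidean[OF assms, of 1 "- x"] by simp

lemma lborel_integrable_translate:
  fixes f :: "'a::euclidean_space \<Rightarrow> 'b::{banach, second_countable_topology}"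
  assumes "integrable lborel f"
  shows "integrable lborel (\<lambda>y. f (y - x))"
  using lborel_integrable_affine_euclidean[OF assms, of 1 "- x"] by simp

lemma lborel_integrable_uminus:
  fixes f :: "'a::euclidean_space \<Rightarrow> 'b::{banach, second_countable_topology}"
  assumes "integrable lborel f"
  shows "integrable lborel (\<lambda>y. f (- y))"
  using lborel_integrable_affine_euclidean[OF assms, of "-1" 0] by simp

text \<open>By Tonelli: with \<open>y\<close> as the outer variable, translation invariance turns
  the inner integral of the modulus into the L1 norm of \<open>a\<close> times the modulus of
  \<open>u y\<close>.\<close>

lemma integrable_convolution_pair:
  fixes a u :: "'a::euclidean_space \<Rightarrow> complex"
  assumes a: "integrable lborel a" and u: "integrable lborel u"
  shows "integrable (lborel \<Otimes>\<^sub>M lborel) (\<lambda>(y, x). a (x - y) * u y)"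
proof (rule lborel_pair.Fubini_integrable)
  have am[measurable]: "a \<in> borel_measurable borel"
    using borel_measurable_integrable[OF a] by simp
  have [measurable]: "u \<in> borel_measurable borel"
    using borel_measurable_integrable[OF u] by simp
  show "(\<lambda>(y, x). a (x - y) * u y) \<in> borel_measurable (lborel \<Otimes>\<^sub>M lborel)" by measurable
  have "(LINT x|lborel. cmod (a (x - y))) = (LINT x|lborel. cmod (a x))" for y
    using lborel_integral_translate[of "\<lambda>x. cmod (a x)" y] by simp
  then have "(\<lambda>y. LINT x|lborel. norm (case (y, x) of (y, x) \<Rightarrow> a (x - y) * u y)) =
      (\<lambda>y. (LINT x|lborel. cmod (a x)) * cmod (u y))"
    by (simp add: norm_mult)
  then show "integrable lborel
      (\<lambda>y. LINT x|lborel. norm (case (y, x) of (y, x) \<Rightarrow> a (x - y) * u y))"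
    using u by simp
  show "AE y in lborel. integrable lborel (\<lambda>x. case (y, x) of (y, x) \<Rightarrow> a (x - y) * u y)"
    using lborel_integrable_translate[OF a] by simp
qed

definition convolution :: "('a::euclidean_space \<Rightarrow> complex) \<Rightarrow> ('a \<Rightarrow> complex) \<Rightarrow> 'a \<Rightarrow> complex" where
  "convolution a u x = (LINT y|lborel. a (x - y) * u y)"

lemma borel_measurable_convolution[measurable (raw)]:
  assumes [measurable]: "a \<in> borel_measurable borel" "u \<in> borel_measurable borel"
  shows "convolution a u \<in> borel_measurable borel"
  unfolding convolution_def[abs_def] by measurable

lemma integrable_convolution:
  assumes a: "integrable lborel a" and u: "integrable lborel u"
  shows "integrable lborel (convolution a u)"
  unfolding convolution_def[abs_def]
  using lborel_pair.integrable_snd[OF integrable_convolution_pair[OF a u]] by simp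

lemma integrable_fourier_kernel:
  fixes u :: "'a::euclidean_space \<Rightarrow> complex"
  assumes "integrable lborel u"
  shows "integrable lborel (\<lambda>\<xi>. u \<xi> * exp (- (\<i> * complex_of_real (x \<bullet> \<xi>))))"
proof (rule Bochner_Integration.integrable_bound[OF assms])
  have [measurable]: "u \<in> borel_measurable borel"
    using borel_measurable_integrable[OF assms] by simp
  show "(\<lambda>\<xi>. u \<xi> * exp (- (\<i> * complex_of_real (x \<bullet> \<xi>)))) \<in> borel_measurable lborel"
    by measurable
qed (simp add: norm_mult)

lemma cmod_fourier_le:
  fixes u :: "'a::euclidean_space \<Rightarrow> complex"
  shows "cmod (fourier u x) \<le> (LINT \<xi>|lborel. cmod (u \<xi>))"
proof -
  have "cmod (fourier u x) \<le>
      (LINT \<xi>|lborel. cmod (u \<xi> * exp (- (\<i> * complex_of_real (x \<bullet> \<xi>)))))"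
    unfolding fourier_def by (rule integral_norm_bound)
  then show ?thesis by (simp add: norm_mult)
qed

lemma continuous_on_fourier:
  fixes u :: "'a::euclidean_space \<Rightarrow> complex"
  assumes u: "integrable lborel u"
  shows "continuous_on UNIV (fourier u)"
proof (rule continuous_at_imp_continuous_on, rule ballI)
  fix x :: 'a
  have [measurable]: "u \<in> borel_measurable borel"
    using borel_measurable_integrable[OF u] by simp
  show "isCont (fourier u) x"
    unfolding continuous_at_sequentially
  proof (intro allI impI)
    fix X assume X: "X \<longlonglongrightarrow> x"
    show "(fourier u \<circ> X) \<longlonglongrightarrow> fourier u x"
      unfolding fourier_def comp_def
    proof (rule integral_dominated_convergence[where w="\<lambda>\<xi>. cmod (u \<xi>)"])
      show "AE \<xi> in lborel. (\<lambda>i. u \<xi> * exp (- (\<i> * complex_of_real (X i \<bullet> \<xi>))))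
          \<longlonglongrightarrow> u \<xi> * exp (- (\<i> * complex_of_real (x \<bullet> \<xi>)))"
        by (intro AE_I2 tendsto_intros X)
    qed (use u in \<open>auto simp: norm_mult\<close>)
  qed
qed

lemma borel_measurable_fourier:
  "integrable lborel u \<Longrightarrow> fourier u \<in> borel_measurable borel"
  by (intro borel_measurable_continuous_onI continuous_on_fourier)

lemma fourier_convolution:
  fixes a u :: "'a::euclidean_space \<Rightarrow> complex"
  assumes a: "integrable lborel a" and u: "integrable lborel u"
  shows "fourier (convolution a u) \<xi> = fourier a \<xi> * fourier u \<xi>"
proof -
  let ?E = "\<lambda>x::'a. exp (- (\<i> * complex_of_real (\<xi> \<bullet> x)))"
  have [measurable]: "a \<in> borel_measurable borel" "u \<in> borel_measurable borel"
    using borel_measurable_integrable[OF a] borel_measurable_integrable[OF u] by simp_all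
  have int: "integrable (lborel \<Otimes>\<^sub>M lborel) (\<lambda>(y, x). a (x - y) * u y * ?E x)"
  proof (rule Bochner_Integration.integrable_bound[OF integrable_convolution_pair[OF a u]])
    show "(\<lambda>(y, x). a (x - y) * u y * ?E x) \<in> borel_measurable (lborel \<Otimes>\<^sub>M lborel)"
      by measurable
  qed (simp add: norm_mult split: prod.split)
  have "fourier (convolution a u) \<xi> = (LINT x|lborel. LINT y|lborel. a (x - y) * u y * ?E x)"
    unfolding fourier_def convolution_def by (simp del: exp_minus)
  also have "\<dots> = (LINT y|lborel. LINT x|lborel. a (x - y) * u y * ?E x)"
    by (rule lborel_pair.Fubini_integral[OF int])
  also have "\<dots> = (LINT y|lborel. fourier a \<xi> * (u y * ?E y))"
  proof (intro Bochner_Integration.integral_cong refl)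
    fix y
    have "(LINT x|lborel. a (x - y) * u y * ?E x) = (LINT x|lborel. (a (x - y) * ?E (x - y)) * (u y * ?E y))"
      by (intro Bochner_Integration.integral_cong refl)
        (simp add: inner_diff_right algebra_simps exp_diff exp_minus divide_simps)
    also have "\<dots> = (LINT x|lborel. a (x - y) * ?E (x - y)) * (u y * ?E y)"
      by simp
    also have "(LINT x|lborel. a (x - y) * ?E (x - y)) = fourier a \<xi>"
      unfolding fourier_def by (rule lborel_integral_translate[of "\<lambda>x. a x * ?E x"]) measurable
    finally show "(LINT x|lborel. a (x - y) * u y * ?E x) = fourier a \<xi> * (u y * ?E y)" .
  qed
  finally show ?thesis by (simp add: fourier_def)
qed

text \<open>The kernel is symmetric in its two variables, so Fubini moves the transform from one
  factor to the other. This identity takes the role of Fourier inversion below.\<close>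

lemma integral_fourier_mult:
  fixes u v :: "'a::euclidean_space \<Rightarrow> complex"
  assumes u: "integrable lborel u" and v: "integrable lborel v"
  shows "(LINT \<xi>|lborel. fourier u \<xi> * v \<xi>) = (LINT x|lborel. u x * fourier v x)"
proof -
  let ?E = "\<lambda>x y::'a. exp (- (\<i> * complex_of_real (x \<bullet> y)))"
  have [measurable]: "u \<in> borel_measurable borel" "v \<in> borel_measurable borel"
    using borel_measurable_integrable[OF u] borel_measurable_integrable[OF v] by simp_all
  have int: "integrable (lborel \<Otimes>\<^sub>M lborel) (\<lambda>(x, \<xi>). u x * v \<xi> * ?E x \<xi>)"
  proof (rule lborel_pair.Fubini_integrable)
    show "(\<lambda>(x, \<xi>). u x * v \<xi> * ?E x \<xi>) \<in> borel_measurable (lborel \<Otimes>\<^sub>M lborel)" by measurable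
    show "integrable lborel (\<lambda>x. LINT \<xi>|lborel. norm (case (x, \<xi>) of (x, \<xi>) \<Rightarrow> u x * v \<xi> * ?E x \<xi>))"
      using u by (simp add: norm_mult)
    show "AE x in lborel. integrable lborel (\<lambda>\<xi>. case (x, \<xi>) of (x, \<xi>) \<Rightarrow> u x * v \<xi> * ?E x \<xi>)"
      using integrable_fourier_kernel[OF v] by (simp add: mult.assoc del: exp_minus)
  qed
  have "(LINT \<xi>|lborel. fourier u \<xi> * v \<xi>) = (LINT \<xi>|lborel. LINT x|lborel. u x * v \<xi> * ?E x \<xi>)"
    unfolding fourier_def integral_mult_left_zero[symmetric]
    by (intro Bochner_Integration.integral_cong refl) (simp add: inner_commute ac_simps)
  also have "\<dots> = (LINT x|lborel. LINT \<xi>|lborel. u x * v \<xi> * ?E x \<xi>)"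
    by (rule lborel_pair.Fubini_integral[OF int])
  also have "\<dots> = (LINT x|lborel. u x * fourier v x)"
    unfolding fourier_def integral_mult_right_zero[symmetric] by (simp add: mult.assoc)
  finally show ?thesis .
qed

section \<open>Gaussians and their Fourier transforms\<close>

lemma has_bochner_integral_gaussian_real:
  "has_bochner_integral lborel
     (\<lambda>t. complex_of_real (exp (- t\<^sup>2 / 2)) * exp (- (\<i> * complex_of_real (s * t))))
     (complex_of_real (sqrt (2 * pi) * exp (- s\<^sup>2 / 2)))"
proof -
  let ?f = "\<lambda>t. complex_of_real (exp (- t\<^sup>2 / 2)) * exp (- (\<i> * complex_of_real (s * t)))"
  have eq: "?f t = complex_of_real (sqrt (2 * pi)) * (std_normal_density t *\<^sub>R iexp ((- s) * t))" for t
    by (simp add: std_normal_density_def scaleR_conv_of_real exp_minus divide_simps flip: exp_of_real)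
  have int: "integrable lborel (\<lambda>t. std_normal_density t *\<^sub>R iexp ((- s) * t))"
    by (rule Bochner_Integration.integrable_bound[OF integrable_normal_density[of 1 0]]) auto
  \<comment> \<open>Up to the factor \<open>sqrt (2 * pi)\<close> the integral is the characteristic
    function of the standard normal distribution at \<open>- s\<close>.\<close>
  have "(LINT t|lborel. std_normal_density t *\<^sub>R iexp ((- s) * t)) = char std_normal_distribution (- s)"
    unfolding char_def by (subst integral_density) auto
  also have "\<dots> = complex_of_real (exp (- s\<^sup>2 / 2))"
    by (simp add: char_std_normal_distribution)
  finally show ?thesis
    unfolding eq has_bochner_integral_iff
    using integrable_mult_right[OF int] by (simp only: integral_mult_right_zero of_real_mult)
qed

definition gaussian :: "'a::euclidean_space \<Rightarrow> real" where
  "gaussian x = exp (- (x \<bullet> x) / 2)"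

lemma
  fixes x :: "'a::euclidean_space"
  shows integrable_gaussian: "integrable lborel (\<lambda>\<xi>::'a. complex_of_real (gaussian \<xi>))" (is ?I)
    and fourier_gaussian: "fourier (\<lambda>\<xi>. complex_of_real (gaussian \<xi>)) x =
      complex_of_real (sqrt (2 * pi) ^ DIM('a) * gaussian x)" (is ?F)
proof -
  interpret product_sigma_finite "\<lambda>_::'a. lborel :: real measure"
    by standard
  \<comment> \<open>\<open>h\<close> is the contribution of one coordinate. Lebesgue measure is the
    image of a product measure under \<open>e\<close>, so the integral factors over
    \<open>Basis\<close>.\<close>
  define h where "h y b t = complex_of_real (exp (- t\<^sup>2 / 2)) * exp (- (\<i> * complex_of_real ((y \<bullet> b) * t)))"
    for y b :: 'a and t
  define e where "e f = (\<Sum>b\<in>Basis. f b *\<^sub>R b)" for f :: "'a \<Rightarrow> real"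
  have [measurable]: "e \<in> borel_measurable (Pi\<^sub>M Basis (\<lambda>_. lborel))"
    unfolding e_def[abs_def] by measurable
  have inner_e: "y \<bullet> e f = (\<Sum>b\<in>Basis. (y \<bullet> b) * f b)" for y f
    by (simp add: e_def inner_sum_right mult.commute)
  have e_b: "e f \<bullet> b = f b" if "b \<in> Basis" for f b
    using that by (simp add: e_def inner_sum_left inner_Basis if_distrib sum.delta cong: if_cong)
  have e_e: "e f \<bullet> e f = (\<Sum>b\<in>Basis. (f b)\<^sup>2)" for f
    unfolding inner_e by (intro sum.cong refl) (simp add: e_b power2_eq_square)
  have prod: "complex_of_real (gaussian (e f)) * exp (- (\<i> * complex_of_real (y \<bullet> e f))) =
      (\<Prod>b\<in>Basis. h y b (f b))" for f y
  proof -
    have "complex_of_real (gaussian (e f)) = (\<Prod>b\<in>Basis. complex_of_real (exp (- (f b)\<^sup>2 / 2)))"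
      unfolding of_real_prod[symmetric] exp_sum[OF finite_Basis, symmetric]
      by (simp add: gaussian_def e_e sum_negf sum_divide_distrib)
    moreover have "exp (- (\<i> * complex_of_real (y \<bullet> e f))) =
        (\<Prod>b\<in>Basis. exp (- (\<i> * complex_of_real ((y \<bullet> b) * f b))))"
      unfolding exp_sum[OF finite_Basis, symmetric]
      by (simp add: inner_e sum_negf sum_distrib_left)
    ultimately show ?thesis by (simp add: h_def prod.distrib del: exp_minus)
  qed
  have hi: "integrable lborel (h y b)" for y b
    using has_bochner_integral_gaussian_real[of "y \<bullet> b"]
    unfolding h_def[abs_def] has_bochner_integral_iff by simp
  have int: "integrable (Pi\<^sub>M Basis (\<lambda>_. lborel)) (\<lambda>f. \<Prod>b\<in>Basis. h y b (f b))" for y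
    by (intro product_integrable_prod hi) simp
  have eq: "lborel = distr (Pi\<^sub>M Basis (\<lambda>_. lborel)) borel e"
    unfolding e_def[abs_def] by (rule lborel_eq)
  have gm[measurable]: "(gaussian :: 'a \<Rightarrow> real) \<in> borel_measurable borel"
    unfolding gaussian_def[abs_def] by measurable
  \<comment> \<open>At frequency 0 the exponential is 1, so integrability of the Gaussian itself is
    the case \<open>y = 0\<close>.\<close>
  show ?I
    unfolding eq using int[of 0] by (subst integrable_distr_eq) (simp_all add: prod[of _ 0, simplified])
  have "fourier (\<lambda>\<xi>. complex_of_real (gaussian \<xi>)) x =
      (LINT f|Pi\<^sub>M Basis (\<lambda>_. lborel). (\<Prod>b\<in>Basis. h x b (f b)))"
    unfolding fourier_def by (subst eq, subst integral_distr) (simp_all add: prod del: exp_minus)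
  also have "\<dots> = (\<Prod>b\<in>Basis. (LINT t|lborel. h x b t))"
    by (intro product_integral_prod hi) simp
  also have "\<dots> = (\<Prod>b\<in>Basis. complex_of_real (sqrt (2 * pi) * exp (- (x \<bullet> b)\<^sup>2 / 2)))"
    using has_bochner_integral_gaussian_real unfolding h_def
    by (intro prod.cong refl) (simp add: has_bochner_integral_iff)
  also have "\<dots> = complex_of_real (sqrt (2 * pi) ^ DIM('a) * (\<Prod>b\<in>Basis. exp (- (x \<bullet> b)\<^sup>2 / 2)))"
    by (simp add: prod.distrib)
  also have "(\<Prod>b\<in>Basis. exp (- (x \<bullet> b)\<^sup>2 / 2)) = gaussian x"
    unfolding exp_sum[OF finite_Basis, symmetric] gaussian_def
    by (subst euclidean_inner[of x x]) (simp add: sum_negf sum_divide_distrib power2_eq_square)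
  finally show ?F .
qed


section \<open>Gaussian regularisation and Plancherel's theorem\<close>

lemma borel_measurable_gaussian[measurable]: "gaussian \<in> borel_measurable borel"
  unfolding gaussian_def[abs_def] by measurable

lemma gaussian_pos: "0 < gaussian x" and gaussian_le_1: "gaussian x \<le> 1"
  by (simp_all add: gaussian_def)

lemma integral_gaussian:
  "(LINT \<xi>::'a::euclidean_space|lborel. gaussian \<xi>) = sqrt (2 * pi) ^ DIM('a)"
proof -
  have "complex_of_real (LINT \<xi>::'a|lborel. gaussian \<xi>) = complex_of_real (sqrt (2 * pi) ^ DIM('a))"
    using fourier_gaussian[of "0::'a"] by (simp add: fourier_def gaussian_def)
  then show ?thesis by (simp only: of_real_eq_iff)
qed

lemma
  fixes x :: "'a::euclidean_space"
  assumes s: "s > 0"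
  shows integrable_gaussian_scaled: "integrable lborel (\<lambda>\<xi>::'a. complex_of_real (gaussian (s *\<^sub>R \<xi>)))"
    and fourier_gaussian_scaled: "fourier (\<lambda>\<xi>. complex_of_real (gaussian (s *\<^sub>R \<xi>))) x =
      complex_of_real (sqrt (2 * pi) ^ DIM('a) / s ^ DIM('a) * gaussian ((1 / s) *\<^sub>R x))"
proof -
  show "integrable lborel (\<lambda>\<xi>::'a. complex_of_real (gaussian (s *\<^sub>R \<xi>)))"
    using lborel_integrable_affine_euclidean[OF integrable_gaussian, of s 0] s by simp
  have "fourier (\<lambda>\<xi>. complex_of_real (gaussian \<xi>)) ((1 / s) *\<^sub>R x) =
      (\<bar>s\<bar> ^ DIM('a)) *\<^sub>R fourier (\<lambda>\<xi>. complex_of_real (gaussian (s *\<^sub>R \<xi>))) x"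
    unfolding fourier_def using s
    by (subst lborel_integral_affine_euclidean[where c=s and t=0])
      (simp_all add: scaleR_conv_of_real mult.assoc)
  then show "fourier (\<lambda>\<xi>. complex_of_real (gaussian (s *\<^sub>R \<xi>))) x =
      complex_of_real (sqrt (2 * pi) ^ DIM('a) / s ^ DIM('a) * gaussian ((1 / s) *\<^sub>R x))"
    using s unfolding fourier_gaussian by (simp add: scaleR_conv_of_real field_simps)
qed

text \<open>Turns the conjugate of a transform into a transform, so that
  \<open>integral_fourier_mult\<close> can be applied to it.\<close>

lemma cnj_fourier: "cnj (fourier g \<xi>) = fourier (\<lambda>y. cnj (g (- y))) \<xi>"
  if "g \<in> borel_measurable borel" for g :: "'a::euclidean_space \<Rightarrow> complex"
proof -
  have [measurable]: "g \<in> borel_measurable borel" by fact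
  have "cnj (fourier g \<xi>) = (LINT y|lborel. cnj (g y) * exp (\<i> * complex_of_real (\<xi> \<bullet> y)))"
    unfolding fourier_def Bochner_Integration.integral_cnj[symmetric]
    by (simp add: exp_cnj)
  also have "\<dots> = (LINT y|lborel. cnj (g (- y)) * exp (\<i> * complex_of_real (\<xi> \<bullet> (- y))))"
    using lborel_integral_reflect_translate
      [of "\<lambda>y. cnj (g y) * exp (\<i> * complex_of_real (\<xi> \<bullet> y))" 0] by simp
  finally show ?thesis by (simp add: fourier_def)
qed

lemma integrable_mult_bounded:
  fixes u v :: "'a \<Rightarrow> complex"
  assumes u: "integrable M u" and v: "v \<in> borel_measurable M" and B: "\<And>x. cmod (v x) \<le> B"
  shows "integrable M (\<lambda>x. u x * v x)"
proof (rule Bochner_Integration.integrable_bound)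
  show "integrable M (\<lambda>x. B * cmod (u x))" using u by simp
  show "(\<lambda>x. u x * v x) \<in> borel_measurable M"
    using u v by measurable
  have "0 \<le> B" using B[of undefined] norm_ge_zero order_trans by blast
  then show "AE x in M. norm (u x * v x) \<le> norm (B * cmod (u x))"
    using B by (auto simp: norm_mult mult.commute[of B] intro!: mult_left_mono)
qed

text \<open>The transform of a wide Gaussian is a narrow one, so the result is \<open>cnj g\<close>
  averaged near \<open>x\<close>. The substitution \<open>y = s t - x\<close> moves \<open>s\<close>
  into the argument of \<open>g\<close> and leaves a fixed weight, which suits dominated convergence
  as \<open>s\<close> tends to 0.\<close>

lemma fourier_cnj_fourier_gaussian:
  fixes g :: "'a::euclidean_space \<Rightarrow> complex"
  assumes g: "integrable lborel g" and s: "s > 0"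
  shows "fourier (\<lambda>\<xi>. cnj (fourier g \<xi>) * complex_of_real (gaussian (s *\<^sub>R \<xi>))) x =
    (LINT t|lborel. cnj (g (x - s *\<^sub>R t)) * complex_of_real (sqrt (2 * pi) ^ DIM('a) * gaussian t))"
proof -
  let ?E = "\<lambda>\<xi>::'a. exp (- (\<i> * complex_of_real (x \<bullet> \<xi>)))"
  let ?w = "\<lambda>\<xi>::'a. complex_of_real (gaussian (s *\<^sub>R \<xi>))"
  let ?c = "sqrt (2 * pi) ^ DIM('a)"
  have gm[measurable]: "g \<in> borel_measurable borel"
    using borel_measurable_integrable[OF g] by simp
  have g': "integrable lborel (\<lambda>y. cnj (g (- y)))"
    using lborel_integrable_uminus[OF g] by (simp add: integrable_cnj)
  have wE: "integrable lborel (\<lambda>\<xi>. ?w \<xi> * ?E \<xi>)"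
    by (intro integrable_fourier_kernel integrable_gaussian_scaled s)
  have shift: "fourier (\<lambda>\<xi>. ?w \<xi> * ?E \<xi>) y = fourier ?w (x + y)" for y
    unfolding fourier_def
    by (intro Bochner_Integration.integral_cong refl)
      (simp add: inner_add_left exp_add[symmetric] algebra_simps del: exp_minus)
  have "fourier (\<lambda>\<xi>. cnj (fourier g \<xi>) * ?w \<xi>) x =
      (LINT \<xi>|lborel. fourier (\<lambda>y. cnj (g (- y))) \<xi> * (?w \<xi> * ?E \<xi>))"
    unfolding cnj_fourier[OF gm] fourier_def[of "\<lambda>\<xi>. fourier (\<lambda>y. cnj (g (- y))) \<xi> * ?w \<xi>"]
    by (simp only: mult.assoc)
  also have "\<dots> = (LINT y|lborel. cnj (g (- y)) * fourier ?w (x + y))"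
    unfolding integral_fourier_mult[OF g' wE] shift ..
  also have "\<dots> = (LINT y|lborel. cnj (g (- y)) * complex_of_real (?c / s ^ DIM('a) * gaussian ((1 / s) *\<^sub>R (x + y))))"
    by (simp only: fourier_gaussian_scaled[OF s])
  also have "\<dots> = (\<bar>s\<bar> ^ DIM('a)) *\<^sub>R (LINT t|lborel. cnj (g (x - s *\<^sub>R t)) *
      complex_of_real (?c / s ^ DIM('a) * gaussian t))"
    using s by (subst lborel_integral_affine_euclidean[where c=s and t="- x"]) simp_all
  also have "\<dots> = (LINT t|lborel. (\<bar>s\<bar> ^ DIM('a)) *\<^sub>R (cnj (g (x - s *\<^sub>R t)) *
      complex_of_real (?c / s ^ DIM('a) * gaussian t)))"
    by simp
  also have "\<dots> = (LINT t|lborel. cnj (g (x - s *\<^sub>R t)) * complex_of_real (?c * gaussian t))"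
    using s by (intro Bochner_Integration.integral_cong refl) (simp add: scaleR_conv_of_real)
  finally show ?thesis .
qed

text \<open>
  Gaussian regularisation stands in for Plancherel's theorem: the approximate identity only has to
  converge pointwise, because one of the two functions is bounded and continuous.
\<close>

lemma fourier_parseval_gaussian:
  fixes u g :: "'a::euclidean_space \<Rightarrow> complex"
  assumes u: "integrable lborel u" and g: "integrable lborel g"
    and g_cont: "continuous_on UNIV g" and g_bdd: "\<And>x. cmod (g x) \<le> B"
  shows "(\<lambda>k. LINT \<xi>|lborel. fourier u \<xi> * (cnj (fourier g \<xi>) *
      complex_of_real (gaussian ((1 / real (Suc k)) *\<^sub>R \<xi>))))
    \<longlonglongrightarrow> complex_of_real ((2 * pi) ^ DIM('a)) * (LINT x|lborel. u x * cnj (g x))"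
proof -
  \<comment> \<open>The constant enters twice, once from the transform of the Gaussian and once from
    its total mass; \<open>c * c\<close> is the power of \<open>2 * pi\<close> in the limit.\<close>
  define c where "c = sqrt (2 * pi) ^ DIM('a)"
  define s where "s k = 1 / real (Suc k)" for k
  have s: "s k > 0" for k by (simp add: s_def)
  have s0: "s \<longlonglongrightarrow> 0" unfolding s_def[abs_def] by (rule LIMSEQ_Suc[OF lim_1_over_n])
  have c: "c \<ge> 0" by (simp add: c_def)
  have B: "0 \<le> B" using g_bdd[of undefined] norm_ge_zero order_trans by blast
  have [measurable]: "u \<in> borel_measurable borel" "g \<in> borel_measurable borel"
    using borel_measurable_integrable[OF u] borel_measurable_integrable[OF g] by simp_all
  define h where "h k x = (LINT t|lborel. cnj (g (x - s k *\<^sub>R t)) * complex_of_real (c * gaussian t))"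
    for k and x :: 'a
  have [measurable]: "h k \<in> borel_measurable borel" for k
    unfolding h_def[abs_def] by measurable
  have gi: "integrable lborel (\<lambda>t::'a. complex_of_real (gaussian t))" by (rule integrable_gaussian)
  have gi': "integrable lborel (\<lambda>t::'a. gaussian t)" using integrable_Re[OF gi] by simp
  have h_lim: "(\<lambda>k. h k x) \<longlonglongrightarrow> complex_of_real (c * c) * cnj (g x)" for x
  proof -
    have "(\<lambda>k. h k x) \<longlonglongrightarrow> (LINT t|lborel. cnj (g x) * complex_of_real (c * gaussian (t::'a)))"
      unfolding h_def
    proof (rule integral_dominated_convergence[where w="\<lambda>t. B * (c * gaussian t)"])
      show "AE t in lborel. (\<lambda>k. cnj (g (x - s k *\<^sub>R t)) * complex_of_real (c * gaussian t))
          \<longlonglongrightarrow> cnj (g x) * complex_of_real (c * gaussian t)"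
      proof (rule AE_I2)
        fix t
        have "(\<lambda>k. x - s k *\<^sub>R t) \<longlonglongrightarrow> x - 0 *\<^sub>R t"
          by (intro tendsto_intros s0)
        then have "(\<lambda>k. g (x - s k *\<^sub>R t)) \<longlonglongrightarrow> g (x - 0 *\<^sub>R t)"
          using g_cont by (intro continuous_on_tendsto_compose[OF g_cont]) auto
        then show "(\<lambda>k. cnj (g (x - s k *\<^sub>R t)) * complex_of_real (c * gaussian t))
            \<longlonglongrightarrow> cnj (g x) * complex_of_real (c * gaussian t)"
          by (intro tendsto_intros) simp
      qed
      show "AE t in lborel. norm (cnj (g (x - s k *\<^sub>R t)) * complex_of_real (c * gaussian t))
          \<le> B * (c * gaussian t)" for k
        using g_bdd c by (intro AE_I2) (auto simp: norm_mult abs_mult less_imp_le[OF gaussian_pos]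
            intro!: mult_right_mono mult_nonneg_nonneg)
    qed (use gi' in auto)
    moreover have "(LINT t|lborel. cnj (g x) * complex_of_real (c * gaussian (t::'a))) =
        complex_of_real (c * c) * cnj (g x)"
      by (simp add: c_def integral_gaussian)
    ultimately show ?thesis by (simp only:)
  qed
  have h_bdd: "cmod (h k x) \<le> B * c * c" for k x
  proof -
    have "cmod (h k x) \<le> (LINT t::'a|lborel. B * (c * gaussian t))"
      unfolding h_def
    proof (rule order_trans[OF integral_norm_bound integral_mono])
      show "integrable lborel (\<lambda>t. cmod (cnj (g (x - s k *\<^sub>R t)) * complex_of_real (c * gaussian t)))"
        using integrable_mult_bounded[of lborel "\<lambda>t. complex_of_real (c * gaussian t)"
            "\<lambda>t. cnj (g (x - s k *\<^sub>R t))" B] gi g_bdd by (simp add: mult.commute)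
      show "cmod (cnj (g (x - s k *\<^sub>R t)) * complex_of_real (c * gaussian t)) \<le> B * (c * gaussian t)" for t
        using g_bdd c by (auto simp: norm_mult abs_mult less_imp_le[OF gaussian_pos]
            intro!: mult_right_mono mult_nonneg_nonneg)
    qed (use gi' in simp)
    also have "\<dots> = B * c * c"
      by (simp add: integral_gaussian c_def)
    finally show ?thesis .
  qed
  have eq: "(LINT \<xi>|lborel. fourier u \<xi> * (cnj (fourier g \<xi>) * complex_of_real (gaussian (s k *\<^sub>R \<xi>)))) =
      (LINT x|lborel. u x * h k x)" for k
  proof (subst integral_fourier_mult[OF u])
    have [measurable]: "fourier g \<in> borel_measurable borel" by (rule borel_measurable_fourier[OF g])
    show "integrable lborel (\<lambda>\<xi>. cnj (fourier g \<xi>) * complex_of_real (gaussian (s k *\<^sub>R \<xi>)))"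
      using integrable_mult_bounded[OF integrable_gaussian_scaled[OF s],
          of "\<lambda>\<xi>. cnj (fourier g \<xi>)" "LINT \<xi>|lborel. cmod (g \<xi>)"] cmod_fourier_le[of g]
      by (simp add: mult.commute)
  qed (simp add: fourier_cnj_fourier_gaussian[OF g s] h_def c_def)
  have "(\<lambda>k. LINT x|lborel. u x * h k x) \<longlonglongrightarrow> (LINT x|lborel. u x * (complex_of_real (c * c) * cnj (g x)))"
  proof (rule integral_dominated_convergence[where w="\<lambda>x. cmod (u x) * (B * c * c)"])
    show "AE x in lborel. (\<lambda>k. u x * h k x) \<longlonglongrightarrow> u x * (complex_of_real (c * c) * cnj (g x))"
      by (intro AE_I2 tendsto_intros h_lim)
    show "AE x in lborel. norm (u x * h k x) \<le> cmod (u x) * (B * c * c)" for k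
      using h_bdd by (auto simp: norm_mult intro!: mult_left_mono)
  qed (use u in auto)
  also have "(\<lambda>x. u x * (complex_of_real (c * c) * cnj (g x))) =
      (\<lambda>x. complex_of_real (c * c) * (u x * cnj (g x)))"
    by (simp add: ac_simps)
  also have "c * c = (2 * pi) ^ DIM('a)"
    unfolding c_def power_mult_distrib[symmetric] by simp
  finally show ?thesis
    unfolding eq[symmetric] s_def by simp
qed

text \<open>In \<open>fourier_parseval_gaussian\<close> with \<open>u = g\<close> the regularised
  integrand is nonnegative and increases with \<open>k\<close>. Monotone convergence therefore
  yields square integrability of the transform together with the value of the integral.\<close>

lemma
  fixes g :: "'a::euclidean_space \<Rightarrow> complex"
  assumes g: "integrable lborel g" and g_cont: "continuous_on UNIV g" and g_bdd: "\<And>x. cmod (g x) \<le> B"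
  shows integrable_fourier_square: "integrable lborel (\<lambda>\<xi>. (cmod (fourier g \<xi>))\<^sup>2)"
    and plancherel: "(LINT \<xi>|lborel. (cmod (fourier g \<xi>))\<^sup>2) =
      (2 * pi) ^ DIM('a) * (LINT x|lborel. (cmod (g x))\<^sup>2)"
proof -
  have [measurable]: "fourier g \<in> borel_measurable borel" by (rule borel_measurable_fourier[OF g])
  let ?w = "\<lambda>k \<xi>::'a. gaussian ((1 / real (Suc k)) *\<^sub>R \<xi>)"
  let ?f = "\<lambda>k \<xi>. (cmod (fourier g \<xi>))\<^sup>2 * ?w k \<xi>"
  have fc: "fourier g \<xi> * (cnj (fourier g \<xi>) * complex_of_real (?w k \<xi>)) = complex_of_real (?f k \<xi>)" for k \<xi>
    unfolding of_real_mult complex_norm_square by (simp only: mult.assoc)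
  have gc: "g x * cnj (g x) = complex_of_real ((cmod (g x))\<^sup>2)" for x
    by (simp only: complex_norm_square)
  have "(\<lambda>k. complex_of_real (LINT \<xi>|lborel. ?f k \<xi>)) \<longlonglongrightarrow>
      complex_of_real ((2 * pi) ^ DIM('a) * (LINT x|lborel. (cmod (g x))\<^sup>2))"
    using fourier_parseval_gaussian[OF g g g_cont g_bdd]
    unfolding fc gc integral_complex_of_real of_real_mult[symmetric] .
  then have lim: "(\<lambda>k. LINT \<xi>|lborel. ?f k \<xi>) \<longlonglongrightarrow> (2 * pi) ^ DIM('a) * (LINT x|lborel. (cmod (g x))\<^sup>2)"
    by (simp only: tendsto_of_real_iff)
  have mono: "AE \<xi> in lborel. mono (\<lambda>k. ?f k \<xi>)"
  proof (rule AE_I2, rule monoI)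
    fix \<xi> :: 'a and j k :: nat assume "j \<le> k"
    then have "(1 / real (Suc k)) * (1 / real (Suc k)) \<le> (1 / real (Suc j)) * (1 / real (Suc j))"
      by (intro mult_mono divide_left_mono) auto
    then have le: "(1 / real (Suc k)) * (1 / real (Suc k)) * (\<xi> \<bullet> \<xi>) \<le>
        (1 / real (Suc j)) * (1 / real (Suc j)) * (\<xi> \<bullet> \<xi>)"
      by (intro mult_right_mono) auto
    have ge: "gaussian (e *\<^sub>R \<xi>) = exp (- (e * e * (\<xi> \<bullet> \<xi>)) / 2)" for e
      by (simp add: gaussian_def mult.assoc)
    have "?w j \<xi> \<le> ?w k \<xi>"
      unfolding ge exp_le_cancel_iff
      by (rule divide_right_mono[OF le_imp_neg_le[OF le]]) simp
    then show "?f j \<xi> \<le> ?f k \<xi>"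
      by (intro mult_left_mono) auto
  qed
  have pw: "AE \<xi> in lborel. (\<lambda>k. ?f k \<xi>) \<longlonglongrightarrow> (cmod (fourier g \<xi>))\<^sup>2"
  proof (rule AE_I2)
    fix \<xi> :: 'a
    have "(\<lambda>k. (cmod (fourier g \<xi>))\<^sup>2 * exp (- (((1 / real (Suc k)) *\<^sub>R \<xi>) \<bullet> ((1 / real (Suc k)) *\<^sub>R \<xi>)) / 2))
      \<longlonglongrightarrow> (cmod (fourier g \<xi>))\<^sup>2 * exp (- ((0 *\<^sub>R \<xi>) \<bullet> (0 *\<^sub>R \<xi>)) / 2)"
      by (intro tendsto_intros LIMSEQ_Suc[OF lim_1_over_n]) simp
    then show "(\<lambda>k. ?f k \<xi>) \<longlonglongrightarrow> (cmod (fourier g \<xi>))\<^sup>2"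
      by (simp add: gaussian_def)
  qed
  have int: "integrable lborel (?f k)" for k
  proof (rule Bochner_Integration.integrable_bound)
    show "integrable lborel (\<lambda>\<xi>. (LINT \<xi>|lborel. cmod (g \<xi>))\<^sup>2 * ?w k \<xi>)"
      using integrable_Re[OF integrable_gaussian_scaled[of "1 / real (Suc k)", where 'a='a]] by simp
    show "AE \<xi> in lborel. norm (?f k \<xi>) \<le> norm ((LINT \<xi>|lborel. cmod (g \<xi>))\<^sup>2 * ?w k \<xi>)"
      by (intro AE_I2) (auto simp: abs_mult simp del: of_nat_Suc intro!: mult_right_mono power_mono cmod_fourier_le)
  qed measurable
  show "integrable lborel (\<lambda>\<xi>. (cmod (fourier g \<xi>))\<^sup>2)"
    by (rule integrable_monotone_convergence[OF int mono pw lim]) measurable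
  show "(LINT \<xi>|lborel. (cmod (fourier g \<xi>))\<^sup>2) = (2 * pi) ^ DIM('a) * (LINT x|lborel. (cmod (g x))\<^sup>2)"
    by (rule integral_monotone_convergence[OF int mono pw lim]) measurable
qed

lemma convolution_form_ge:
  fixes a u :: "'a::euclidean_space \<Rightarrow> complex"
  assumes a: "integrable lborel a" and p: "integrable lborel (minus_part (fourier a))"
    and u: "integrable lborel u" and u_cont: "continuous_on UNIV u" and u_bdd: "\<And>x. cmod (u x) \<le> B"
  shows "- (LINT \<xi>|lborel. minus_part (fourier a) \<xi> * (cmod (fourier u \<xi>))\<^sup>2)
    \<le> (2 * pi) ^ DIM('a) * Re (LINT x|lborel. convolution a u x * cnj (u x))"
proof -
  have [measurable]: "fourier u \<in> borel_measurable borel" "fourier a \<in> borel_measurable borel"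
    by (rule borel_measurable_fourier[OF u] borel_measurable_fourier[OF a])+
  let ?w = "\<lambda>k \<xi>::'a. gaussian ((1 / real (Suc k)) *\<^sub>R \<xi>)"
  let ?p = "minus_part (fourier a)"
  let ?U = "\<lambda>\<xi>. (cmod (fourier u \<xi>))\<^sup>2"
  let ?A = "LINT x|lborel. cmod (a x)" and ?C = "LINT x|lborel. cmod (u x)"
  let ?f = "\<lambda>k \<xi>. fourier a \<xi> * complex_of_real (?U \<xi> * ?w k \<xi>)"
  have f: "fourier (convolution a u) \<xi> * (cnj (fourier u \<xi>) * complex_of_real (?w k \<xi>)) = ?f k \<xi>" for k \<xi>
    unfolding of_real_mult complex_norm_square fourier_convolution[OF a u] by (simp only: mult.assoc)
  have lim: "(\<lambda>k. Re (LINT \<xi>|lborel. ?f k \<xi>)) \<longlonglongrightarrow>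
      Re (complex_of_real ((2 * pi) ^ DIM('a)) * (LINT x|lborel. convolution a u x * cnj (u x)))"
    using tendsto_Re[OF fourier_parseval_gaussian[OF integrable_convolution[OF a u] u u_cont u_bdd]]
    unfolding f .
  have int: "integrable lborel (?f k)" for k
  proof (rule Bochner_Integration.integrable_bound)
    show "integrable lborel (\<lambda>\<xi>. (?A * ?C\<^sup>2) * ?w k \<xi>)"
      using integrable_Re[OF integrable_gaussian_scaled[of "1 / real (Suc k)", where 'a='a]] by simp
    show "AE \<xi> in lborel. norm (?f k \<xi>) \<le> norm (?A * ?C\<^sup>2 * ?w k \<xi>)"
    proof (rule AE_I2)
      fix \<xi> :: 'a
      have "cmod (fourier a \<xi>) * (?U \<xi> * ?w k \<xi>) \<le> ?A * (?C\<^sup>2 * ?w k \<xi>)"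
        by (intro mult_mono mult_right_mono power_mono cmod_fourier_le)
          (auto intro!: mult_nonneg_nonneg less_imp_le[OF gaussian_pos])
      moreover have "0 \<le> ?w k \<xi>" by (rule less_imp_le[OF gaussian_pos])
      moreover have "0 \<le> ?A" by simp
      ultimately show "norm (?f k \<xi>) \<le> norm (?A * ?C\<^sup>2 * ?w k \<xi>)"
        by (simp only: norm_mult norm_of_real abs_mult abs_norm_cancel abs_power2 abs_of_nonneg
            real_norm_def mult.assoc norm_ge_zero)
    qed
  qed measurable
  have pU: "integrable lborel (\<lambda>\<xi>. ?p \<xi> * ?U \<xi>)"
  proof (rule Bochner_Integration.integrable_bound)
    show "integrable lborel (\<lambda>\<xi>. ?p \<xi> * ?C\<^sup>2)" using p by simp
    show "AE \<xi> in lborel. norm (?p \<xi> * ?U \<xi>) \<le> norm (?p \<xi> * ?C\<^sup>2)"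
      by (intro AE_I2) (auto simp: abs_mult intro!: mult_left_mono power_mono cmod_fourier_le)
  qed (use p in measurable)
  have "- (LINT \<xi>|lborel. ?p \<xi> * ?U \<xi>) \<le> Re (LINT \<xi>|lborel. ?f k \<xi>)" for k
  proof -
    have "- (LINT \<xi>|lborel. ?p \<xi> * ?U \<xi>) = (LINT \<xi>|lborel. - (?p \<xi> * ?U \<xi>))" by simp
    also have "\<dots> \<le> (LINT \<xi>|lborel. Re (?f k \<xi>))"
    proof (rule integral_mono)
      show "- (?p \<xi> * ?U \<xi>) \<le> Re (?f k \<xi>)" for \<xi>
      proof -
        have "?p \<xi> * (?U \<xi> * ?w k \<xi>) \<le> ?p \<xi> * (?U \<xi> * 1)"
          by (intro mult_left_mono gaussian_le_1) (auto simp: minus_part_def)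
        moreover have "- ?p \<xi> * (?U \<xi> * ?w k \<xi>) \<le> Re (fourier a \<xi>) * (?U \<xi> * ?w k \<xi>)"
          by (intro mult_right_mono) (auto simp: minus_part_def less_imp_le[OF gaussian_pos])
        ultimately show ?thesis by (simp del: of_nat_Suc)
      qed
    qed (use pU integrable_Re[OF int] in auto)
    also have "\<dots> = Re (LINT \<xi>|lborel. ?f k \<xi>)"
      by (rule integral_Re[OF int])
    finally show ?thesis .
  qed
  then have "- (LINT \<xi>|lborel. ?p \<xi> * ?U \<xi>) \<le>
      Re (complex_of_real ((2 * pi) ^ DIM('a)) * (LINT x|lborel. convolution a u x * cnj (u x)))"
    by (intro LIMSEQ_le_const[OF lim]) auto
  then show ?thesis by (simp only: Re_complex_of_real times_complex.sel Im_complex_of_real)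
qed


section \<open>Approximation by test functions\<close>

text \<open>Neither smoothness nor compact support is asked for: these are exactly the conditions of
  \<open>plancherel\<close>, and they are inherited by \<open>p\<close> times the transform of such
  a function.\<close>

definition test_function :: "('a::euclidean_space \<Rightarrow> complex) \<Rightarrow> bool" where
  "test_function u \<longleftrightarrow> continuous_on UNIV u \<and> bounded (range u) \<and> integrable lborel u"

lemma test_function_bound:
  assumes "test_function u"
  obtains B where "\<And>x. cmod (u x) \<le> B"
  using assms unfolding test_function_def bounded_iff by auto

lemma test_function_lincomb:
  assumes "\<And>i. i \<in> A \<Longrightarrow> test_function (f i)"
  shows "test_function (\<lambda>x. \<Sum>i\<in>A. c i * f i x)"
proof -
  have "\<forall>i\<in>A. \<exists>B. \<forall>x. cmod (f i x) \<le> B"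
    using assms unfolding test_function_def bounded_iff by auto
  then obtain B where B: "\<And>i x. i \<in> A \<Longrightarrow> cmod (f i x) \<le> B i" by metis
  have "cmod (\<Sum>i\<in>A. c i * f i x) \<le> (\<Sum>i\<in>A. cmod (c i) * B i)" for x
    by (rule order_trans[OF norm_sum]) (auto simp: norm_mult intro!: sum_mono mult_left_mono B)
  then have "bounded (range (\<lambda>x. \<Sum>i\<in>A. c i * f i x))"
    unfolding bounded_iff by auto
  then show ?thesis
    using assms unfolding test_function_def by (auto intro!: continuous_intros)
qed

lemma test_function_L2:
  assumes "test_function u"
  shows "u \<in> L2"
proof (rule L2_I)
  have u: "integrable lborel u" using assms by (simp add: test_function_def)
  show [measurable]: "u \<in> borel_measurable borel" using borel_measurable_integrable[OF u] by simp
  obtain B where B: "\<And>x. cmod (u x) \<le> B" using test_function_bound[OF assms] by blast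
  show "integrable lborel (\<lambda>x. (cmod (u x))\<^sup>2)"
  proof (rule Bochner_Integration.integrable_bound)
    show "integrable lborel (\<lambda>x. B * cmod (u x))" using u by simp
    have "(cmod (u x))\<^sup>2 \<le> B * cmod (u x)" for x
      using B[of x] by (simp add: power2_eq_square mult_right_mono)
    moreover have "0 \<le> B * cmod (u x)" for x
      using B[of x] by (intro mult_nonneg_nonneg) (auto intro: order_trans[OF norm_ge_zero])
    ultimately show "AE x in lborel. norm ((cmod (u x))\<^sup>2) \<le> norm (B * cmod (u x))" by auto
  qed measurable
qed

text \<open>For \<open>k > 0\<close> this is the radial retraction of the complex plane onto the
  disc of radius \<open>k\<close>.\<close>

definition clip :: "real \<Rightarrow> complex \<Rightarrow> complex" where
  "clip k z = (1 / max 1 (cmod z / k)) *\<^sub>R z"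

lemma continuous_on_clip: "continuous_on UNIV (clip k)"
  unfolding clip_def[abs_def] by (cases "k = 0") (auto intro!: continuous_intros)

lemma clip_eq: "cmod z \<le> k \<Longrightarrow> k > 0 \<Longrightarrow> clip k z = z"
  by (simp add: clip_def max_def)

lemma cmod_clip_le: "k > 0 \<Longrightarrow> cmod (clip k z) \<le> k" and cmod_clip_le_self: "k > 0 \<Longrightarrow> cmod (clip k z) \<le> cmod z"
  by (auto simp: clip_def max_def divide_simps mult_left_le)

definition cutoff :: "real \<Rightarrow> 'a::euclidean_space \<Rightarrow> real" where
  "cutoff k x = max 0 (min 1 (k + 1 - norm x))"

lemma continuous_on_cutoff: "continuous_on UNIV (cutoff k)"
  unfolding cutoff_def[abs_def] by (intro continuous_intros)

lemma cutoff_eq_1: "norm x \<le> k \<Longrightarrow> cutoff k x = 1"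
  and cutoff_nonneg: "0 \<le> cutoff k x"
  and cutoff_le_1: "cutoff k x \<le> 1"
  and cutoff_le_indicator: "cutoff k x \<le> indicator (cball 0 (k + 1)) x"
  by (auto simp: cutoff_def indicator_def)

text \<open>Continuous functions converging to \<open>u\<close> almost everywhere need not converge
  in L2. Therefore \<open>u\<close> is first truncated in range and in space to \<open>v k\<close>;
  putting the continuous functions through the same truncation gives them a common integrable
  bound.\<close>

lemma L2_approx_test_function:
  fixes u :: "'a::euclidean_space \<Rightarrow> complex"
  assumes u: "u \<in> L2" and \<tau>: "\<tau> > 0"
  obtains \<phi> where "test_function \<phi>" "(LINT x|lborel. (cmod (\<phi> x - u x))\<^sup>2) < \<tau>"
proof -
  have um[measurable]: "u \<in> borel_measurable borel" using L2_measurable[OF u] .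
  have [measurable]: "clip k \<in> borel_measurable borel" for k
    by (intro borel_measurable_continuous_onI continuous_on_clip)
  have [measurable]: "(cutoff k :: 'a \<Rightarrow> real) \<in> borel_measurable borel" for k
    by (intro borel_measurable_continuous_onI continuous_on_cutoff)
  define v where "v k x = complex_of_real (cutoff (real (Suc k)) x) * clip (real (Suc k)) (u x)" for k x
  have [measurable]: "v k \<in> borel_measurable borel" for k
    unfolding v_def[abs_def] by measurable
  have v_le: "cmod (v k x) \<le> 1 * cmod (u x)" for k x
    unfolding v_def norm_mult norm_of_real
    by (intro mult_mono cmod_clip_le_self) (auto simp: cutoff_nonneg cutoff_le_1)
  have vL2: "v k \<in> L2" for k
    by (rule L2_dominated[OF u, where C=1]) (use v_le in auto)
  have "(\<lambda>k. LINT x|lborel. (cmod (v k x - u x))\<^sup>2) \<longlonglongrightarrow> (LINT x::'a|lborel. 0)"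
  proof (rule integral_dominated_convergence[where w="\<lambda>x. 4 * (cmod (u x))\<^sup>2"])
    show "AE x in lborel. (\<lambda>k. (cmod (v k x - u x))\<^sup>2) \<longlonglongrightarrow> 0"
    proof (rule AE_I2)
      fix x
      obtain K where K: "max (norm x) (cmod (u x)) \<le> real K" using real_arch_simple by blast
      have "v k x = u x" if "k \<ge> K" for k
        using K that by (simp add: v_def cutoff_eq_1 clip_eq)
      then have "\<forall>\<^sub>F k in sequentially. (cmod (v k x - u x))\<^sup>2 = 0"
        by (intro eventually_sequentiallyI[of K]) auto
      then show "(\<lambda>k. (cmod (v k x - u x))\<^sup>2) \<longlonglongrightarrow> 0" by (rule tendsto_eventually)
    qed
    show "AE x in lborel. norm ((cmod (v k x - u x))\<^sup>2) \<le> 4 * (cmod (u x))\<^sup>2" for k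
    proof (rule AE_I2)
      fix x
      have "cmod (v k x - u x) \<le> 2 * cmod (u x)"
        using v_le[of k x] norm_triangle_ineq4[of "v k x" "u x"] by simp
      then have "(cmod (v k x - u x))\<^sup>2 \<le> (2 * cmod (u x))\<^sup>2" by (intro power_mono) auto
      then show "norm ((cmod (v k x - u x))\<^sup>2) \<le> 4 * (cmod (u x))\<^sup>2"
        by (simp add: power_mult_distrib)
    qed
  qed (use L2_square_integrable[OF u] in auto)
  \<comment> \<open>Two errors below \<open>\<tau> / 4\<close> suffice, because
    \<open>norm_add_square_le\<close> doubles each of them.\<close>
  then have "\<forall>\<^sub>F k in sequentially. (LINT x|lborel. (cmod (v k x - u x))\<^sup>2) < \<tau> / 4"
    using \<tau> by (intro order_tendstoD(2)[where y=0]) auto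
  then obtain k where k: "(LINT x|lborel. (cmod (v k x - u x))\<^sup>2) < \<tau> / 4"
    unfolding eventually_sequentially by blast
  define K where "K = real (Suc k)"
  have K: "K > 0" by (simp add: K_def)
  \<comment> \<open>A Lebesgue measurable function is the limit of continuous functions off a
    negligible set.\<close>
  have "u measurable_on UNIV"
    using um by (intro lebesgue_measurable_imp_measurable_on) (auto intro: measurable_completion)
  then obtain N g where N: "negligible N" and g: "\<And>n. continuous_on UNIV (g n)"
    and gu: "\<And>x. x \<notin> N \<Longrightarrow> (\<lambda>n. g n x) \<longlonglongrightarrow> u x"
    unfolding measurable_on_def by auto
  have gu_AE: "AE x in lborel. (\<lambda>n. g n x) \<longlonglongrightarrow> u x"
  proof -
    have "AE x in lebesgue. x \<notin> N"
      using N by (intro AE_not_in) (simp add: negligible_iff_null_sets)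
    then have "AE x in lborel. x \<notin> N" by (simp add: AE_completion_iff)
    then show ?thesis by eventually_elim (rule gu)
  qed
  define \<phi> where "\<phi> n x = complex_of_real (cutoff K x) * clip K (g n x)" for n x
  have \<phi>_cont: "continuous_on UNIV (\<phi> n)" for n
    unfolding \<phi>_def[abs_def]
    by (intro continuous_intros continuous_on_cutoff continuous_on_compose2[OF continuous_on_clip g]) auto
  have [measurable]: "\<phi> n \<in> borel_measurable borel" for n
    by (intro borel_measurable_continuous_onI \<phi>_cont)
  have \<phi>_le: "cmod (\<phi> n x) \<le> K * indicator (cball 0 (K + 1)) x" for n x
  proof -
    have "cmod (\<phi> n x) \<le> indicator (cball 0 (K + 1)) x * K"
      unfolding \<phi>_def norm_mult norm_of_real using K
      by (intro mult_mono) (auto simp: cutoff_nonneg cutoff_le_indicator cmod_clip_le)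
    then show ?thesis by (simp add: mult.commute)
  qed
  have v_le': "cmod (v k x) \<le> K * indicator (cball 0 (K + 1)) x" for x
  proof -
    have "cmod (v k x) \<le> indicator (cball 0 (K + 1)) x * K"
      unfolding v_def norm_mult norm_of_real K_def[symmetric] using K
      by (intro mult_mono) (auto simp: cutoff_nonneg cutoff_le_indicator cmod_clip_le)
    then show ?thesis by (simp add: mult.commute)
  qed
  have ind: "integrable lborel (\<lambda>x. c * indicator (cball 0 (K + 1)) (x::'a))" for c :: real
    using emeasure_bounded_finite[OF bounded_cball, of "0::'a" "K + 1"]
    by (intro integrable_mult_right integrable_real_indicator) auto
  have \<phi>_test: "test_function (\<phi> n)" for n
    unfolding test_function_def
  proof (intro conjI \<phi>_cont)
    have "cmod (\<phi> n x) \<le> K" for x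
      using \<phi>_le[of n x] K by (cases "norm x \<le> K + 1") auto
    then show "bounded (range (\<phi> n))" unfolding bounded_iff by auto
    show "integrable lborel (\<phi> n)"
      by (rule Bochner_Integration.integrable_bound[OF ind[of K]])
        (use \<phi>_le K in \<open>auto simp: abs_mult\<close>)
  qed
  have "(\<lambda>n. LINT x|lborel. (cmod (\<phi> n x - v k x))\<^sup>2) \<longlonglongrightarrow> (LINT x::'a|lborel. 0)"
  proof (rule integral_dominated_convergence[where w="\<lambda>x. 4 * K\<^sup>2 * indicator (cball 0 (K + 1)) x"])
    show "AE x in lborel. (\<lambda>n. (cmod (\<phi> n x - v k x))\<^sup>2) \<longlonglongrightarrow> 0"
      using gu_AE
    proof eventually_elim
      case (elim x)
      have "(\<lambda>n. clip K (g n x)) \<longlonglongrightarrow> clip K (u x)"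
        using elim by (intro continuous_on_tendsto_compose[OF continuous_on_clip]) auto
      then have "(\<lambda>n. (cmod (\<phi> n x - v k x))\<^sup>2) \<longlonglongrightarrow>
          (cmod (complex_of_real (cutoff K x) * clip K (u x) - v k x))\<^sup>2"
        unfolding \<phi>_def by (intro tendsto_intros)
      then show ?case by (simp add: v_def K_def)
    qed
    show "AE x in lborel. norm ((cmod (\<phi> n x - v k x))\<^sup>2) \<le> 4 * K\<^sup>2 * indicator (cball 0 (K + 1)) x" for n
    proof (rule AE_I2)
      fix x :: 'a
      have "cmod (\<phi> n x - v k x) \<le> 2 * (K * indicator (cball 0 (K + 1)) x)"
        using v_le'[of x] \<phi>_le[of n x] norm_triangle_ineq4[of "\<phi> n x" "v k x"] by simp
      then have "(cmod (\<phi> n x - v k x))\<^sup>2 \<le> (2 * (K * indicator (cball 0 (K + 1)) x))\<^sup>2"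
        by (intro power_mono) auto
      then show "norm ((cmod (\<phi> n x - v k x))\<^sup>2) \<le> 4 * K\<^sup>2 * indicator (cball 0 (K + 1)) x"
        by (cases "norm x \<le> K + 1") (simp_all add: power_mult_distrib)
    qed
  qed (use ind in \<open>auto simp: mult.assoc\<close>)
  then have "\<forall>\<^sub>F n in sequentially. (LINT x|lborel. (cmod (\<phi> n x - v k x))\<^sup>2) < \<tau> / 4"
    using \<tau> by (intro order_tendstoD(2)[where y=0]) auto
  then obtain n where n: "(LINT x|lborel. (cmod (\<phi> n x - v k x))\<^sup>2) < \<tau> / 4"
    unfolding eventually_sequentially by blast
  have i1: "integrable lborel (\<lambda>x. (cmod (\<phi> n x - v k x))\<^sup>2)"
    and i2: "integrable lborel (\<lambda>x. (cmod (v k x - u x))\<^sup>2)"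
    and i3: "integrable lborel (\<lambda>x. (cmod (\<phi> n x - u x))\<^sup>2)"
    by (intro L2_square_integrable L2_diff test_function_L2 \<phi>_test vL2 u)+
  have "(LINT x|lborel. (cmod (\<phi> n x - u x))\<^sup>2) \<le>
      (LINT x|lborel. 2 * (cmod (\<phi> n x - v k x))\<^sup>2 + 2 * (cmod (v k x - u x))\<^sup>2)"
  proof (rule integral_mono)
    show "(cmod (\<phi> n x - u x))\<^sup>2 \<le> 2 * (cmod (\<phi> n x - v k x))\<^sup>2 + 2 * (cmod (v k x - u x))\<^sup>2" for x
      using norm_add_square_le[of "\<phi> n x - v k x" "v k x - u x"] by simp
  qed (use i1 i2 i3 in auto)
  also have "\<dots> < \<tau>" using n k i1 i2 by simp
  finally show thesis using that \<phi>_test by blast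
qed

text \<open>A double integral, because it converges absolutely for all pairs in L2. The convolution
  integral itself may diverge on a null set, where its default value 0 would break
  linearity.\<close>

definition conv_form ::
  "('a::euclidean_space \<Rightarrow> complex) \<Rightarrow> ('a \<Rightarrow> complex) \<Rightarrow> ('a \<Rightarrow> complex) \<Rightarrow> complex" where
  "conv_form a u v = (LINT (x, y)|(lborel \<Otimes>\<^sub>M lborel). a (x - y) * u y * cnj (v x))"

text \<open>The elementary inequality \<open>\<bar>u\<bar> \<bar>v\<bar> \<le> s
  \<bar>u\<bar>\<^sup>2 + \<bar>v\<bar>\<^sup>2 / s\<close> stands in for Cauchy-Schwarz; each term
  then factors by translation invariance. The free parameter is later set to \<open>\<tau>\<close>
  or \<open>1 / \<tau>\<close>, whichever makes the bound small.\<close>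

lemma
  fixes a u v :: "'a::euclidean_space \<Rightarrow> complex"
  assumes a: "integrable lborel a" and u: "u \<in> L2" and v: "v \<in> L2"
  shows integrable_conv_form:
      "integrable (lborel \<Otimes>\<^sub>M lborel) (\<lambda>(x, y). a (x - y) * u y * cnj (v x))"
    and cmod_conv_form_le: "s > 0 \<Longrightarrow> cmod (conv_form a u v) \<le> (LINT x|lborel. cmod (a x)) *
      (s * (LINT x|lborel. (cmod (u x))\<^sup>2) + (LINT x|lborel. (cmod (v x))\<^sup>2) / s)"
proof -
  note [measurable] = L2_measurable[OF u] L2_measurable[OF v]
  have [measurable]: "a \<in> borel_measurable borel" using borel_measurable_integrable[OF a] by simp
  let ?A = "LINT x|lborel. cmod (a x)"
  let ?U = "LINT x|lborel. (cmod (u x))\<^sup>2" and ?V = "LINT x|lborel. (cmod (v x))\<^sup>2"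
  have sq: "integrable lborel (\<lambda>x. complex_of_real ((cmod (w x))\<^sup>2))" if "w \<in> L2" for w :: "'a \<Rightarrow> complex"
    using L2_square_integrable[OF that] by (rule integrable_of_real)
  have absa: "integrable lborel (\<lambda>x. complex_of_real (cmod (a x)))" using a by (intro integrable_of_real) simp
  \<comment> \<open>The term in \<open>v x\<close> has the roles of the two variables exchanged, so
    it is a convolution with the reflected kernel.\<close>
  have absa': "integrable lborel (\<lambda>x. complex_of_real (cmod (a (- x))))"
    using lborel_integrable_uminus[OF absa] by simp
  have P: "integrable (lborel \<Otimes>\<^sub>M lborel) (\<lambda>(y, x). cmod (a (x - y)) * (cmod (u y))\<^sup>2)"
    using integrable_Re[OF integrable_convolution_pair[OF absa sq[OF u]]]
    by (simp add: split_beta')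
  have P': "integrable (lborel \<Otimes>\<^sub>M lborel) (\<lambda>(x, y). cmod (a (x - y)) * (cmod (u y))\<^sup>2)"
    using lborel_pair.integrable_product_swap[OF P] by (simp add: split_beta')
  have Q: "integrable (lborel \<Otimes>\<^sub>M lborel) (\<lambda>(x, y). cmod (a (x - y)) * (cmod (v x))\<^sup>2)"
    using integrable_Re[OF integrable_convolution_pair[OF absa' sq[OF v]]]
    by (simp add: split_beta')
  have bound: "cmod (a (x - y) * u y * cnj (v x)) \<le>
      s * (cmod (a (x - y)) * (cmod (u y))\<^sup>2) + cmod (a (x - y)) * (cmod (v x))\<^sup>2 / s"
    if s: "s > 0" for s x y
  proof -
    have "2 * (cmod (u y) * cmod (v x)) \<le> s * (cmod (u y))\<^sup>2 + (cmod (v x))\<^sup>2 / s"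
    proof -
      have "0 \<le> (s * cmod (u y) - cmod (v x))\<^sup>2 / s" using s by simp
      also have "\<dots> = s * (cmod (u y))\<^sup>2 + (cmod (v x))\<^sup>2 / s - 2 * (cmod (u y) * cmod (v x))"
        using s by (simp add: power2_eq_square field_simps)
      finally show ?thesis by simp
    qed
    moreover have "0 \<le> cmod (u y) * cmod (v x)" by simp
    ultimately have "cmod (u y) * cmod (v x) \<le> s * (cmod (u y))\<^sup>2 + (cmod (v x))\<^sup>2 / s" by linarith
    then have "cmod (a (x - y)) * (cmod (u y) * cmod (v x)) \<le>
        cmod (a (x - y)) * (s * (cmod (u y))\<^sup>2 + (cmod (v x))\<^sup>2 / s)"
      by (intro mult_left_mono) auto
    then show ?thesis by (simp add: norm_mult algebra_simps)
  qed
  have PQ: "integrable (lborel \<Otimes>\<^sub>M lborel) (\<lambda>(x, y).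
      s * (cmod (a (x - y)) * (cmod (u y))\<^sup>2) + cmod (a (x - y)) * (cmod (v x))\<^sup>2 / s)" for s
    using P' Q by (simp add: split_beta')
  show int: "integrable (lborel \<Otimes>\<^sub>M lborel) (\<lambda>(x, y). a (x - y) * u y * cnj (v x))"
  proof (rule Bochner_Integration.integrable_bound[OF PQ[of 1]])
    show "AE z in lborel \<Otimes>\<^sub>M lborel. norm (case z of (x, y) \<Rightarrow> a (x - y) * u y * cnj (v x)) \<le>
        norm (case z of (x, y) \<Rightarrow> 1 * (cmod (a (x - y)) * (cmod (u y))\<^sup>2) + cmod (a (x - y)) * (cmod (v x))\<^sup>2 / 1)"
      by (intro AE_I2) (use bound[of 1] in \<open>force split: prod.split intro: order_trans[OF _ abs_ge_self]\<close>)
  qed measurable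
  have IP: "(LINT (x, y)|(lborel \<Otimes>\<^sub>M lborel). cmod (a (x - y)) * (cmod (u y))\<^sup>2) = ?A * ?U"
  proof -
    have "(LINT (x, y)|(lborel \<Otimes>\<^sub>M lborel). cmod (a (x - y)) * (cmod (u y))\<^sup>2) =
        (LINT y|lborel. LINT x|lborel. cmod (a (x - y)) * (cmod (u y))\<^sup>2)"
      using lborel_pair.integral_snd[OF P'] by simp
    also have "(\<lambda>y. LINT x|lborel. cmod (a (x - y)) * (cmod (u y))\<^sup>2) = (\<lambda>y. ?A * (cmod (u y))\<^sup>2)"
      using lborel_integral_translate[of "\<lambda>x. cmod (a x)"] by simp
    finally show ?thesis by simp
  qed
  have IQ: "(LINT (x, y)|(lborel \<Otimes>\<^sub>M lborel). cmod (a (x - y)) * (cmod (v x))\<^sup>2) = ?A * ?V"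
  proof -
    have "(LINT (x, y)|(lborel \<Otimes>\<^sub>M lborel). cmod (a (x - y)) * (cmod (v x))\<^sup>2) =
        (LINT x|lborel. LINT y|lborel. cmod (a (x - y)) * (cmod (v x))\<^sup>2)"
      using lborel_pair.integral_fst[OF Q] by simp
    also have "(\<lambda>x. LINT y|lborel. cmod (a (x - y)) * (cmod (v x))\<^sup>2) = (\<lambda>x. ?A * (cmod (v x))\<^sup>2)"
      using lborel_integral_reflect_translate[of "\<lambda>x. cmod (a x)"] by simp
    finally show ?thesis by simp
  qed
  assume s: "s > 0"
  have "cmod (conv_form a u v) \<le> (LINT z|(lborel \<Otimes>\<^sub>M lborel).
      (case z of (x, y) \<Rightarrow> s * (cmod (a (x - y)) * (cmod (u y))\<^sup>2) + cmod (a (x - y)) * (cmod (v x))\<^sup>2 / s))"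
    unfolding conv_form_def
  proof (rule order_trans[OF integral_norm_bound integral_mono])
    show "integrable (lborel \<Otimes>\<^sub>M lborel) (\<lambda>z. norm (case z of (x, y) \<Rightarrow> a (x - y) * u y * cnj (v x)))"
      by (rule integrable_norm[OF int])
  qed (use PQ bound[OF s] in \<open>auto split: prod.split\<close>)
  also have "\<dots> = s * (?A * ?U) + ?A * ?V / s"
    unfolding IP[symmetric] IQ[symmetric] using P' Q by (simp add: split_beta')
  finally show "cmod (conv_form a u v) \<le> ?A * (s * ?U + ?V / s)"
    by (simp add: algebra_simps)
qed


section \<open>The quadratic form of the operator\<close>

lemma AE_lborel_translate:
  fixes x :: "'a::euclidean_space"
  assumes "AE z in lborel. P z"
  shows "AE y in lborel. P (y - x)"
proof -
  have "AE z in distr lborel borel ((+) (- x)). P z"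
    unfolding lborel_distr_plus by (rule assms)
  then have "AE y in lborel. P (- x + y)"
    by (rule AE_distrD[rotated]) simp
  then show ?thesis by simp
qed

lemma
  fixes a u v :: "'a::euclidean_space \<Rightarrow> complex"
  assumes a: "integrable lborel a" and u: "u \<in> L2" and v: "v \<in> L2"
  shows integrable_convolution_mult_cnj: "integrable lborel (\<lambda>x. convolution a u x * cnj (v x))"
    and conv_form_eq_convolution: "conv_form a u v = (LINT x|lborel. convolution a u x * cnj (v x))"
proof -
  note int = integrable_conv_form[OF a u v]
  show "integrable lborel (\<lambda>x. convolution a u x * cnj (v x))"
    using lborel_pair.integrable_fst[OF int] by (simp add: convolution_def)
  show "conv_form a u v = (LINT x|lborel. convolution a u x * cnj (v x))"
    unfolding conv_form_def using lborel_pair.integral_fst[OF int] by (simp add: convolution_def)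
qed

text \<open>Conjugation and an exchange of the order of integration replace the kernel by its
  conjugate reflection. The symmetry of \<open>a\<close> holds only almost everywhere, so for each
  \<open>x\<close> its exceptional null set is translated by \<open>x\<close>.\<close>

lemma conv_form_hermitian:
  fixes a u v :: "'a::euclidean_space \<Rightarrow> complex"
  assumes a: "integrable lborel a" and sym: "hermitian_ae a" and u: "u \<in> L2" and v: "v \<in> L2"
  shows "conv_form a v u = cnj (conv_form a u v)"
proof -
  note [measurable] = L2_measurable[OF u] L2_measurable[OF v]
  have [measurable]: "a \<in> borel_measurable borel" using borel_measurable_integrable[OF a] by simp
  have "cnj (conv_form a u v) = cnj (LINT y|lborel. LINT x|lborel. a (x - y) * u y * cnj (v x))"
    unfolding conv_form_def using lborel_pair.integral_snd[OF integrable_conv_form[OF a u v]] by simp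
  also have "\<dots> = (LINT x|lborel. LINT y|lborel. cnj (a (y - x)) * cnj (u x) * v y)"
    by (simp flip: Bochner_Integration.integral_cnj)
  also have "\<dots> = (LINT x|lborel. LINT y|lborel. a (x - y) * v y * cnj (u x))"
  proof (rule Bochner_Integration.integral_cong[OF refl])
    fix x
    show "(LINT y|lborel. cnj (a (y - x)) * cnj (u x) * v y) = (LINT y|lborel. a (x - y) * v y * cnj (u x))"
    proof (rule integral_cong_AE)
      have "AE y in lborel. a (- (y - x)) = cnj (a (y - x))"
        using sym unfolding hermitian_ae_def by (rule AE_lborel_translate)
      then show "AE y in lborel. cnj (a (y - x)) * cnj (u x) * v y = a (x - y) * v y * cnj (u x)"
        by eventually_elim simp
    qed measurable
  qed
  also have "\<dots> = conv_form a v u"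
    unfolding conv_form_def using lborel_pair.integral_fst[OF integrable_conv_form[OF a v u]] by simp
  finally show ?thesis ..
qed

lemma conv_form_sum_left:
  assumes a: "integrable lborel a" and f: "\<And>i. i \<in> A \<Longrightarrow> f i \<in> L2" and v: "v \<in> L2"
  shows "conv_form a (\<lambda>x. \<Sum>i\<in>A. c i * f i x) v = (\<Sum>i\<in>A. c i * conv_form a (f i) v)"
proof -
  have "conv_form a (\<lambda>x. \<Sum>i\<in>A. c i * f i x) v =
      (LINT z|(lborel \<Otimes>\<^sub>M lborel). (\<Sum>i\<in>A. c i * (case z of (x, y) \<Rightarrow> a (x - y) * f i y * cnj (v x))))"
    unfolding conv_form_def
    by (intro Bochner_Integration.integral_cong refl)
      (auto simp: sum_distrib_left sum_distrib_right ac_simps)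
  also have "\<dots> = (\<Sum>i\<in>A. c i * conv_form a (f i) v)"
    unfolding conv_form_def
    by (subst Bochner_Integration.integral_sum) (auto intro!: integrable_mult_right integrable_conv_form a f v)
  finally show ?thesis .
qed

lemma conv_form_sum_right:
  assumes a: "integrable lborel a" and f: "\<And>i. i \<in> A \<Longrightarrow> f i \<in> L2" and v: "v \<in> L2"
  shows "conv_form a v (\<lambda>x. \<Sum>i\<in>A. c i * f i x) = (\<Sum>i\<in>A. cnj (c i) * conv_form a v (f i))"
proof -
  have "conv_form a v (\<lambda>x. \<Sum>i\<in>A. c i * f i x) =
      (LINT z|(lborel \<Otimes>\<^sub>M lborel). (\<Sum>i\<in>A. cnj (c i) * (case z of (x, y) \<Rightarrow> a (x - y) * v y * cnj (f i x))))"
    unfolding conv_form_def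
    by (intro Bochner_Integration.integral_cong refl)
      (auto simp: sum_distrib_left sum_distrib_right ac_simps)
  also have "\<dots> = (\<Sum>i\<in>A. cnj (c i) * conv_form a v (f i))"
    unfolding conv_form_def
    by (subst Bochner_Integration.integral_sum) (auto intro!: integrable_mult_right integrable_conv_form a f v)
  finally show ?thesis .
qed

text \<open>It is used with \<open>W = v + m\<close>, as the form of the operator shifted by
  \<open>m\<close>; eigenvalues below \<open>- m\<close> become negative values of this
  form.\<close>

definition op_form :: "('a::euclidean_space \<Rightarrow> complex) \<Rightarrow> ('a \<Rightarrow> real) \<Rightarrow>
    ('a \<Rightarrow> complex) \<Rightarrow> ('a \<Rightarrow> complex) \<Rightarrow> complex" where
  "op_form a W u v = conv_form a u v + L2_inner (\<lambda>x. complex_of_real (W x) * u x) v"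

lemma L2_bounded_mult:
  fixes W :: "'a::euclidean_space \<Rightarrow> real"
  assumes "u \<in> L2" and [measurable]: "W \<in> borel_measurable borel" and "\<And>x. \<bar>W x\<bar> \<le> M"
  shows "(\<lambda>x. complex_of_real (W x) * u x) \<in> L2"
proof (rule L2_dominated[OF assms(1), where C=M])
  note [measurable] = L2_measurable[OF assms(1)]
  show "(\<lambda>x. complex_of_real (W x) * u x) \<in> borel_measurable borel" by measurable
qed (use assms(3) in \<open>auto simp: norm_mult intro!: mult_right_mono\<close>)

lemma cmod_L2_inner_le:
  assumes u: "u \<in> L2" and v: "v \<in> L2" and s: "s > 0"
  shows "cmod (L2_inner u v) \<le> s * (LINT x|lborel. (cmod (u x))\<^sup>2) + (LINT x|lborel. (cmod (v x))\<^sup>2) / s"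
proof -
  note i = L2_square_integrable[OF u] L2_square_integrable[OF v]
  have "cmod (L2_inner u v) \<le> (LINT x|lborel. s * (cmod (u x))\<^sup>2 + (cmod (v x))\<^sup>2 / s)"
    unfolding L2_inner_def
  proof (rule order_trans[OF integral_norm_bound integral_mono])
    show "integrable lborel (\<lambda>x. cmod (u x * cnj (v x)))"
      by (intro integrable_norm L2_integrable_mult_cnj u v)
    fix x
    have "0 \<le> (s * cmod (u x) - cmod (v x))\<^sup>2 / s" using s by simp
    also have "\<dots> = s * (cmod (u x))\<^sup>2 + (cmod (v x))\<^sup>2 / s - 2 * (cmod (u x) * cmod (v x))"
      using s by (simp add: power2_eq_square field_simps)
    moreover have "0 \<le> cmod (u x) * cmod (v x)" by simp
    ultimately show "cmod (u x * cnj (v x)) \<le> s * (cmod (u x))\<^sup>2 + (cmod (v x))\<^sup>2 / s"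
      unfolding norm_mult complex_mod_cnj by linarith
  qed (use i in auto)
  also have "\<dots> = s * (LINT x|lborel. (cmod (u x))\<^sup>2) + (LINT x|lborel. (cmod (v x))\<^sup>2) / s"
    using i by simp
  finally show ?thesis .
qed

lemma op_form_hermitian:
  assumes "integrable lborel a" "hermitian_ae a" "u \<in> L2" "v \<in> L2"
  shows "op_form a W v u = cnj (op_form a W u v)"
  using conv_form_hermitian[OF assms]
  by (simp add: op_form_def L2_inner_def mult.assoc mult.left_commute mult.commute flip: Bochner_Integration.integral_cnj)

context
  fixes a :: "'a::euclidean_space \<Rightarrow> complex" and W :: "'a \<Rightarrow> real" and M :: real
  assumes a: "integrable lborel a" and W: "W \<in> borel_measurable borel" and M: "\<And>x. \<bar>W x\<bar> \<le> M"
begin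

lemma op_form_sum_left:
  assumes f: "\<And>i. i \<in> A \<Longrightarrow> f i \<in> L2" and v: "v \<in> L2"
  shows "op_form a W (\<lambda>x. \<Sum>i\<in>A. c i * f i x) v = (\<Sum>i\<in>A. c i * op_form a W (f i) v)"
proof -
  have "(\<lambda>x. complex_of_real (W x) * (\<Sum>i\<in>A. c i * f i x)) =
      (\<lambda>x. \<Sum>i\<in>A. c i * (complex_of_real (W x) * f i x))"
    by (simp add: sum_distrib_left ac_simps)
  then show ?thesis
    unfolding op_form_def distrib_left sum.distrib
    by (simp add: conv_form_sum_left[OF a f v] L2_inner_sum_left[OF L2_bounded_mult[OF f W M] v])
qed

lemma op_form_sum_right:
  assumes f: "\<And>i. i \<in> A \<Longrightarrow> f i \<in> L2" and v: "v \<in> L2"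
  shows "op_form a W v (\<lambda>x. \<Sum>i\<in>A. c i * f i x) = (\<Sum>i\<in>A. cnj (c i) * op_form a W v (f i))"
  unfolding op_form_def distrib_left sum.distrib
  by (simp add: conv_form_sum_right[OF a f v] L2_inner_sum_right[OF f L2_bounded_mult[OF v W M]])

text \<open>\<open>M\<close> enters squared because the weighted inequality is applied to
  \<open>W u\<close> as a whole. The constant is crude, but it does not depend on
  \<open>s\<close>.\<close>

lemma cmod_op_form_le:
  assumes u: "u \<in> L2" and v: "v \<in> L2" and s: "s > 0"
  shows "cmod (op_form a W u v) \<le> ((LINT x|lborel. cmod (a x)) + M\<^sup>2 + 1) *
    (s * (LINT x|lborel. (cmod (u x))\<^sup>2) + (LINT x|lborel. (cmod (v x))\<^sup>2) / s)"
proof -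
  let ?A = "LINT x|lborel. cmod (a x)"
  let ?U = "LINT x|lborel. (cmod (u x))\<^sup>2" and ?V = "LINT x|lborel. (cmod (v x))\<^sup>2"
  have WL: "(\<lambda>x. complex_of_real (W x) * u x) \<in> L2" by (rule L2_bounded_mult[OF u W M])
  have "(LINT x|lborel. (cmod (complex_of_real (W x) * u x))\<^sup>2) \<le> (LINT x|lborel. M\<^sup>2 * (cmod (u x))\<^sup>2)"
  proof (rule integral_mono)
    show "(cmod (complex_of_real (W x) * u x))\<^sup>2 \<le> M\<^sup>2 * (cmod (u x))\<^sup>2" for x
      using power_mono[OF M[of x] abs_ge_zero, of 2]
      by (simp add: norm_mult power_mult_distrib mult_right_mono)
  qed (use L2_square_integrable[OF WL] L2_square_integrable[OF u] in auto)
  then have "s * (LINT x|lborel. (cmod (complex_of_real (W x) * u x))\<^sup>2) \<le> s * (M\<^sup>2 * ?U)"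
    using s by (intro mult_left_mono) auto
  then have *: "cmod (L2_inner (\<lambda>x. complex_of_real (W x) * u x) v) \<le> s * (M\<^sup>2 * ?U) + ?V / s"
      "0 \<le> s * ?U" "0 \<le> M\<^sup>2 * (?V / s)"
    using cmod_L2_inner_le[OF WL v s] s by (linarith, auto)
  have "cmod (L2_inner (\<lambda>x. complex_of_real (W x) * u x) v) \<le> (M\<^sup>2 + 1) * (s * ?U + ?V / s)"
  proof -
    have "(M\<^sup>2 + 1) * (p + q) = (M\<^sup>2 * p + q) + p + M\<^sup>2 * q" for p q :: real
      by (simp add: algebra_simps)
    then have "(M\<^sup>2 + 1) * (s * ?U + ?V / s) = (s * (M\<^sup>2 * ?U) + ?V / s) + s * ?U + M\<^sup>2 * (?V / s)"
      by simp
    with * show ?thesis by linarith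
  qed
  then have "cmod (op_form a W u v) \<le> ?A * (s * ?U + ?V / s) + (M\<^sup>2 + 1) * (s * ?U + ?V / s)"
    unfolding op_form_def
    by (intro order_trans[OF norm_triangle_ineq] add_mono cmod_conv_form_le[OF a u v s])
  then show ?thesis by (simp only: distrib_right add.assoc)
qed

text \<open>
  The family \<open>u\<close> diagonalises the form, so negative definiteness survives any perturbation that is
  small in \<open>L2\<close> compared with the entries \<open>D i\<close>, in particular one that leads to test functions.
\<close>

lemma op_form_neg_on_test_functions:
  fixes n :: nat
  assumes u: "\<And>i. i < n \<Longrightarrow> u i \<in> L2"
    and u1: "\<And>i. i < n \<Longrightarrow> (LINT x|lborel. (cmod (u i x))\<^sup>2) = 1"
    and diag: "\<And>i j. i < n \<Longrightarrow> j < n \<Longrightarrow>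
      op_form a W (u i) (u j) = (if i = j then complex_of_real (D i) else 0)"
    and D: "\<And>i. i < n \<Longrightarrow> D i < 0"
  obtains \<phi> where "\<And>i. i < n \<Longrightarrow> test_function (\<phi> i)"
    "\<And>c. \<exists>i<n. c i \<noteq> 0 \<Longrightarrow>
      Re (op_form a W (\<lambda>x. \<Sum>i<n. c i * \<phi> i x) (\<lambda>x. \<Sum>i<n. c i * \<phi> i x)) < 0"
proof -
  define K where "K = (LINT x|lborel. cmod (a x)) + M\<^sup>2 + 1"
  have K: "K \<ge> 1" by (simp add: K_def)
  \<comment> \<open>The inserted 1 keeps the minimum defined for \<open>n = 0\<close>.\<close>
  define \<delta> where "\<delta> = Min (insert 1 ((\<lambda>i. - D i) ` {..<n}))"
  have \<delta>: "\<delta> > 0" unfolding \<delta>_def by (subst Min_gr_iff) (simp_all add: D)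
  have \<delta>D: "D i \<le> - \<delta>" if "i < n" for i
  proof -
    have "\<delta> \<le> - D i" unfolding \<delta>_def using that by (intro Min_le) auto
    then show ?thesis by simp
  qed
  \<comment> \<open>The bound by 1 controls the norms of the approximants. The other entry makes the
    total error \<open>7 * K * \<tau> * n\<close> smaller than \<open>\<delta>\<close>; 8 in place
    of 7 and \<open>n + 1\<close> in place of \<open>n\<close> give strictness and allow
    \<open>n = 0\<close>.\<close>
  define \<tau> where "\<tau> = min 1 (\<delta> / (8 * K * (real n + 1)))"
  have \<tau>: "0 < \<tau>" "\<tau> \<le> 1" using \<delta> K by (auto simp: \<tau>_def)
  have \<tau>\<delta>: "7 * K * \<tau> * n < \<delta>"
  proof -
    have "\<tau> \<le> \<delta> / (8 * K * (real n + 1))" by (simp add: \<tau>_def)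
    then have "\<tau> * (8 * K * (real n + 1)) \<le> \<delta>" using K by (simp add: pos_le_divide_eq)
    moreover have "7 * K * \<tau> * n < \<tau> * (8 * K * (real n + 1))"
    proof -
      have "(K * \<tau>) * (7 * real n) < (K * \<tau>) * (8 * (real n + 1))"
        using K \<tau> by (intro mult_strict_left_mono) auto
      then show ?thesis by (simp add: ac_simps)
    qed
    ultimately show ?thesis by simp
  qed
  have "\<forall>i. \<exists>\<phi>. i < n \<longrightarrow> test_function \<phi> \<and> (LINT x|lborel. (cmod (\<phi> x - u i x))\<^sup>2) < \<tau>\<^sup>2"
    using L2_approx_test_function[OF u, of _ "\<tau>\<^sup>2"] \<tau> by (metis zero_less_power)
  then obtain \<phi> where \<phi>: "\<And>i. i < n \<Longrightarrow> test_function (\<phi> i)"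
    and \<phi>u: "\<And>i. i < n \<Longrightarrow> (LINT x|lborel. (cmod (\<phi> i x - u i x))\<^sup>2) < \<tau>\<^sup>2"
    by metis
  have \<phi>L2: "\<phi> i \<in> L2" if "i < n" for i using test_function_L2[OF \<phi>[OF that]] .
  have \<phi>4: "(LINT x|lborel. (cmod (\<phi> i x))\<^sup>2) \<le> 4" if i: "i < n" for i
  proof -
    note L = L2_diff[OF \<phi>L2[OF i] u[OF i]]
    have "(LINT x|lborel. (cmod (\<phi> i x))\<^sup>2) \<le> (LINT x|lborel. 2 * (cmod (\<phi> i x - u i x))\<^sup>2 + 2 * (cmod (u i x))\<^sup>2)"
    proof (rule integral_mono)
      show "(cmod (\<phi> i x))\<^sup>2 \<le> 2 * (cmod (\<phi> i x - u i x))\<^sup>2 + 2 * (cmod (u i x))\<^sup>2" for x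
        using norm_add_square_le[of "\<phi> i x - u i x" "u i x"] by simp
    qed (use L2_square_integrable[OF \<phi>L2[OF i]] L2_square_integrable[OF L] L2_square_integrable[OF u[OF i]] in auto)
    also have "\<dots> = 2 * (LINT x|lborel. (cmod (\<phi> i x - u i x))\<^sup>2) + 2"
      using L2_square_integrable[OF L] L2_square_integrable[OF u[OF i]] u1[OF i] by simp
    also have "\<dots> \<le> 4"
      using \<phi>u[OF i] \<tau> power_le_one[of \<tau> 2] by simp
    finally show ?thesis .
  qed
  define E where "E i j = op_form a W (\<phi> i) (\<phi> j) - op_form a W (u i) (u j)" for i j
  \<comment> \<open>One argument is changed at a time. With \<open>s = 1 / \<tau>\<close> the first
    difference costs \<open>\<tau> + 4 * \<tau>\<close>, with \<open>s = \<tau>\<close> the second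
    costs \<open>\<tau> + \<tau>\<close>; hence the factor 7.\<close>
  have E: "cmod (E i j) \<le> 7 * K * \<tau>" if i: "i < n" and j: "j < n" for i j
  proof -
    note Li = L2_diff[OF \<phi>L2[OF i] u[OF i]] and Lj = L2_diff[OF \<phi>L2[OF j] u[OF j]]
    \<comment> \<open>A difference is treated as a linear combination over the index set
      \<open>{0, 1}\<close> with coefficients 1 and -1.\<close>
    have l: "op_form a W (\<lambda>x. \<phi> i x - u i x) v = op_form a W (\<phi> i) v - op_form a W (u i) v"
      if "v \<in> L2" for v
      using op_form_sum_left[of "{0,1::nat}" "\<lambda>k. if k = 0 then \<phi> i else u i" v "\<lambda>k. if k = 0 then 1 else - 1"]
        that \<phi>L2[OF i] u[OF i] by simp
    have r: "op_form a W v (\<lambda>x. \<phi> j x - u j x) = op_form a W v (\<phi> j) - op_form a W v (u j)"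
      if "v \<in> L2" for v
      using op_form_sum_right[of "{0,1::nat}" "\<lambda>k. if k = 0 then \<phi> j else u j" v "\<lambda>k. if k = 0 then 1 else - 1"]
        that \<phi>L2[OF j] u[OF j] by simp
    have "E i j = op_form a W (\<lambda>x. \<phi> i x - u i x) (\<phi> j) + op_form a W (u i) (\<lambda>x. \<phi> j x - u j x)"
      unfolding E_def l[OF \<phi>L2[OF j]] r[OF u[OF i]] by simp
    then have "cmod (E i j) \<le> cmod (op_form a W (\<lambda>x. \<phi> i x - u i x) (\<phi> j)) +
        cmod (op_form a W (u i) (\<lambda>x. \<phi> j x - u j x))"
      using norm_triangle_ineq by simp
    also have "cmod (op_form a W (\<lambda>x. \<phi> i x - u i x) (\<phi> j)) \<le> K * (5 * \<tau>)"
    proof -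
      have "(1 / \<tau>) * (LINT x|lborel. (cmod (\<phi> i x - u i x))\<^sup>2) \<le> (1 / \<tau>) * \<tau>\<^sup>2"
        using \<phi>u[OF i] \<tau> by (intro mult_left_mono) auto
      then have "(1 / \<tau>) * (LINT x|lborel. (cmod (\<phi> i x - u i x))\<^sup>2) \<le> \<tau>"
        using \<tau> by (simp add: power2_eq_square)
      moreover have "(LINT x|lborel. (cmod (\<phi> j x))\<^sup>2) / (1 / \<tau>) \<le> 4 * \<tau>"
        using \<phi>4[OF j] \<tau> by simp
      ultimately have "K * ((1 / \<tau>) * (LINT x|lborel. (cmod (\<phi> i x - u i x))\<^sup>2) +
          (LINT x|lborel. (cmod (\<phi> j x))\<^sup>2) / (1 / \<tau>)) \<le> K * (5 * \<tau>)"
        using K by (intro mult_left_mono) auto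
      then show ?thesis
        by (rule order_trans[OF cmod_op_form_le[OF Li \<phi>L2[OF j], of "1 / \<tau>", folded K_def], rotated])
          (simp add: \<tau>)
    qed
    also have "cmod (op_form a W (u i) (\<lambda>x. \<phi> j x - u j x)) \<le> K * (2 * \<tau>)"
    proof -
      have "(LINT x|lborel. (cmod (\<phi> j x - u j x))\<^sup>2) / \<tau> \<le> \<tau>\<^sup>2 / \<tau>"
        using \<phi>u[OF j] \<tau> by (intro divide_right_mono) auto
      then have "(LINT x|lborel. (cmod (\<phi> j x - u j x))\<^sup>2) / \<tau> \<le> \<tau>"
        using \<tau> by (simp add: power2_eq_square)
      then have "K * (\<tau> * (LINT x|lborel. (cmod (u i x))\<^sup>2) +
          (LINT x|lborel. (cmod (\<phi> j x - u j x))\<^sup>2) / \<tau>) \<le> K * (2 * \<tau>)"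
        using K by (intro mult_left_mono) (auto simp: u1[OF i])
      then show ?thesis
        by (rule order_trans[OF cmod_op_form_le[OF u[OF i] Lj, of \<tau>, folded K_def], rotated])
          (simp add: \<tau>)
    qed
    finally show ?thesis by (simp add: algebra_simps)
  qed
  have "Re (op_form a W (\<lambda>x. \<Sum>i<n. c i * \<phi> i x) (\<lambda>x. \<Sum>i<n. c i * \<phi> i x)) < 0"
    if c: "\<exists>i<n. c i \<noteq> 0" for c
  proof -
    let ?S = "\<Sum>i<n. (cmod (c i))\<^sup>2"
    have S: "?S > 0" using c by (auto intro!: sum_pos2)
    have "op_form a W (\<lambda>x. \<Sum>i<n. c i * \<phi> i x) (\<lambda>x. \<Sum>i<n. c i * \<phi> i x) =
        (\<Sum>i<n. c i * (\<Sum>j<n. cnj (c j) * op_form a W (\<phi> i) (\<phi> j)))"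
      by (subst op_form_sum_left, (auto intro!: L2_lincomb \<phi>L2)[2])
        (intro sum.cong refl arg_cong2[where f="(*)"] op_form_sum_right, auto simp: \<phi>L2)
    also have "\<dots> = (\<Sum>i<n. c i * (\<Sum>j<n. cnj (c j) * (if i = j then complex_of_real (D i) else 0))) +
        (\<Sum>i<n. \<Sum>j<n. c i * cnj (c j) * E i j)"
      unfolding sum.distrib[symmetric] sum_distrib_left
      by (intro sum.cong refl) (simp add: E_def diag algebra_simps)
    also have "(\<Sum>i<n. c i * (\<Sum>j<n. cnj (c j) * (if i = j then complex_of_real (D i) else 0))) =
        complex_of_real (\<Sum>i<n. (cmod (c i))\<^sup>2 * D i)"
      unfolding of_real_sum
      by (intro sum.cong refl) (simp add: if_distrib complex_norm_square sum.delta cong: if_cong del: of_real_power)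
    finally have "Re (op_form a W (\<lambda>x. \<Sum>i<n. c i * \<phi> i x) (\<lambda>x. \<Sum>i<n. c i * \<phi> i x)) \<le>
        (\<Sum>i<n. (cmod (c i))\<^sup>2 * D i) + cmod (\<Sum>i<n. \<Sum>j<n. c i * cnj (c j) * E i j)"
      using complex_Re_le_cmod[of "\<Sum>i<n. \<Sum>j<n. c i * cnj (c j) * E i j"] by simp
    also have "(\<Sum>i<n. (cmod (c i))\<^sup>2 * D i) \<le> (\<Sum>i<n. (cmod (c i))\<^sup>2 * (- \<delta>))"
      using \<delta>D by (intro sum_mono mult_left_mono) auto
    also have "\<dots> = - \<delta> * ?S" by (simp add: sum_distrib_left mult.commute sum_negf)
    \<comment> \<open>Each product of two coefficients is at most half the sum of their squares;
      summing over both indices produces the factor \<open>n\<close>.\<close>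
    also have "cmod (\<Sum>i<n. \<Sum>j<n. c i * cnj (c j) * E i j) \<le>
        (\<Sum>i<n. \<Sum>j<n. ((cmod (c i))\<^sup>2 + (cmod (c j))\<^sup>2) / 2 * (7 * K * \<tau>))"
    proof (intro order_trans[OF norm_sum] sum_mono order_trans[OF norm_sum])
      fix i j assume "i \<in> {..<n}" "j \<in> {..<n}"
      then show "cmod (c i * cnj (c j) * E i j) \<le> ((cmod (c i))\<^sup>2 + (cmod (c j))\<^sup>2) / 2 * (7 * K * \<tau>)"
        using sum_squares_bound[of "cmod (c i)" "cmod (c j)"] unfolding norm_mult complex_mod_cnj
        by (intro mult_mono E) auto
    qed
    also have "\<dots> = (\<Sum>i<n. \<Sum>j<n. ((cmod (c i))\<^sup>2 + (cmod (c j))\<^sup>2) / 2) * (7 * K * \<tau>)"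
      by (simp only: sum_distrib_right)
    also have "(\<Sum>i<n. \<Sum>j<n. ((cmod (c i))\<^sup>2 + (cmod (c j))\<^sup>2) / 2) = n * ?S"
      by (simp add: sum.distrib add_divide_distrib sum_distrib_left[symmetric] sum_divide_distrib[symmetric])
    also have "- \<delta> * ?S + n * ?S * (7 * K * \<tau>) = - (\<delta> - 7 * K * \<tau> * n) * ?S"
      by (simp add: algebra_simps)
    also have "\<dots> < 0" using S \<tau>\<delta> by (intro mult_neg_pos) auto
    finally show ?thesis by simp
  qed
  then show thesis using that \<phi> by blast
qed

end


section \<open>The Birman-Schwinger bound\<close>

lemma fourier_sum:
  assumes "\<And>i. i \<in> A \<Longrightarrow> integrable lborel (f i)"
  shows "fourier (\<lambda>x. \<Sum>i\<in>A. c i * f i x) \<xi> = (\<Sum>i\<in>A. c i * fourier (f i) \<xi>)"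
proof -
  have "fourier (\<lambda>x. \<Sum>i\<in>A. c i * f i x) \<xi> =
      (LINT x|lborel. (\<Sum>i\<in>A. c i * (f i x * exp (- (\<i> * complex_of_real (\<xi> \<bullet> x))))))"
    unfolding fourier_def by (simp add: sum_distrib_right mult.assoc del: exp_minus)
  also have "\<dots> = (\<Sum>i\<in>A. c i * fourier (f i) \<xi>)"
    unfolding fourier_def
    by (subst Bochner_Integration.integral_sum)
      (auto intro!: integrable_mult_right integrable_fourier_kernel assms simp del: exp_minus)
  finally show ?thesis .
qed

text \<open>Here \<open>m\<close> is the negative of the minimum of the potential. The strict
  inequalities, which follow from finiteness of the two integrals, say that the denominators vanish
  only on null sets, so the default value of division by zero does not affect the real
  quotients.\<close>

locale birman_schwinger =
  fixes a :: "'a::euclidean_space \<Rightarrow> complex" and v p q :: "'a \<Rightarrow> real" and m M :: real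
  assumes a: "integrable lborel a"
    and v_measurable[measurable]: "v \<in> borel_measurable borel"
    and v_bounded: "\<And>x. \<bar>v x\<bar> \<le> M"
    and m_pos: "0 < m"
    and p: "p = minus_part (fourier a)"
    and q: "\<And>x. q x = - min 0 (v x)"
    and p_le: "\<And>\<xi>. p \<xi> \<le> m" and q_le: "\<And>x. q x \<le> m"
    and p_less: "AE \<xi> in lborel. p \<xi> < m" and q_less: "AE x in lborel. q x < m"
    and integrable_p: "integrable lborel (\<lambda>\<xi>. p \<xi> / (m - p \<xi>))"
    and integrable_q: "integrable lborel (\<lambda>x. q x / (m - q x))"
begin

definition c0 :: real where "c0 = 1 / (2 * pi) ^ DIM('a)"

lemma c0_pos: "c0 > 0"
  by (simp add: c0_def)

definition R :: "'a \<Rightarrow> real" where "R \<xi> = p \<xi> / (m - p \<xi>)"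
definition W :: "'a \<Rightarrow> real" where "W x = q x / (m - q x)"

lemma p_nonneg: "0 \<le> p \<xi>" and q_nonneg: "0 \<le> q x"
  by (simp_all add: p q minus_part_def)

lemma R_nonneg: "0 \<le> R \<xi>" and W_nonneg: "0 \<le> W x"
  using p_nonneg q_nonneg p_le q_le by (simp_all add: R_def W_def)

lemma R_integrable: "integrable lborel R" and W_integrable: "integrable lborel W"
  using integrable_p integrable_q by (simp_all add: R_def[abs_def] W_def[abs_def])

lemma continuous_on_p: "continuous_on UNIV p"
  unfolding p minus_part_def[abs_def]
  by (intro continuous_intros continuous_on_fourier a)

lemma measurable_p[measurable]: "p \<in> borel_measurable borel"
  by (intro borel_measurable_continuous_onI continuous_on_p)

lemma measurable_q[measurable]: "q \<in> borel_measurable borel"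
proof -
  have "q = (\<lambda>x. - min 0 (v x))" using q by auto
  then show ?thesis by simp
qed

lemma measurable_R[measurable]: "R \<in> borel_measurable borel"
  and measurable_W[measurable]: "W \<in> borel_measurable borel"
  unfolding R_def[abs_def] W_def[abs_def] by measurable

text \<open>As \<open>m - p \<le> m\<close>, almost everywhere \<open>p \<le> m R\<close>. Thus
  finiteness of \<open>I_a\<close> makes \<open>p\<close> itself integrable, and \<open>chi\<close>
  is given by an absolutely convergent integral.\<close>

lemma p_integrable: "integrable lborel p"
proof (rule Bochner_Integration.integrable_bound)
  show "integrable lborel (\<lambda>\<xi>. m * R \<xi>)" using R_integrable by simp
  show "AE \<xi> in lborel. norm (p \<xi>) \<le> norm (m * R \<xi>)"
    using p_less
  proof eventually_elim
    case (elim \<xi>)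
    have "p \<xi> * (m - p \<xi>) \<le> p \<xi> * m" using p_nonneg[of \<xi>] by (intro mult_left_mono) auto
    then have "p \<xi> \<le> m * R \<xi>" using elim by (simp add: R_def field_simps)
    then show ?case using p_nonneg[of \<xi>] by simp
  qed
qed measurable

text \<open>
  The image of \<open>\<psi>\<close> under the Fourier multiplier with symbol \<open>p\<close>; evaluating \<open>fourier\<close> at \<open>- x\<close>
  gives the inverse transform.
\<close>

definition chi :: "('a \<Rightarrow> complex) \<Rightarrow> 'a \<Rightarrow> complex" where
  "chi \<psi> x = complex_of_real c0 * fourier (\<lambda>\<xi>. complex_of_real (p \<xi>) * fourier \<psi> \<xi>) (- x)"

text \<open>Integrability is supplied by \<open>p\<close>, boundedness and continuity by both
  factors. As a result \<open>plancherel\<close> can be applied a second time, to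
  \<open>chi\<close>.\<close>

lemma test_function_p_fourier:
  assumes "test_function \<psi>"
  shows "test_function (\<lambda>\<xi>. complex_of_real (p \<xi>) * fourier \<psi> \<xi>)"
  unfolding test_function_def
proof (intro conjI)
  have \<psi>: "integrable lborel \<psi>" using assms by (simp add: test_function_def)
  have [measurable]: "fourier \<psi> \<in> borel_measurable borel" by (rule borel_measurable_fourier[OF \<psi>])
  show "continuous_on UNIV (\<lambda>\<xi>. complex_of_real (p \<xi>) * fourier \<psi> \<xi>)"
    by (intro continuous_intros continuous_on_p continuous_on_fourier \<psi>)
  have "cmod (complex_of_real (p \<xi>) * fourier \<psi> \<xi>) \<le> m * (LINT x|lborel. cmod (\<psi> x))" for \<xi>
    unfolding norm_mult norm_of_real
    using p_nonneg[of \<xi>] p_le[of \<xi>] m_pos by (intro mult_mono cmod_fourier_le) auto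
  then show "bounded (range (\<lambda>\<xi>. complex_of_real (p \<xi>) * fourier \<psi> \<xi>))"
    unfolding bounded_iff by blast
  show "integrable lborel (\<lambda>\<xi>. complex_of_real (p \<xi>) * fourier \<psi> \<xi>)"
    by (rule integrable_mult_bounded[OF integrable_of_real[OF p_integrable] _ cmod_fourier_le]) measurable
qed

lemma cmod_chi_bounded:
  obtains B where "\<And>x. cmod (chi \<psi> x) \<le> B"
  using cmod_fourier_le[of "\<lambda>\<xi>. complex_of_real (p \<xi>) * fourier \<psi> \<xi>"] c0_pos
  unfolding chi_def norm_mult norm_of_real
  by (metis abs_of_pos mult_left_mono less_imp_le)

lemma chi_measurable:
  assumes "test_function \<psi>"
  shows "chi \<psi> \<in> borel_measurable borel"
proof -
  have "integrable lborel (\<lambda>\<xi>. complex_of_real (p \<xi>) * fourier \<psi> \<xi>)"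
    using test_function_p_fourier[OF assms] by (simp add: test_function_def)
  note [measurable] = borel_measurable_fourier[OF this]
  show ?thesis unfolding chi_def[abs_def] by measurable
qed

lemma integrable_W_chi:
  assumes "test_function \<psi>"
  shows "integrable lborel (\<lambda>x. W x * (cmod (chi \<psi> x))\<^sup>2)"
proof -
  obtain B where B: "\<And>x. cmod (chi \<psi> x) \<le> B" using cmod_chi_bounded by blast
  note [measurable] = chi_measurable[OF assms]
  show ?thesis
  proof (rule Bochner_Integration.integrable_bound)
    show "integrable lborel (\<lambda>x. W x * B\<^sup>2)" using W_integrable by simp
    show "AE x in lborel. norm (W x * (cmod (chi \<psi> x))\<^sup>2) \<le> norm (W x * B\<^sup>2)"
      using B W_nonneg by (intro AE_I2) (auto simp: abs_mult intro!: mult_left_mono power_mono)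
  qed measurable
qed

text \<open>Up to reflection, \<open>chi \<psi>\<close> is \<open>c0\<close> times a transform;
  Plancherel's constant cancels one of the two factors \<open>c0\<close>.\<close>

lemma
  assumes \<psi>: "test_function \<psi>"
  shows integrable_chi_square: "integrable lborel (\<lambda>x. (cmod (chi \<psi> x))\<^sup>2)"
    and integral_chi_square: "(LINT x|lborel. (cmod (chi \<psi> x))\<^sup>2) =
      c0 * (LINT \<xi>|lborel. (p \<xi>)\<^sup>2 * (cmod (fourier \<psi> \<xi>))\<^sup>2)"
proof -
  let ?g = "\<lambda>\<xi>. complex_of_real (p \<xi>) * fourier \<psi> \<xi>"
  have g: "test_function ?g" by (rule test_function_p_fourier[OF \<psi>])
  obtain B where B: "\<And>x. cmod (?g x) \<le> B" using test_function_bound[OF g] by blast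
  have g': "integrable lborel ?g" "continuous_on UNIV ?g" using g by (auto simp: test_function_def)
  note [measurable] = borel_measurable_fourier[OF g'(1)]
  have i: "integrable lborel (\<lambda>x. (cmod (fourier ?g x))\<^sup>2)"
    by (rule integrable_fourier_square[OF g' B])
  have eq: "(cmod (chi \<psi> x))\<^sup>2 = c0\<^sup>2 * (cmod (fourier ?g (- x)))\<^sup>2" for x
    using c0_pos by (simp add: chi_def norm_mult power_mult_distrib)
  show "integrable lborel (\<lambda>x. (cmod (chi \<psi> x))\<^sup>2)"
    unfolding eq using lborel_integrable_uminus[OF i] by simp
  have "(LINT x|lborel. (cmod (chi \<psi> x))\<^sup>2) = c0\<^sup>2 * (LINT x|lborel. (cmod (fourier ?g (- x)))\<^sup>2)"
    unfolding eq by simp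
  also have "(LINT x|lborel. (cmod (fourier ?g (- x)))\<^sup>2) = (LINT x|lborel. (cmod (fourier ?g x))\<^sup>2)"
    using lborel_integral_reflect_translate[of "\<lambda>x. (cmod (fourier ?g x))\<^sup>2" 0] by simp
  also have "\<dots> = (2 * pi) ^ DIM('a) * (LINT \<xi>|lborel. (cmod (?g \<xi>))\<^sup>2)"
    by (rule plancherel[OF g' B])
  also have "c0\<^sup>2 * \<dots> = c0 * (LINT \<xi>|lborel. (p \<xi>)\<^sup>2 * (cmod (fourier \<psi> \<xi>))\<^sup>2)"
  proof -
    have "c0\<^sup>2 * ((2 * pi) ^ DIM('a) * I) = c0 * I" for I
      by (simp add: c0_def power2_eq_square)
    then show ?thesis by (simp only: norm_mult power_mult_distrib norm_of_real power2_abs)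
  qed
  finally show "(LINT x|lborel. (cmod (chi \<psi> x))\<^sup>2) =
      c0 * (LINT \<xi>|lborel. (p \<xi>)\<^sup>2 * (cmod (fourier \<psi> \<xi>))\<^sup>2)" .
qed

text \<open>The outer transform in \<open>chi\<close> is moved onto the reflected conjugate of
  \<open>\<psi>\<close>, where it becomes the conjugate of the transform of \<open>\<psi>\<close>;
  no inversion is required.\<close>

lemma integral_chi_mult_cnj:
  assumes \<psi>: "test_function \<psi>"
  shows "(LINT x|lborel. chi \<psi> x * cnj (\<psi> x)) =
    complex_of_real (c0 * (LINT \<xi>|lborel. p \<xi> * (cmod (fourier \<psi> \<xi>))\<^sup>2))"
proof -
  let ?g = "\<lambda>\<xi>. complex_of_real (p \<xi>) * fourier \<psi> \<xi>"
  have g: "integrable lborel ?g" using test_function_p_fourier[OF \<psi>] by (simp add: test_function_def)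
  have \<psi>i: "integrable lborel \<psi>" using \<psi> by (simp add: test_function_def)
  then have \<psi>m[measurable]: "\<psi> \<in> borel_measurable borel" using borel_measurable_integrable by force
  note [measurable] = borel_measurable_fourier[OF g]
  have \<psi>': "integrable lborel (\<lambda>x. cnj (\<psi> (- x)))"
    using lborel_integrable_uminus[OF \<psi>i] by (simp add: integrable_cnj)
  have "(LINT x|lborel. chi \<psi> x * cnj (\<psi> x)) = c0 * (LINT x|lborel. fourier ?g (- x) * cnj (\<psi> x))"
    by (simp add: chi_def mult.assoc)
  also have "(LINT x|lborel. fourier ?g (- x) * cnj (\<psi> x)) = (LINT x|lborel. fourier ?g x * cnj (\<psi> (- x)))"
    using lborel_integral_reflect_translate[of "\<lambda>x. fourier ?g x * cnj (\<psi> (- x))" 0] by simp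
  also have "\<dots> = (LINT \<xi>|lborel. ?g \<xi> * cnj (fourier \<psi> \<xi>))"
    unfolding integral_fourier_mult[OF g \<psi>'] cnj_fourier[OF \<psi>m] ..
  also have "\<dots> = (LINT \<xi>|lborel. complex_of_real (p \<xi> * (cmod (fourier \<psi> \<xi>))\<^sup>2))"
    unfolding of_real_mult complex_norm_square by (simp only: mult.assoc)
  also have "\<dots> = complex_of_real (LINT \<xi>|lborel. p \<xi> * (cmod (fourier \<psi> \<xi>))\<^sup>2)"
    by (rule integral_complex_of_real)
  finally show ?thesis by (simp only: of_real_mult)
qed

lemma integrable_bounded_fourier_square:
  fixes h :: "'a \<Rightarrow> real"
  assumes \<psi>: "test_function \<psi>" and h: "integrable lborel h"
  shows "integrable lborel (\<lambda>\<xi>. h \<xi> * (cmod (fourier \<psi> \<xi>))\<^sup>2)"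
proof -
  have [measurable]: "fourier \<psi> \<in> borel_measurable borel"
    using \<psi> by (intro borel_measurable_fourier) (simp add: test_function_def)
  have [measurable]: "h \<in> borel_measurable borel" using borel_measurable_integrable[OF h] by simp
  show ?thesis
  proof (rule Bochner_Integration.integrable_bound)
    show "integrable lborel (\<lambda>\<xi>. h \<xi> * (LINT x|lborel. cmod (\<psi> x))\<^sup>2)" using h by simp
    show "AE \<xi> in lborel. norm (h \<xi> * (cmod (fourier \<psi> \<xi>))\<^sup>2) \<le> norm (h \<xi> * (LINT x|lborel. cmod (\<psi> x))\<^sup>2)"
      by (intro AE_I2) (auto simp: abs_mult intro!: mult_left_mono power_mono cmod_fourier_le)
  qed measurable
qed

lemma p_square_integrable: "integrable lborel (\<lambda>\<xi>. (p \<xi>)\<^sup>2)"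
proof (rule Bochner_Integration.integrable_bound)
  show "integrable lborel (\<lambda>\<xi>. m * p \<xi>)" using p_integrable by simp
  show "AE \<xi> in lborel. norm ((p \<xi>)\<^sup>2) \<le> norm (m * p \<xi>)"
    using p_nonneg p_le m_pos
    by (intro AE_I2) (auto simp: power2_eq_square abs_mult intro!: mult_right_mono)
qed measurable

text \<open>The strict inequality of the form is played against the completed square: from
  \<open>Y < X\<close> and \<open>2 X \<le> (C + Z) / m + Y\<close> one gets
  \<open>m X - C < Z\<close>. By Plancherel, \<open>C\<close> has the symbol
  \<open>p\<^sup>2\<close>, so \<open>m X - C\<close> has the symbol
  \<open>p (m - p)\<close>.\<close>

lemma weighted_norm_less:
  assumes \<psi>: "test_function \<psi>" and neg: "Re (op_form a (\<lambda>x. v x + m) \<psi> \<psi>) < 0"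
  shows "(LINT \<xi>|lborel. c0 * p \<xi> * (m - p \<xi>) * (cmod (fourier \<psi> \<xi>))\<^sup>2) <
    (LINT x|lborel. W x * (cmod (chi \<psi> x))\<^sup>2)"
proof -
  have L2: "\<psi> \<in> L2" by (rule test_function_L2[OF \<psi>])
  note [measurable] = L2_measurable[OF L2] chi_measurable[OF \<psi>]
  note \<psi>2 = L2_square_integrable[OF L2]
  \<comment> \<open>\<open>X\<close> and \<open>Y\<close> are the forms of \<open>P\<close> and of
    \<open>m - q\<close> at \<open>\<psi>\<close>, \<open>C\<close> is the squared norm of
    \<open>chi \<psi>\<close>, and \<open>Z\<close> is the same norm with weight
    \<open>W\<close>.\<close>
  define X where "X = c0 * (LINT \<xi>|lborel. p \<xi> * (cmod (fourier \<psi> \<xi>))\<^sup>2)"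
  define Y where "Y = (LINT x|lborel. (m - q x) * (cmod (\<psi> x))\<^sup>2)"
  define C where "C = (LINT x|lborel. (cmod (chi \<psi> x))\<^sup>2)"
  define Z where "Z = (LINT x|lborel. W x * (cmod (chi \<psi> x))\<^sup>2)"
  have bounded_mult: "integrable lborel (\<lambda>x. w x * (cmod (\<psi> x))\<^sup>2)"
    if [measurable]: "w \<in> borel_measurable borel" and B: "\<And>x. \<bar>w x\<bar> \<le> B" for w :: "'a \<Rightarrow> real" and B
  proof (rule Bochner_Integration.integrable_bound)
    show "integrable lborel (\<lambda>x. B * (cmod (\<psi> x))\<^sup>2)" using \<psi>2 by simp
    show "AE x in lborel. norm (w x * (cmod (\<psi> x))\<^sup>2) \<le> norm (B * (cmod (\<psi> x))\<^sup>2)"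
      by (intro AE_I2) (auto simp: abs_mult intro!: mult_right_mono order_trans[OF B abs_ge_self])
  qed measurable
  have iY: "integrable lborel (\<lambda>x. (m - q x) * (cmod (\<psi> x))\<^sup>2)"
  proof (rule bounded_mult[where B=m])
    show "\<bar>m - q x\<bar> \<le> m" for x using q_nonneg[of x] q_le[of x] by simp
  qed measurable
  have iv: "integrable lborel (\<lambda>x. (v x + m) * (cmod (\<psi> x))\<^sup>2)"
  proof (rule bounded_mult[where B="M + m"])
    show "\<bar>v x + m\<bar> \<le> M + m" for x using v_bounded[of x] m_pos by linarith
  qed measurable
  have "Y < X"
  proof -
    have "- X \<le> Re (conv_form a \<psi> \<psi>)"
    proof -
      obtain B where B: "\<And>x. cmod (\<psi> x) \<le> B" using test_function_bound[OF \<psi>] by blast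
      have "- (LINT \<xi>|lborel. p \<xi> * (cmod (fourier \<psi> \<xi>))\<^sup>2) \<le>
          (2 * pi) ^ DIM('a) * Re (LINT x|lborel. convolution a \<psi> x * cnj (\<psi> x))"
        unfolding p using \<psi> p_integrable
        by (intro convolution_form_ge[where B=B] a B) (auto simp: test_function_def p)
      then have "c0 * - (LINT \<xi>|lborel. p \<xi> * (cmod (fourier \<psi> \<xi>))\<^sup>2) \<le>
          c0 * ((2 * pi) ^ DIM('a) * Re (conv_form a \<psi> \<psi>))"
        using c0_pos unfolding conv_form_eq_convolution[OF a L2 L2] by (intro mult_left_mono) auto
      then show ?thesis by (simp add: X_def c0_def)
    qed
    moreover have "Y \<le> Re (L2_inner (\<lambda>x. complex_of_real (v x + m) * \<psi> x) \<psi>)"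
    proof -
      have "L2_inner (\<lambda>x. complex_of_real (v x + m) * \<psi> x) \<psi> =
          (LINT x|lborel. complex_of_real ((v x + m) * (cmod (\<psi> x))\<^sup>2))"
        unfolding L2_inner_def of_real_mult[of _ "(cmod _)\<^sup>2"] complex_norm_square by (simp only: mult.assoc)
      then have "Re (L2_inner (\<lambda>x. complex_of_real (v x + m) * \<psi> x) \<psi>) =
          (LINT x|lborel. (v x + m) * (cmod (\<psi> x))\<^sup>2)"
        by (simp only: integral_complex_of_real Re_complex_of_real)
      moreover have "Y \<le> (LINT x|lborel. (v x + m) * (cmod (\<psi> x))\<^sup>2)"
        unfolding Y_def by (intro integral_mono iY iv mult_right_mono) (auto simp: q)
      ultimately show ?thesis by simp
    qed
    ultimately show ?thesis using neg by (simp add: op_form_def)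
  qed
  have "2 * X \<le> (C + Z) / m + Y"
  proof -
    \<comment> \<open>\<open>X\<close> is real and nonnegative, so nothing is lost by passing to the
      modulus.\<close>
    have "X = cmod (LINT x|lborel. chi \<psi> x * cnj (\<psi> x))"
      unfolding integral_chi_mult_cnj[OF \<psi>] X_def[symmetric] norm_of_real
      using c0_pos p_nonneg by (simp add: X_def)
    also have "\<dots> \<le> (LINT x|lborel. cmod (chi \<psi> x * cnj (\<psi> x)))"
      by (rule integral_norm_bound)
    also have "\<dots> \<le> (LINT x|lborel. (((cmod (chi \<psi> x))\<^sup>2 + W x * (cmod (chi \<psi> x))\<^sup>2) / m +
        (m - q x) * (cmod (\<psi> x))\<^sup>2) / 2)"
    proof (rule integral_mono_AE)
      have chiL2: "chi \<psi> \<in> L2" by (intro L2_I integrable_chi_square \<psi>) measurable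
      show "integrable lborel (\<lambda>x. cmod (chi \<psi> x * cnj (\<psi> x)))"
        by (intro integrable_norm L2_integrable_mult_cnj chiL2 L2)
      show "integrable lborel (\<lambda>x. (((cmod (chi \<psi> x))\<^sup>2 + W x * (cmod (chi \<psi> x))\<^sup>2) / m +
        (m - q x) * (cmod (\<psi> x))\<^sup>2) / 2)"
        using integrable_chi_square[OF \<psi>] integrable_W_chi[OF \<psi>] iY by simp
      show "AE x in lborel. cmod (chi \<psi> x * cnj (\<psi> x)) \<le>
        (((cmod (chi \<psi> x))\<^sup>2 + W x * (cmod (chi \<psi> x))\<^sup>2) / m + (m - q x) * (cmod (\<psi> x))\<^sup>2) / 2"
        using q_less
      proof eventually_elim
        case (elim x)
        define s where "s = m - q x"
        have s: "s > 0" using elim by (simp add: s_def)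
        have "0 \<le> (cmod (chi \<psi> x) - s * cmod (\<psi> x))\<^sup>2 / s" using s by simp
        also have "\<dots> = (cmod (chi \<psi> x))\<^sup>2 / s + s * (cmod (\<psi> x))\<^sup>2 - 2 * (cmod (chi \<psi> x) * cmod (\<psi> x))"
          using s by (simp add: power2_eq_square field_simps)
        finally have "2 * (cmod (chi \<psi> x) * cmod (\<psi> x)) \<le> (cmod (chi \<psi> x))\<^sup>2 / s + s * (cmod (\<psi> x))\<^sup>2"
          by simp
        moreover have "(cmod (chi \<psi> x))\<^sup>2 / s = ((cmod (chi \<psi> x))\<^sup>2 + W x * (cmod (chi \<psi> x))\<^sup>2) / m"
        proof -
          have "1 + W x = m / s" using s by (simp add: W_def s_def field_simps)
          then have "(cmod (chi \<psi> x))\<^sup>2 + W x * (cmod (chi \<psi> x))\<^sup>2 = m / s * (cmod (chi \<psi> x))\<^sup>2"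
            by (metis mult_1 distrib_right)
          then show ?thesis using m_pos by simp
        qed
        ultimately show ?case by (simp add: norm_mult s_def)
      qed
    qed
    also have "\<dots> = ((C + Z) / m + Y) / 2"
      unfolding C_def Z_def Y_def
      using integrable_chi_square[OF \<psi>] integrable_W_chi[OF \<psi>] iY by simp
    finally show ?thesis by simp
  qed
  with \<open>Y < X\<close> have "X < (C + Z) / m" by linarith
  then have "m * X - C < Z" using m_pos by (simp add: field_simps)
  moreover have "(LINT \<xi>|lborel. c0 * p \<xi> * (m - p \<xi>) * (cmod (fourier \<psi> \<xi>))\<^sup>2) = m * X - C"
  proof -
    have "(LINT \<xi>|lborel. c0 * p \<xi> * (m - p \<xi>) * (cmod (fourier \<psi> \<xi>))\<^sup>2) =
        (LINT \<xi>|lborel. (m * c0) * (p \<xi> * (cmod (fourier \<psi> \<xi>))\<^sup>2) - c0 * ((p \<xi>)\<^sup>2 * (cmod (fourier \<psi> \<xi>))\<^sup>2))"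
      by (intro Bochner_Integration.integral_cong refl) (simp add: power2_eq_square algebra_simps)
    also have "\<dots> = m * X - C"
      unfolding X_def C_def integral_chi_square[OF \<psi>]
      using integrable_bounded_fourier_square[OF \<psi> p_integrable]
        integrable_bounded_fourier_square[OF \<psi> p_square_integrable] by simp
    finally show ?thesis .
  qed
  ultimately show ?thesis by (simp add: Z_def)
qed

text \<open>The operator taking combinations of \<open>f\<close> to the square root of
  \<open>W\<close> times \<open>chi\<close> strictly increases the norm. Summing the squared norms
  of the images of \<open>n\<close> orthonormal vectors therefore gives at least \<open>n\<close>,
  while Bessel bounds the same sum pointwise in \<open>x\<close>.\<close>

lemma card_neg_family_le:
  assumes \<phi>: "\<And>i. i < n \<Longrightarrow> test_function (\<phi> i)"
    and neg: "\<And>c. \<exists>i<n. c i \<noteq> 0 \<Longrightarrow>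
      Re (op_form a (\<lambda>x. v x + m) (\<lambda>x. \<Sum>i<n. c i * \<phi> i x) (\<lambda>x. \<Sum>i<n. c i * \<phi> i x)) < 0"
  shows "real n \<le> c0 * (LINT \<xi>|lborel. R \<xi>) * (LINT x|lborel. W x)"
proof -
  define f where "f i \<xi> = complex_of_real (sqrt (c0 * p \<xi> * (m - p \<xi>))) * fourier (\<phi> i) \<xi>" for i \<xi>
  \<comment> \<open>This is the kernel for which \<open>chi (\<psi> c) x\<close> is the inner
    product of the combination of \<open>f\<close> with \<open>k x\<close>. Its modulus does not
    depend on \<open>x\<close>, so all \<open>k x\<close> have the same norm.\<close>
  define k where "k x \<xi> = complex_of_real (sqrt (c0 * R \<xi>)) * exp (- (\<i> * complex_of_real (x \<bullet> \<xi>)))" for x \<xi>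
  define \<psi> where "\<psi> c x = (\<Sum>i<n. c i * \<phi> i x)" for c x
  have \<phi>i: "integrable lborel (\<phi> i)" if "i < n" for i
    using \<phi>[OF that] by (simp add: test_function_def)
  have \<psi>: "test_function (\<psi> c)" for c
    unfolding \<psi>_def[abs_def] by (intro test_function_lincomb) (auto intro: \<phi>)
  have nonneg: "0 \<le> c0 * p \<xi> * (m - p \<xi>)" for \<xi>
    using c0_pos p_nonneg[of \<xi>] p_le[of \<xi>] by simp
  have f_\<psi>: "(\<Sum>i<n. c i * f i \<xi>) = complex_of_real (sqrt (c0 * p \<xi> * (m - p \<xi>))) * fourier (\<psi> c) \<xi>" for c \<xi>
    unfolding \<psi>_def[abs_def] by (subst fourier_sum) (auto simp: f_def sum_distrib_left sum_distrib_right ac_simps intro: \<phi>i)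
  have norm_f: "(cmod (complex_of_real (sqrt (c0 * p \<xi> * (m - p \<xi>))) * z))\<^sup>2 =
      c0 * p \<xi> * (m - p \<xi>) * (cmod z)\<^sup>2" for \<xi> z
    using nonneg[of \<xi>] by (simp add: norm_mult power_mult_distrib)
  have weight: "integrable lborel (\<lambda>\<xi>. c0 * p \<xi> * (m - p \<xi>))"
  proof -
    have "integrable lborel (\<lambda>\<xi>. (c0 * m) * p \<xi> - c0 * (p \<xi>)\<^sup>2)"
      using p_integrable p_square_integrable by simp
    then show ?thesis by (simp add: power2_eq_square algebra_simps)
  qed
  have [measurable]: "fourier (\<phi> i) \<in> borel_measurable borel" if "i < n" for i
    by (rule borel_measurable_fourier[OF \<phi>i[OF that]])
  have fL2: "f i \<in> L2" if i: "i < n" for i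
  proof (rule L2_I)
    show "f i \<in> borel_measurable borel" unfolding f_def[abs_def] using i by measurable
    show "integrable lborel (\<lambda>\<xi>. (cmod (f i \<xi>))\<^sup>2)"
      unfolding f_def norm_f by (rule integrable_bounded_fourier_square[OF \<phi>[OF i] weight])
  qed
  have kL2: "k x \<in> L2" and norm_k: "(LINT \<xi>|lborel. (cmod (k x \<xi>))\<^sup>2) = c0 * (LINT \<xi>|lborel. R \<xi>)" for x
  proof -
    have eq: "(cmod (k x \<xi>))\<^sup>2 = c0 * R \<xi>" for \<xi>
      using c0_pos R_nonneg[of \<xi>] by (simp add: k_def norm_mult)
    show "(LINT \<xi>|lborel. (cmod (k x \<xi>))\<^sup>2) = c0 * (LINT \<xi>|lborel. R \<xi>)"
      unfolding eq by simp
    show "k x \<in> L2"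
    proof (rule L2_I)
      show "k x \<in> borel_measurable borel" unfolding k_def[abs_def] by measurable
    qed (use R_integrable in \<open>simp add: eq\<close>)
  qed
  have chi: "chi (\<psi> c) x = L2_inner (\<lambda>\<xi>. \<Sum>i<n. c i * f i \<xi>) (k x)" for c x
  proof -
    have [measurable]: "fourier (\<psi> c) \<in> borel_measurable borel"
      using \<psi>[of c] by (intro borel_measurable_fourier) (simp add: test_function_def)
    have "chi (\<psi> c) x = (LINT \<xi>|lborel. complex_of_real (c0 * p \<xi>) * fourier (\<psi> c) \<xi> *
        exp (\<i> * complex_of_real (x \<bullet> \<xi>)))"
      unfolding chi_def fourier_def[of "\<lambda>\<xi>. complex_of_real (p \<xi>) * fourier (\<psi> c) \<xi>"]
      by (simp add: mult.assoc flip: integral_mult_right_zero)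
    also have "\<dots> = (LINT \<xi>|lborel. complex_of_real (sqrt (c0 * p \<xi> * (m - p \<xi>))) * fourier (\<psi> c) \<xi> * cnj (k x \<xi>))"
    proof (rule integral_cong_AE)
      show "AE \<xi> in lborel. complex_of_real (c0 * p \<xi>) * fourier (\<psi> c) \<xi> * exp (\<i> * complex_of_real (x \<bullet> \<xi>)) =
          complex_of_real (sqrt (c0 * p \<xi> * (m - p \<xi>))) * fourier (\<psi> c) \<xi> * cnj (k x \<xi>)"
        using p_less
      proof eventually_elim
        case (elim \<xi>)
        \<comment> \<open>The factor \<open>m - p\<close> cancels against the denominator of
          \<open>R\<close>; this needs \<open>p < m\<close> and thus holds only almost
          everywhere.\<close>
        have "sqrt (c0 * p \<xi> * (m - p \<xi>)) * sqrt (c0 * R \<xi>) = sqrt ((c0 * p \<xi>)\<^sup>2)"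
        proof -
          have "c0 * p \<xi> * (m - p \<xi>) * (c0 * R \<xi>) = (c0 * p \<xi>)\<^sup>2"
            using elim by (simp add: R_def power2_eq_square ac_simps)
          then show ?thesis by (simp only: real_sqrt_mult[symmetric])
        qed
        also have "\<dots> = c0 * p \<xi>" using c0_pos p_nonneg[of \<xi>] by simp
        finally have "complex_of_real (c0 * p \<xi>) =
            complex_of_real (sqrt (c0 * p \<xi> * (m - p \<xi>))) * complex_of_real (sqrt (c0 * R \<xi>))"
          by (metis of_real_mult)
        moreover have "cnj (k x \<xi>) = complex_of_real (sqrt (c0 * R \<xi>)) * exp (\<i> * complex_of_real (x \<bullet> \<xi>))"
          by (simp add: k_def exp_cnj)
        ultimately show ?case by (simp only: ac_simps)
      qed
      have [measurable]: "k x \<in> borel_measurable borel" by (rule L2_measurable[OF kL2])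
      show "(\<lambda>\<xi>. complex_of_real (sqrt (c0 * p \<xi> * (m - p \<xi>))) * fourier (\<psi> c) \<xi> * cnj (k x \<xi>)) \<in> borel_measurable lborel"
        by measurable
    qed measurable
    finally show ?thesis by (simp add: L2_inner_def f_\<psi>)
  qed
  have less: "(LINT \<xi>|lborel. (cmod (\<Sum>i<n. c i * f i \<xi>))\<^sup>2) < (LINT x|lborel. W x * (cmod (chi (\<psi> c) x))\<^sup>2)"
    if "\<exists>i<n. c i \<noteq> 0" for c
    unfolding f_\<psi> norm_f using weighted_norm_less[OF \<psi>, of c] neg[OF that] by (simp add: \<psi>_def[abs_def])
  \<comment> \<open>Strictness yields independence: a nontrivial combination vanishing almost
    everywhere would make \<open>chi\<close> vanish identically, and the inequality would read
    \<open>0 < 0\<close>.\<close>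
  have "lin_indep_ae n f"
    unfolding lin_indep_ae_def
  proof (intro allI impI)
    fix c i assume 0: "AE \<xi> in lborel. (\<Sum>i<n. c i * f i \<xi>) = 0" and i: "i < n"
    show "c i = 0"
    proof (rule ccontr)
      assume "c i \<noteq> 0"
      with i have "\<exists>i<n. c i \<noteq> 0" by blast
      note less[OF this]
      moreover have "chi (\<psi> c) x = 0" for x
      proof -
        have "L2_inner (\<lambda>\<xi>. \<Sum>i<n. c i * f i \<xi>) (k x) = L2_inner (\<lambda>\<xi>. 0) (k x)"
          by (rule L2_inner_cong_AE[OF 0])
            (auto intro!: L2_measurable L2_lincomb kL2 fL2)
        then show ?thesis unfolding chi by (simp add: L2_inner_def)
      qed
      ultimately have "(LINT \<xi>|lborel. (cmod (\<Sum>i<n. c i * f i \<xi>))\<^sup>2) < 0" by simp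
      moreover have "0 \<le> (LINT \<xi>|lborel. (cmod (\<Sum>i<n. c i * f i \<xi>))\<^sup>2)" by simp
      ultimately show False by linarith
    qed
  qed
  then obtain C where C: "orthonormal_family n (\<lambda>i \<xi>. \<Sum>j<n. C i j * f j \<xi>)"
    using gram_schmidt_ae[of n f] fL2 by blast
  define e where "e i \<xi> = (\<Sum>j<n. C i j * f j \<xi>)" for i \<xi>
  have e: "orthonormal_family n e" using C by (simp add: e_def[abs_def])
  have one: "1 \<le> (LINT x|lborel. W x * (cmod (L2_inner (k x) (e i)))\<^sup>2)"
    and int: "integrable lborel (\<lambda>x. W x * (cmod (L2_inner (k x) (e i)))\<^sup>2)" if i: "i < n" for i
  proof -
    have "L2_inner (e i) (e i) = 1" using e i by (simp add: orthonormal_family_def)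
    then have e1: "(LINT \<xi>|lborel. (cmod (e i \<xi>))\<^sup>2) = 1"
      by (simp only: L2_inner_self of_real_eq_1_iff)
    have "\<exists>j<n. C i j \<noteq> 0"
    proof (rule ccontr)
      assume "\<not> (\<exists>j<n. C i j \<noteq> 0)"
      then have "e i \<xi> = 0" for \<xi> by (simp add: e_def)
      with e1 show False by simp
    qed
    from less[OF this] e1 have "1 < (LINT x|lborel. W x * (cmod (chi (\<psi> (C i)) x))\<^sup>2)"
      by (simp add: e_def)
    moreover have eq: "cmod (chi (\<psi> (C i)) x) = cmod (L2_inner (k x) (e i))" for x
      unfolding chi e_def[abs_def, symmetric] by (subst L2_inner_cnj) (simp add: e_def[abs_def])
    ultimately show "1 \<le> (LINT x|lborel. W x * (cmod (L2_inner (k x) (e i)))\<^sup>2)" by simp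
    show "integrable lborel (\<lambda>x. W x * (cmod (L2_inner (k x) (e i)))\<^sup>2)"
      using integrable_W_chi[OF \<psi>[of "C i"]] by (simp add: eq)
  qed
  have "real n = (\<Sum>i<n. 1)" by simp
  also have "\<dots> \<le> (\<Sum>i<n. LINT x|lborel. W x * (cmod (L2_inner (k x) (e i)))\<^sup>2)"
    by (intro sum_mono one) simp
  also have "\<dots> = (LINT x|lborel. (\<Sum>i<n. W x * (cmod (L2_inner (k x) (e i)))\<^sup>2))"
    by (rule Bochner_Integration.integral_sum[symmetric]) (auto intro: int)
  \<comment> \<open>For fixed \<open>x\<close> the sum is that of Bessel's inequality for
    \<open>k x\<close>.\<close>
  also have "\<dots> \<le> (LINT x|lborel. W x * (c0 * (LINT \<xi>|lborel. R \<xi>)))"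
  proof (rule integral_mono)
    show "(\<Sum>i<n. W x * (cmod (L2_inner (k x) (e i)))\<^sup>2) \<le> W x * (c0 * (LINT \<xi>|lborel. R \<xi>))" for x
      using bessel_inequality[OF e kL2[of x]] W_nonneg[of x]
      by (simp add: norm_k sum_distrib_left[symmetric] mult_left_mono)
  qed (use W_integrable in \<open>auto intro!: Bochner_Integration.integrable_sum int\<close>)
  also have "\<dots> = c0 * (LINT \<xi>|lborel. R \<xi>) * (LINT x|lborel. W x)" by simp
  finally show ?thesis .
qed

end


section \<open>Counting eigenvalues\<close>

lemma eigenspace_L2: "u \<in> eigenspace T l \<Longrightarrow> u \<in> L2"
  by (simp add: eigenspace_def)

text \<open>The eigenvalue equation holds only almost everywhere; paired with \<open>w\<close> it
  becomes an identity between numbers, via the iterated form of \<open>conv_form\<close>.\<close>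

lemma op_form_eigenspace:
  fixes a u w :: "'a::euclidean_space \<Rightarrow> complex" and v :: "'a \<Rightarrow> real"
  assumes a: "integrable lborel a" and [measurable]: "v \<in> borel_measurable borel"
    and M: "\<And>x. \<bar>v x + m\<bar> \<le> M"
    and u: "u \<in> eigenspace (conv_pot_op a (\<lambda>x. complex_of_real (v x))) (complex_of_real l)" and w: "w \<in> L2"
  shows "op_form a (\<lambda>x. v x + m) u w = complex_of_real (l + m) * L2_inner u w"
proof -
  have uL: "u \<in> L2" by (rule eigenspace_L2[OF u])
  note [measurable] = L2_measurable[OF uL] L2_measurable[OF w]
  have [measurable]: "a \<in> borel_measurable borel" using borel_measurable_integrable[OF a] by simp
  have vu: "(\<lambda>x. complex_of_real (v x + m) * u x) \<in> L2"
    by (rule L2_bounded_mult[OF uL _ M]) measurable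
  have "op_form a (\<lambda>x. v x + m) u w =
      (LINT x|lborel. convolution a u x * cnj (w x) + complex_of_real (v x + m) * u x * cnj (w x))"
    unfolding op_form_def conv_form_eq_convolution[OF a uL w] L2_inner_def
    by (rule Bochner_Integration.integral_add[symmetric])
      (rule integrable_convolution_mult_cnj[OF a uL w], rule L2_integrable_mult_cnj[OF vu w])
  also have "\<dots> = (LINT x|lborel. complex_of_real (l + m) * (u x * cnj (w x)))"
  proof (rule integral_cong_AE)
    have "AE x in lborel. conv_pot_op a (\<lambda>x. complex_of_real (v x)) u x = complex_of_real l * u x"
      using u by (simp add: eigenspace_def)
    then show "AE x in lborel. convolution a u x * cnj (w x) + complex_of_real (v x + m) * u x * cnj (w x) =
        complex_of_real (l + m) * (u x * cnj (w x))"
    proof eventually_elim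
      case (elim x)
      then have "convolution a u x + complex_of_real (v x) * u x = complex_of_real l * u x"
        by (simp add: conv_pot_op_def convolution_def)
      then have "convolution a u x = complex_of_real l * u x - complex_of_real (v x) * u x"
        by (simp add: algebra_simps)
      then show ?case by (simp only:) (simp add: algebra_simps)
    qed
  qed measurable
  finally show ?thesis by (simp add: L2_inner_def)
qed

text \<open>Orthonormal bases inside each eigenspace, together with orthogonality between
  eigenspaces, diagonalise the shifted form with entries \<open>l + m < 0\<close>. This is the
  situation in which \<open>op_form_neg_on_test_functions\<close> applies.\<close>

lemma negative_family_from_eigenspaces:
  fixes a :: "'a::euclidean_space \<Rightarrow> complex" and v :: "'a \<Rightarrow> real"
  assumes a: "integrable lborel a" and sym: "hermitian_ae a"
    and v: "v \<in> borel_measurable borel" and M: "\<And>x. \<bar>v x + m\<bar> \<le> M"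
    and F: "finite F" "\<And>l. l \<in> F \<Longrightarrow> l < - m"
    and f: "\<And>l k. l \<in> F \<Longrightarrow> k < N l \<Longrightarrow>
      f l k \<in> eigenspace (conv_pot_op a (\<lambda>x. complex_of_real (v x))) (complex_of_real l)"
    and indep: "\<And>l. l \<in> F \<Longrightarrow> lin_indep_ae (N l) (f l)"
  obtains \<phi> where "\<And>i. i < (\<Sum>l\<in>F. N l) \<Longrightarrow> test_function (\<phi> i)"
    "\<And>c. \<exists>i<(\<Sum>l\<in>F. N l). c i \<noteq> 0 \<Longrightarrow>
      Re (op_form a (\<lambda>x. v x + m) (\<lambda>x. \<Sum>i<(\<Sum>l\<in>F. N l). c i * \<phi> i x)
        (\<lambda>x. \<Sum>i<(\<Sum>l\<in>F. N l). c i * \<phi> i x)) < 0"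
proof -
  let ?W = "\<lambda>x. v x + m"
  have W: "?W \<in> borel_measurable borel" using v by measurable
  have fL: "f l k \<in> L2" if "l \<in> F" "k < N l" for l k
    by (rule eigenspace_L2[OF f[OF that]])
  have "\<forall>l. \<exists>C. l \<in> F \<longrightarrow> orthonormal_family (N l) (\<lambda>i x. \<Sum>k<N l. C i k * f l k x)"
  proof
    fix l
    show "\<exists>C. l \<in> F \<longrightarrow> orthonormal_family (N l) (\<lambda>i x. \<Sum>k<N l. C i k * f l k x)"
    proof (cases "l \<in> F")
      case True
      from gram_schmidt_ae[OF fL[OF True] indep[OF True]] show ?thesis by simp
    qed simp
  qed
  from choice[OF this] obtain C
    where C: "\<And>l. l \<in> F \<Longrightarrow> orthonormal_family (N l) (\<lambda>i x. \<Sum>k<N l. C l i k * f l k x)"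
    by blast
  define e where "e l i x = (\<Sum>k<N l. C l i k * f l k x)" for l i x
  have e: "orthonormal_family (N l) (e l)" if "l \<in> F" for l
    using C[OF that] by (simp add: e_def[abs_def])
  have eL: "e l i \<in> L2" if "l \<in> F" "i < N l" for l i
    using e[OF that(1)] that(2) by (simp add: orthonormal_family_def)
  have form: "op_form a ?W (e l i) w = complex_of_real (l + m) * L2_inner (e l i) w"
    if "l \<in> F" "w \<in> L2" for l i w
  proof -
    have "op_form a ?W (e l i) w = (\<Sum>k<N l. C l i k * op_form a ?W (f l k) w)"
      unfolding e_def[abs_def] by (rule op_form_sum_left[OF a W M]) (use fL that in auto)
    also have "\<dots> = (\<Sum>k<N l. C l i k * (complex_of_real (l + m) * L2_inner (f l k) w))"
      using op_form_eigenspace[OF a v M f that(2)] that(1) by (intro sum.cong refl) auto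
    also have "\<dots> = complex_of_real (l + m) * (\<Sum>k<N l. C l i k * L2_inner (f l k) w)"
      by (simp add: sum_distrib_left ac_simps)
    also have "(\<Sum>k<N l. C l i k * L2_inner (f l k) w) = L2_inner (e l i) w"
      unfolding e_def[abs_def] by (rule L2_inner_sum_left[symmetric]) (use fL that in auto)
    finally show ?thesis .
  qed
  \<comment> \<open>By Hermitian symmetry the same inner product is multiplied by
    \<open>l + m\<close> and by \<open>l' + m\<close>, which are distinct and real.\<close>
  have orth: "L2_inner (e l i) (e l' j) = 0"
    if "l \<in> F" "l' \<in> F" "l \<noteq> l'" "i < N l" "j < N l'" for l l' i j
  proof -
    have "complex_of_real (l + m) * L2_inner (e l i) (e l' j) = op_form a ?W (e l i) (e l' j)"
      by (rule form[OF that(1) eL[OF that(2,5)], symmetric])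
    also have "\<dots> = cnj (op_form a ?W (e l' j) (e l i))"
      by (rule op_form_hermitian[OF a sym eL[OF that(2,5)] eL[OF that(1,4)]])
    also have "\<dots> = complex_of_real (l' + m) * L2_inner (e l i) (e l' j)"
      by (simp add: form[OF that(2) eL[OF that(1,4)]] L2_inner_cnj[of "e l i", symmetric])
    finally have "complex_of_real (l + m) = complex_of_real (l' + m) \<or> L2_inner (e l i) (e l' j) = 0"
      unfolding mult_cancel_right by (rule disj_commute[THEN iffD1])
    with that(3) show ?thesis by (simp only: of_real_eq_iff) simp
  qed
  define n where "n = (\<Sum>l\<in>F. N l)"
  have "card (Sigma F (\<lambda>l. {..<N l})) = n" using F(1) by (simp add: n_def)
  \<comment> \<open>\<open>h\<close> enumerates the disjoint union of the index sets, so that the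
    bases of all eigenspaces form a single family.\<close>
  then obtain h where h: "bij_betw h {..<n} (Sigma F (\<lambda>l. {..<N l}))"
    using F(1) by (metis bij_betw_from_nat_into_finite ex_bij_betw_nat_finite atLeast0LessThan finite_SigmaI finite_lessThan)
  have hF: "fst (h i) \<in> F" "snd (h i) < N (fst (h i))" if "i < n" for i
  proof -
    have "(fst (h i), snd (h i)) \<in> Sigma F (\<lambda>l. {..<N l})"
      using bij_betw_apply[OF h, of i] that by simp
    then show "fst (h i) \<in> F" "snd (h i) < N (fst (h i))"
      by (simp_all only: mem_Sigma_iff lessThan_iff)
  qed
  define u where "u i = e (fst (h i)) (snd (h i))" for i
  have uL: "u i \<in> L2" if "i < n" for i
    unfolding u_def by (rule eL[OF hF[OF that]])
  have inner: "L2_inner (u i) (u j) = (if i = j then 1 else 0)" if i: "i < n" and j: "j < n" for i j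
  proof (cases "fst (h i) = fst (h j)")
    case True
    have "h i = h j \<longleftrightarrow> i = j" using bij_betw_imp_inj_on[OF h] i j by (auto simp: inj_on_eq_iff)
    then have "snd (h i) = snd (h j) \<longleftrightarrow> i = j" using True by (metis prod_eqI)
    then show ?thesis
      using e[OF hF(1)[OF i]] hF[OF i] hF[OF j] True by (simp add: u_def orthonormal_family_def)
  next
    case False
    then show ?thesis using orth[OF hF(1)[OF i] hF(1)[OF j] False hF(2)[OF i] hF(2)[OF j]]
      by (auto simp: u_def)
  qed
  show thesis
  proof (rule op_form_neg_on_test_functions[OF a W M, of n u "\<lambda>i. fst (h i) + m"])
    fix i assume i: "i < n"
    show "u i \<in> L2" by (rule uL[OF i])
    have "L2_inner (u i) (u i) = 1" using inner[OF i i] by simp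
    then show "(LINT x|lborel. (cmod (u i x))\<^sup>2) = 1"
      by (simp only: L2_inner_self of_real_eq_1_iff)
    show "fst (h i) + m < 0" using F(2)[OF hF(1)[OF i]] by simp
    fix j assume j: "j < n"
    show "op_form a ?W (u i) (u j) = (if i = j then complex_of_real (fst (h i) + m) else 0)"
      using form[OF hF(1)[OF i] uL[OF j], of "snd (h i)"] inner[OF i j] by (simp add: u_def)
  next
    fix \<phi>
    assume "\<And>i. i < n \<Longrightarrow> test_function (\<phi> i)"
      "\<And>c. \<exists>i<n. c i \<noteq> 0 \<Longrightarrow>
        Re (op_form a ?W (\<lambda>x. \<Sum>i<n. c i * \<phi> i x) (\<lambda>x. \<Sum>i<n. c i * \<phi> i x)) < 0"
    then show thesis unfolding n_def by (rule that)
  qed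
qed

text \<open>Serves the degenerate case \<open>m \<le> 0\<close>. The negative part of the symbol
  vanishes, so \<open>convolution_form_ge\<close> gives nonnegativity of the convolution
  term.\<close>

lemma op_form_nonneg:
  fixes a :: "'a::euclidean_space \<Rightarrow> complex"
  assumes a: "integrable lborel a" and pos: "\<And>\<xi>. 0 \<le> Re (fourier a \<xi>)" and W: "\<And>x. 0 \<le> W x"
    and \<psi>: "test_function \<psi>"
  shows "0 \<le> Re (op_form a W \<psi> \<psi>)"
proof -
  have L2: "\<psi> \<in> L2" by (rule test_function_L2[OF \<psi>])
  obtain B where B: "\<And>x. cmod (\<psi> x) \<le> B" using test_function_bound[OF \<psi>] by blast
  have p: "minus_part (fourier a) = (\<lambda>\<xi>. 0)" using pos by (auto simp: minus_part_def)
  have "0 \<le> (2 * pi) ^ DIM('a) * Re (LINT x|lborel. convolution a \<psi> x * cnj (\<psi> x))"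
    using convolution_form_ge[OF a _ _ _ B] \<psi> by (simp add: p test_function_def)
  moreover have "0 \<le> c * t \<Longrightarrow> 0 < c \<Longrightarrow> 0 \<le> t" for c t :: real
    by (simp add: zero_le_mult_iff)
  ultimately have "0 \<le> Re (conv_form a \<psi> \<psi>)"
    unfolding conv_form_eq_convolution[OF a L2 L2] by (metis zero_less_power pi_gt_zero mult_pos_pos zero_less_numeral)
  moreover have "L2_inner (\<lambda>x. complex_of_real (W x) * \<psi> x) \<psi> =
      (LINT x|lborel. complex_of_real (W x * (cmod (\<psi> x))\<^sup>2))"
    unfolding L2_inner_def of_real_mult[of _ "(cmod _)\<^sup>2"] complex_norm_square by (simp only: mult.assoc)
  then have "Re (L2_inner (\<lambda>x. complex_of_real (W x) * \<psi> x) \<psi>) = (LINT x|lborel. W x * (cmod (\<psi> x))\<^sup>2)"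
    by (simp only: integral_complex_of_real Re_complex_of_real)
  moreover have "0 \<le> (LINT x|lborel. W x * (cmod (\<psi> x))\<^sup>2)" using W by simp
  ultimately show ?thesis by (simp add: op_form_def)
qed

text \<open>Reduces the count to finite families. Their uniform bound makes each multiplicity
  finite, hence attained by some independent family, and bounds all finite partial sums of the
  infinite sum.\<close>

lemma num_eigenvalues_below_le:
  assumes bound: "\<And>F N f. finite F \<Longrightarrow> (\<And>l. l \<in> F \<Longrightarrow> l < b) \<Longrightarrow>
      (\<And>l k. l \<in> F \<Longrightarrow> k < N l \<Longrightarrow> f l k \<in> eigenspace T (complex_of_real l)) \<Longrightarrow>
      (\<And>l. l \<in> F \<Longrightarrow> lin_indep_ae (N l) (f l)) \<Longrightarrow> real (\<Sum>l\<in>F. N l) \<le> r"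
  shows "ereal_of_enat (num_eigenvalues_below T b) \<le> ereal r"
proof -
  \<comment> \<open>The count is extended natural, the bound real; the integer part allows
    comparison among natural numbers.\<close>
  define B where "B = nat \<lfloor>r\<rfloor>"
  have "0 \<le> r" using bound[of "{}"] by simp
  then have B: "real n \<le> r \<longleftrightarrow> n \<le> B" for n
    by (simp add: B_def le_nat_iff le_floor_iff)
  have attained: "\<exists>n f. multiplicity_ev T (complex_of_real l) = enat n \<and>
      (\<forall>i<n. f i \<in> eigenspace T (complex_of_real l)) \<and> lin_indep_ae n f" if l: "l < b" for l
  proof -
    let ?A = "{enat n |n. \<exists>f. (\<forall>i<n. f i \<in> eigenspace T (complex_of_real l)) \<and> lin_indep_ae n f}"
    \<comment> \<open>The hypothesis for a single eigenvalue bounds its multiplicity, so the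
      supremum is a maximum.\<close>
    have "?A \<subseteq> enat ` {..B}"
    proof safe
      fix n f assume "\<forall>i<n. f i \<in> eigenspace T (complex_of_real l)" "lin_indep_ae n f"
      then have "real (\<Sum>l\<in>{l}. n) \<le> r"
        using l by (intro bound[where f="\<lambda>_. f"]) auto
      then show "enat n \<in> enat ` {..B}" using B by simp
    qed
    then have fin: "finite ?A" by (rule finite_subset) simp
    have "enat 0 \<in> ?A" by (auto simp: lin_indep_ae_def)
    then have ne: "?A \<noteq> {}" by blast
    have "Sup ?A = Max ?A" by (simp only: Sup_enat_def ne fin if_False if_True)
    with Max_in[OF fin ne] have "Sup ?A \<in> ?A" by (simp only:)
    then show ?thesis unfolding multiplicity_ev_def by blast
  qed
  then obtain N f where N: "\<And>l. l < b \<Longrightarrow> multiplicity_ev T (complex_of_real l) = enat (N l)"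
    and f: "\<And>l i. l < b \<Longrightarrow> i < N l \<Longrightarrow> f l i \<in> eigenspace T (complex_of_real l)"
    and indep: "\<And>l. l < b \<Longrightarrow> lin_indep_ae (N l) (f l)"
    by metis
  have "num_eigenvalues_below T b \<le> enat B"
    unfolding num_eigenvalues_below_def
  proof (rule infsum_le_finite_sums)
    fix F assume F: "finite F" "F \<subseteq> {l. l < b \<and> eigenvalue T (complex_of_real l)}"
    then have "real (\<Sum>l\<in>F. N l) \<le> r"
      by (intro bound[where f=f]) (auto intro: f indep)
    then have "(\<Sum>l\<in>F. N l) \<le> B" using B by blast
    moreover have "(\<Sum>l\<in>F. multiplicity_ev T (complex_of_real l)) = (\<Sum>l\<in>F. enat (N l))"
      using F(2) by (intro sum.cong refl N) auto
    moreover have "\<dots> = enat (\<Sum>l\<in>F. N l)"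
      using F(1) by (induction F) (auto simp: zero_enat_def)
    ultimately show "(\<Sum>l\<in>F. multiplicity_ev T (complex_of_real l)) \<le> enat B" by simp
  qed simp
  then have "ereal_of_enat (num_eigenvalues_below T b) \<le> ereal_of_enat (enat B)"
    by (simp only: ereal_of_enat_le_iff)
  also have "\<dots> \<le> ereal r" using B[of B] by simp
  finally show ?thesis .
qed

section \<open>Integrals with values in \<open>[-\<infinity>, 0]\<close> and the final
  estimate\<close>

lemma nonpos_integral_le_0: "nonpos_integral g \<le> 0"
  by (simp add: nonpos_integral_def)

text \<open>The quotient is infinite where \<open>g\<close> attains \<open>m\<close>, so a finite
  integral forces that set to be null. Elsewhere changing the sign of the denominator gives a
  nonnegative real quotient.\<close>

lemma
  fixes g :: "'a::euclidean_space \<Rightarrow> real"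
  assumes [measurable]: "g \<in> borel_measurable borel" and m: "m > 0"
    and g0: "\<And>x. 0 \<le> g x" and gm: "\<And>x. g x \<le> m"
    and fin: "nonpos_integral (\<lambda>x. ext_quot (g x) (- m)) \<noteq> - \<infinity>"
  shows ext_quot_AE_less: "AE x in lborel. g x < m"
    and ext_quot_integrable: "integrable lborel (\<lambda>x. g x / (m - g x))"
    and nonpos_integral_ext_quot: "nonpos_integral (\<lambda>x. ext_quot (g x) (- m)) =
      - ereal (LINT x|lborel. g x / (m - g x))"
proof -
  \<comment> \<open>\<open>m > 0\<close> is essential here: where \<open>g x = m\<close>, the
    numerator is nonzero and \<open>ext_quot\<close> is infinite rather than 0.\<close>
  define G where "G x = (if g x = m then \<infinity> else ennreal (g x / (m - g x)))" for x
  have [measurable]: "G \<in> borel_measurable borel" unfolding G_def[abs_def] by measurable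
  have eq: "e2ennreal (- ext_quot (g x) (- m)) = G x" for x
  proof -
    have "- (g x / (g x - m)) = g x / (m - g x)" by (metis minus_diff_eq minus_divide_right)
    then show ?thesis using m by (auto simp: ext_quot_def G_def zero_ereal_def)
  qed
  have int: "nonpos_integral (\<lambda>x. ext_quot (g x) (- m)) = - enn2ereal (\<integral>\<^sup>+x. G x \<partial>lborel)"
    by (simp add: nonpos_integral_def eq)
  then have nn: "(\<integral>\<^sup>+x. G x \<partial>lborel) \<noteq> \<infinity>" using fin by auto
  then have "AE x in lborel. G x \<noteq> \<infinity>" by (intro nn_integral_PInf_AE) simp_all
  then show AE: "AE x in lborel. g x < m"
    by eventually_elim (use gm in \<open>auto simp: G_def less_le split: if_splits\<close>)
  have "(\<integral>\<^sup>+x. G x \<partial>lborel) = (\<integral>\<^sup>+x. ennreal (g x / (m - g x)) \<partial>lborel)"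
    by (rule nn_integral_cong_AE) (use AE in eventually_elim, simp add: G_def)
  moreover have nonneg: "0 \<le> g x / (m - g x)" for x using g0[of x] gm[of x] by simp
  ultimately show i: "integrable lborel (\<lambda>x. g x / (m - g x))"
    using nn by (intro integrableI_nonneg) (auto simp: top.not_eq_extremum)
  have "(\<integral>\<^sup>+x. ennreal (g x / (m - g x)) \<partial>lborel) = ennreal (LINT x|lborel. g x / (m - g x))"
    by (rule nn_integral_eq_integral[OF i]) (simp add: nonneg)
  then show "nonpos_integral (\<lambda>x. ext_quot (g x) (- m)) = - ereal (LINT x|lborel. g x / (m - g x))"
    using \<open>(\<integral>\<^sup>+x. G x \<partial>lborel) = _\<close> nonneg by (simp add: int enn2ereal_ennreal)
qed

text \<open>A real \<open>INF\<close> is a lower bound only for a set bounded below; this is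
  guaranteed by the L1 norm of \<open>u\<close>.\<close>

lemma inf_val_fourier_le:
  assumes "integrable lborel u"
  shows "inf_val (fourier u) \<le> Re (fourier u x)"
proof -
  have "bdd_below (range (\<lambda>x. Re (fourier u x)))"
  proof (rule bdd_belowI2)
    show "- (LINT \<xi>|lborel. cmod (u \<xi>)) \<le> Re (fourier u x)" for x
      using cmod_fourier_le[of u x] abs_Re_le_cmod[of "fourier u x"] by linarith
  qed
  then show ?thesis unfolding inf_val_def by (intro cINF_lower) auto
qed

theorem theorem2p8:
  fixes a V V_hat :: "real ^ 'n \<Rightarrow> complex" and \<mu>\<^sub>0 a_min V_min :: real
  assumes a_L1: "integrable lborel a" and a_sym: "hermitian_ae a"
    and V_hat_L1: "integrable lborel V_hat" and V_hat_sym: "hermitian_ae V_hat"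
    and V: "V = fourier V_hat"
    and a_min: "a_min = inf_val (fourier a)"
    and V_min: "V_min = inf_val V"
    and mu0: "\<mu>\<^sub>0 = min a_min V_min"
    and mu0_V_min: "\<mu>\<^sub>0 = V_min"
    and V_min_le: "V_min \<le> a_min"
    and I_V_finite: "\<bar>I_V V\<bar> \<noteq> \<infinity>"
    and I_a_finite: "\<bar>I_a a V\<bar> \<noteq> \<infinity>"
  shows "ereal_of_enat (num_eigenvalues_below (conv_pot_op a V) \<mu>\<^sub>0) \<le> I_a a V * I_V V"
proof -
  define v where "v x = Re (V x)" for x
  define m where "m = - V_min"
  define A where "A = (LINT \<xi>|lborel. cmod (V_hat \<xi>))"
  have Vv: "V = (\<lambda>x. complex_of_real (v x))"
    unfolding v_def V using fourier_hermitian_real[OF V_hat_L1 V_hat_sym] by blast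
  have [measurable]: "v \<in> borel_measurable borel"
    unfolding v_def[abs_def] V using borel_measurable_fourier[OF V_hat_L1] by measurable
  have v_bounded: "\<bar>v x\<bar> \<le> A" for x
    using cmod_fourier_le[of V_hat x] abs_Re_le_cmod[of "fourier V_hat x"] by (simp add: v_def V A_def)
  have v_ge: "- m \<le> v x" for x
    using inf_val_fourier_le[OF V_hat_L1] by (simp add: m_def V_min V v_def)
  have a_ge: "- m \<le> Re (fourier a \<xi>)" for \<xi>
    using inf_val_fourier_le[OF a_L1, of \<xi>] V_min_le by (simp add: m_def a_min)
  have W_bounded: "\<bar>v x + m\<bar> \<le> A + \<bar>m\<bar>" for x using v_bounded[of x] by linarith
  have inf_V: "inf_val V = - m" by (simp add: m_def V_min)
  define S where "S = nonpos_integral (\<lambda>\<xi>. ext_quot (minus_part (fourier a) \<xi>) (- m))"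
  have I_a: "I_a a V = ereal (1 / (2 * pi) ^ DIM(real ^ 'n)) * S"
    by (simp add: I_a_def S_def inf_V)
  \<comment> \<open>The prefactor of \<open>S\<close> is positive, so an infinite \<open>S\<close>
    would make \<open>I_a\<close> infinite.\<close>
  have S_finite: "S \<noteq> - \<infinity>"
    using I_a_finite unfolding I_a by auto
  have "I_V V \<le> 0" unfolding I_V_def by (rule nonpos_integral_le_0)
  then obtain x where x: "I_V V = ereal x" "x \<le> 0" using I_V_finite by (cases "I_V V") auto
  have "S \<le> 0" unfolding S_def by (rule nonpos_integral_le_0)
  then obtain y where y: "S = ereal y" "y \<le> 0" using S_finite by (cases S) auto
  define r where "r = (1 / (2 * pi) ^ DIM(real ^ 'n)) * y * x"
  have r: "I_a a V * I_V V = ereal r" unfolding I_a x y r_def by simp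
  have r0: "0 \<le> r" unfolding r_def using x(2) y(2)
    by (simp add: mult_nonpos_nonpos zero_le_divide_iff)
  show ?thesis
    unfolding r mu0_V_min
  proof (rule num_eigenvalues_below_le)
    fix F :: "real set" and N :: "real \<Rightarrow> nat" and f
    assume F: "finite F" "\<And>l. l \<in> F \<Longrightarrow> l < V_min"
      and f: "\<And>l k. l \<in> F \<Longrightarrow> k < N l \<Longrightarrow> f l k \<in> eigenspace (conv_pot_op a V) (complex_of_real l)"
      and indep: "\<And>l. l \<in> F \<Longrightarrow> lin_indep_ae (N l) (f l)"
    define n where "n = (\<Sum>l\<in>F. N l)"
    have F': "l < - m" if "l \<in> F" for l using F(2)[OF that] by (simp add: m_def)
    obtain \<phi> where \<phi>: "\<And>i. i < n \<Longrightarrow> test_function (\<phi> i)"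
      and neg: "\<And>c. \<exists>i<n. c i \<noteq> 0 \<Longrightarrow>
        Re (op_form a (\<lambda>x. v x + m) (\<lambda>x. \<Sum>i<n. c i * \<phi> i x) (\<lambda>x. \<Sum>i<n. c i * \<phi> i x)) < 0"
      unfolding n_def
      using negative_family_from_eigenspaces[OF a_L1 a_sym _ W_bounded F(1) F' f[unfolded Vv] indep] by auto
    have "real n \<le> r"
    \<comment> \<open>The Birman-Schwinger bound divides by \<open>m\<close>. If
      \<open>m \<le> 0\<close>, the shifted form is nonnegative and no eigenvalue has to be
      counted.\<close>
    proof (cases "m > 0")
      case True
      define q where "q = minus_part V"
      let ?p = "minus_part (fourier a)"
      have p_le: "?p \<xi> \<le> m" for \<xi> using a_ge[of \<xi>] True by (simp add: minus_part_def)
      have q_le: "q x \<le> m" for x using v_ge[of x] True by (simp add: q_def minus_part_def v_def)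
      have q: "q x = - min 0 (v x)" for x by (simp add: q_def minus_part_def v_def)
      have p0: "0 \<le> ?p \<xi>" and q0: "0 \<le> q x" for \<xi> x by (simp_all add: minus_part_def q)
      have pm: "?p \<in> borel_measurable borel"
        unfolding minus_part_def[abs_def] using borel_measurable_fourier[OF a_L1] by measurable
      have qm: "q \<in> borel_measurable borel"
        unfolding q[abs_def] by measurable
      have I_V: "I_V V = nonpos_integral (\<lambda>x. ext_quot (q x) (- m))"
        by (simp add: I_V_def inf_V q_def)
      have I_V_finite': "nonpos_integral (\<lambda>x. ext_quot (q x) (- m)) \<noteq> - \<infinity>"
        using x(1) unfolding I_V by simp
      note P = pm True p0 p_le S_finite[unfolded S_def] and Q = qm True q0 q_le I_V_finite'
      interpret birman_schwinger a v ?p q m A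
        by unfold_locales (use a_L1 v_bounded True q p_le q_le ext_quot_AE_less[OF P] ext_quot_AE_less[OF Q]
          ext_quot_integrable[OF P] ext_quot_integrable[OF Q] in auto)
      have "real n \<le> c0 * (LINT \<xi>|lborel. R \<xi>) * (LINT x|lborel. W x)"
        by (rule card_neg_family_le[OF \<phi> neg])
      also have "\<dots> = r"
      proof -
        \<comment> \<open>Both extended integrals are the negatives of the real ones, and the two
          signs cancel in the product.\<close>
        have "y = - (LINT \<xi>|lborel. R \<xi>)"
          using nonpos_integral_ext_quot[OF P] y(1) by (simp add: S_def R_def)
        moreover have "x = - (LINT x|lborel. W x)"
          using nonpos_integral_ext_quot[OF Q] x(1) by (simp add: I_V W_def)
        ultimately show ?thesis by (simp add: r_def c0_def)
      qed
      finally show ?thesis .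
    next
      case False
      \<comment> \<open>A nonempty family would make the form negative at the sum of its members,
        although the symbol of \<open>a\<close> and \<open>v + m\<close> are nonnegative.\<close>
      have "n = 0"
      proof (rule ccontr)
        assume "n \<noteq> 0"
        then have "\<exists>i<n. (1::complex) \<noteq> 0" by auto
        from neg[OF this] have "Re (op_form a (\<lambda>x. v x + m) (\<lambda>x. \<Sum>i<n. 1 * \<phi> i x) (\<lambda>x. \<Sum>i<n. 1 * \<phi> i x)) < 0" .
        moreover have "0 \<le> Re (op_form a (\<lambda>x. v x + m) (\<lambda>x. \<Sum>i<n. 1 * \<phi> i x) (\<lambda>x. \<Sum>i<n. 1 * \<phi> i x))"
        proof (rule op_form_nonneg[OF a_L1])
          show "0 \<le> Re (fourier a \<xi>)" for \<xi> using a_ge[of \<xi>] False by simp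
          show "0 \<le> v x + m" for x using v_ge[of x] by simp
          show "test_function (\<lambda>x. \<Sum>i<n. 1 * \<phi> i x)"
            by (rule test_function_lincomb) (simp add: \<phi>)
        qed
        ultimately show False by linarith
      qed
      then show ?thesis using r0 by simp
    qed
    then show "real (\<Sum>l\<in>F. N l) \<le> r" by (simp add: n_def)
  qed
qed

end
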